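(* Let $N$ be a $4$-manifold, $\kappa\in\widetilde\Omega^2_2(N)$ and $p\in N$. Suppose (a) $\kappa$ is skewon-free at $p$, (b) $\kappa$ is invertible at $p$, and (c) the Fresnel surface $F_p(\kappa)$ does not contain a two-dimensional vector subspace of $T^*_pN$. Then there exist coordinates $\{x^i\}_{i=0}^3$ around $p$ in which the $6\times 6$ matrix representing $\kappa|_p$ is one of the following seven matrices (written row by row): Metaclass I: $(\alpha_1,0,0,-\beta_1,0,0)$, $(0,\alpha_2,0,0,-\beta_2,0)$, $(0,0,\alpha_3,0,0,-\beta_3)$, $(\beta_1,0,0,\alpha_1,0,0)$, $(0,\beta_2,0,0,\alpha_2,0)$, $(0,0,\beta_3,0,0,\alpha_3)$; Metaclass II: $(\alpha_1,-\beta_1,0,0,0,0)$, $(\beta_1,\alpha_1,0,0,0,0)$, $(0,0,\alpha_2,0,0,-\beta_2)$, $(0,1,0,\alpha_1,\beta_1,0)$, $(1,0,0,-\beta_1,\alpha_1,0)$, $(0,0,\beta_2,0,0,\alpha_2)$; Metaclass III: $(\alpha_1,-\beta_1,0,0,0,0)$, $(\beta_1,\alpha_1,0,0,0,0)$, $(1,0,\alpha_1,0,0,-\beta_1)$, $(0,0,0,\alpha_1,\beta_1,1)$, $(0,0,1,-\beta_1,\alpha_1,0)$, $(0,1,\beta_1,0,0,\alpha_1)$; Metaclass IV: $(\alpha_1,0,0,-\beta_1,0,0)$, $(0,\alpha_2,0,0,-\beta_2,0)$, $(0,0,\alpha_3,0,0,\alpha_4)$, $(\beta_1,0,0,\alpha_1,0,0)$,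 $(0,\beta_2,0,0,\alpha_2,0)$, $(0,0,\alpha_4,0,0,\alpha_3)$; Metaclass V: $(\alpha_1,-\beta_1,0,0,0,0)$, $(\beta_1,\alpha_1,0,0,0,0)$, $(0,0,\alpha_2,0,0,\alpha_3)$, $(0,1,0,\alpha_1,\beta_1,0)$, $(1,0,0,-\beta_1,\alpha_1,0)$, $(0,0,\alpha_3,0,0,\alpha_2)$; Metaclass VI: $(\alpha_1,0,0,-\beta_1,0,0)$, $(0,\alpha_2,0,0,\alpha_4,0)$, $(0,0,\alpha_3,0,0,\alpha_5)$, $(\beta_1,0,0,\alpha_1,0,0)$, $(0,\alpha_4,0,0,\alpha_2,0)$, $(0,0,\alpha_5,0,0,\alpha_3)$; Metaclass VII: $(\alpha_1,0,0,\alpha_4,0,0)$, $(0,\alpha_2,0,0,\alpha_5,0)$, $(0,0,\alpha_3,0,0,\alpha_6)$, $(\alpha_4,0,0,\alpha_1,0,0)$, $(0,\alpha_5,0,0,\alpha_2,0)$, $(0,0,\alpha_6,0,0,\alpha_3)$. In each matrix the parameters satisfy $\alpha_1,\alpha_2,\ldots\in\mathbb R$, $\beta_1,\beta_2,\ldots\in\mathbb R\setminus\{0\}$, and $\operatorname{sgn}\beta_1=\operatorname{sgn}\beta_2=\cdots$.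
   Context: Let $N$ be a smooth 4-manifold; Einstein summation is used, indices run over $0,1,2,3$; $\varepsilon_{ijkl},\varepsilon^{ijkl}$ are Levi-Civita permutation symbols. Twisted tensors transform like ordinary tensors with an extra factor $\operatorname{sgn}\det(\partial x^a/\partial\tilde x^b)$. $\widetilde\Omega^2_2(N)$ is the space of twisted tensor fields written in each chart as $\kappa=\frac18\kappa^{ij}_{rs}\,dx^r\wedge dx^s\otimes\partial_i\wedge\partial_j$ with components antisymmetric in $ij$ and in $rs$; $\kappa$ acts on 2-forms by $\kappa(\frac12F_{ij}dx^i\wedge dx^j)=\frac12G_{ij}dx^i\wedge dx^j$, $G_{ij}=\frac12\kappa^{ab}_{ij}F_{ab}$. $\kappa$ is invertible at $p$ if this linear map on 2-forms at $p$ has nonzero determinant. $\kappa$ is skewon-free at $p$ if $u\wedge\kappa(v)=\kappa(u)\wedge v$ for all 2-forms $u,v$ at $p$. Matrix representation: let $O=(01,02,03,23,31,12)$ be the ordered list of index pairs, identified with $1,\dots,6$ in this order; the matrix representing $\kappa|_p$ in a chart has entry in row $I$, column $J$ equal to $\kappa^{J_1J_2}_{I_1I_2}$, so that $\kappa(dx^{J_1}\wedge dx^{J_2})=\sum_{I\in O}\kappa^{J_1J_2}_{I_1I_2}\,dx^{I_1}\wedge dx^{I_2}$. Fresnel surface: in a chart set $\mathcal G_0^{ijkl}=\frac1{48}\kappa^{a_1a_2}_{b_1b_2}\kappa^{a_3i}_{b_3b_4}\kappa^{a_4j}_{b_5b_6}\varepsilon^{b_1b_2b_5k}\varepsilon^{b_3b_4b_6l}\varepsilon_{a_1a_2a_3a_4}$;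 then $F_p(\kappa)=\{\xi\in T^*_pN:\mathcal G_0^{ijkl}\xi_i\xi_j\xi_k\xi_l=0\}$ (independent of the chart). *)

theory Defs
  imports "Jordan_Normal_Form.Determinant"
begin

text \<open>Pointwise (linear-algebraic) setting at a point p of a 4-manifold.
  A twisted (2,2)-tensor at p is given in a chart by its components
  K i j r s = kappa^{ij}_{rs}, indices 0..3 (nat, only values < 4 matter).\<close>

definition idx4 :: "nat set" where "idx4 = {..<4}"

definition levi :: "nat \<Rightarrow> nat \<Rightarrow> nat \<Rightarrow> nat \<Rightarrow> real" where
  "levi i j k l =
     (if i < 4 \<and> j < 4 \<and> k < 4 \<and> l < 4 then
        sgn (real j - real i) * sgn (real k - real i) * sgn (real l - real i) *
        sgn (real k - real j) * sgn (real l - real j) * sgn (real l - real k)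
      else 0)"

definition antisym_components :: "(nat \<Rightarrow> nat \<Rightarrow> nat \<Rightarrow> nat \<Rightarrow> real) \<Rightarrow> bool" where
  "antisym_components K \<longleftrightarrow>
     (\<forall>i<4. \<forall>j<4. \<forall>r<4. \<forall>s<4. K i j r s = - K j i r s \<and> K i j r s = - K i j s r)"

definition two_form :: "(nat \<Rightarrow> nat \<Rightarrow> real) \<Rightarrow> bool" where
  "two_form F \<longleftrightarrow> (\<forall>i<4. \<forall>j<4. F i j = - F j i)"

definition kappa_act :: "(nat \<Rightarrow> nat \<Rightarrow> nat \<Rightarrow> nat \<Rightarrow> real) \<Rightarrow> (nat \<Rightarrow> nat \<Rightarrow> real) \<Rightarrow> nat \<Rightarrow> nat \<Rightarrow> real" where
  "kappa_act K F i j = (1/2) * (\<Sum>a\<in>idx4. \<Sum>b\<in>idx4. K a b i j * F a b)"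

text \<open>Coefficient of dx^0/\dx^1/\dx^2/\dx^3 in the wedge of two 2-forms.\<close>
definition wedge22 :: "(nat \<Rightarrow> nat \<Rightarrow> real) \<Rightarrow> (nat \<Rightarrow> nat \<Rightarrow> real) \<Rightarrow> real" where
  "wedge22 u w = (1/4) * (\<Sum>i\<in>idx4. \<Sum>j\<in>idx4. \<Sum>k\<in>idx4. \<Sum>l\<in>idx4.
                       levi i j k l * u i j * w k l)"

definition skewon_free :: "(nat \<Rightarrow> nat \<Rightarrow> nat \<Rightarrow> nat \<Rightarrow> real) \<Rightarrow> bool" where
  "skewon_free K \<longleftrightarrow> (\<forall>u v. two_form u \<longrightarrow> two_form v \<longrightarrow>
       wedge22 u (kappa_act K v) = wedge22 (kappa_act K u) v)"

definition pairsO :: "(nat \<times> nat) list" where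
  "pairsO = [(0,1),(0,2),(0,3),(2,3),(3,1),(1,2)]"

definition kappa_matrix :: "(nat \<Rightarrow> nat \<Rightarrow> nat \<Rightarrow> nat \<Rightarrow> real) \<Rightarrow> real mat" where
  "kappa_matrix K = mat 6 6 (\<lambda>(I,J). K (fst (pairsO ! J)) (snd (pairsO ! J))
                                         (fst (pairsO ! I)) (snd (pairsO ! I)))"

definition kappa_invertible :: "(nat \<Rightarrow> nat \<Rightarrow> nat \<Rightarrow> nat \<Rightarrow> real) \<Rightarrow> bool" where
  "kappa_invertible K \<longleftrightarrow> det (kappa_matrix K) \<noteq> 0"

definition fresnel_G0 :: "(nat \<Rightarrow> nat \<Rightarrow> nat \<Rightarrow> nat \<Rightarrow> real) \<Rightarrow> nat \<Rightarrow> nat \<Rightarrow> nat \<Rightarrow> nat \<Rightarrow> real" where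
  "fresnel_G0 K i j k l = (1/48) *
     (\<Sum>a1\<in>idx4. \<Sum>a2\<in>idx4. \<Sum>a3\<in>idx4. \<Sum>a4\<in>idx4.
      \<Sum>b1\<in>idx4. \<Sum>b2\<in>idx4. \<Sum>b3\<in>idx4. \<Sum>b4\<in>idx4. \<Sum>b5\<in>idx4. \<Sum>b6\<in>idx4.
        K a1 a2 b1 b2 * K a3 i b3 b4 * K a4 j b5 b6 *
        levi b1 b2 b5 k * levi b3 b4 b6 l * levi a1 a2 a3 a4)"

definition in_fresnel :: "(nat \<Rightarrow> nat \<Rightarrow> nat \<Rightarrow> nat \<Rightarrow> real) \<Rightarrow> (nat \<Rightarrow> real) \<Rightarrow> bool" where
  "in_fresnel K \<xi> \<longleftrightarrow>
     (\<Sum>i\<in>idx4. \<Sum>j\<in>idx4. \<Sum>k\<in>idx4. \<Sum>l\<in>idx4.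
        fresnel_G0 K i j k l * \<xi> i * \<xi> j * \<xi> k * \<xi> l) = 0"

text \<open>A two-dimensional subspace of T*_p N is the span of two linearly independent covectors.\<close>
definition lin_indep2 :: "(nat \<Rightarrow> real) \<Rightarrow> (nat \<Rightarrow> real) \<Rightarrow> bool" where
  "lin_indep2 \<xi> \<eta> \<longleftrightarrow> (\<forall>a b. (\<forall>i<4. a * \<xi> i + b * \<eta> i = 0) \<longrightarrow> a = 0 \<and> b = 0)"

definition fresnel_contains_plane :: "(nat \<Rightarrow> nat \<Rightarrow> nat \<Rightarrow> nat \<Rightarrow> real) \<Rightarrow> bool" where
  "fresnel_contains_plane K \<longleftrightarrow>
     (\<exists>\<xi> \<eta>. lin_indep2 \<xi> \<eta> \<and> (\<forall>a b. in_fresnel K (\<lambda>i. a * \<xi> i + b * \<eta> i)))"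

text \<open>Components of a twisted (2,2)-tensor in new coordinates x~, where
  P = (dx^a/dx~^r) at p (row a, column r) and Q = P^{-1} = (dx~^i/dx^a).\<close>
definition twisted_transform ::
  "real mat \<Rightarrow> real mat \<Rightarrow> (nat \<Rightarrow> nat \<Rightarrow> nat \<Rightarrow> nat \<Rightarrow> real) \<Rightarrow> nat \<Rightarrow> nat \<Rightarrow> nat \<Rightarrow> nat \<Rightarrow> real" where
  "twisted_transform P Q K i j r s = sgn (det P) *
     (\<Sum>a\<in>idx4. \<Sum>b\<in>idx4. \<Sum>c\<in>idx4. \<Sum>d\<in>idx4.
        Q $$ (i,a) * Q $$ (j,b) * P $$ (c,r) * P $$ (d,s) * K a b c d)"

definition same_sign :: "real list \<Rightarrow> bool" where
  "same_sign bs \<longleftrightarrow> (\<forall>b\<in>set bs. b \<noteq> 0) \<and> (\<forall>b\<in>set bs. \<forall>c\<in>set bs. sgn b = sgn c)"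

definition metaclass_normal_form :: "real mat \<Rightarrow> bool" where
  "metaclass_normal_form M \<longleftrightarrow>
   (\<exists>a1 a2 a3 b1 b2 b3. same_sign [b1,b2,b3] \<and> M = mat_of_rows_list 6
      [[a1,0,0,-b1,0,0],[0,a2,0,0,-b2,0],[0,0,a3,0,0,-b3],
       [b1,0,0,a1,0,0],[0,b2,0,0,a2,0],[0,0,b3,0,0,a3]]) \<or>
   (\<exists>a1 a2 b1 b2. same_sign [b1,b2] \<and> M = mat_of_rows_list 6
      [[a1,-b1,0,0,0,0],[b1,a1,0,0,0,0],[0,0,a2,0,0,-b2],
       [0,1,0,a1,b1,0],[1,0,0,-b1,a1,0],[0,0,b2,0,0,a2]]) \<or>
   (\<exists>a1 b1. same_sign [b1] \<and> M = mat_of_rows_list 6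
      [[a1,-b1,0,0,0,0],[b1,a1,0,0,0,0],[1,0,a1,0,0,-b1],
       [0,0,0,a1,b1,1],[0,0,1,-b1,a1,0],[0,1,b1,0,0,a1]]) \<or>
   (\<exists>a1 a2 a3 a4 b1 b2. same_sign [b1,b2] \<and> M = mat_of_rows_list 6
      [[a1,0,0,-b1,0,0],[0,a2,0,0,-b2,0],[0,0,a3,0,0,a4],
       [b1,0,0,a1,0,0],[0,b2,0,0,a2,0],[0,0,a4,0,0,a3]]) \<or>
   (\<exists>a1 a2 a3 b1. same_sign [b1] \<and> M = mat_of_rows_list 6
      [[a1,-b1,0,0,0,0],[b1,a1,0,0,0,0],[0,0,a2,0,0,a3],
       [0,1,0,a1,b1,0],[1,0,0,-b1,a1,0],[0,0,a3,0,0,a2]]) \<or>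
   (\<exists>a1 a2 a3 a4 a5 b1. same_sign [b1] \<and> M = mat_of_rows_list 6
      [[a1,0,0,-b1,0,0],[0,a2,0,0,a4,0],[0,0,a3,0,0,a5],
       [b1,0,0,a1,0,0],[0,a4,0,0,a2,0],[0,0,a5,0,0,a3]]) \<or>
   (\<exists>a1 a2 a3 a4 a5 a6. M = mat_of_rows_list 6
      [[a1,0,0,a4,0,0],[0,a2,0,0,a5,0],[0,0,a3,0,0,a6],
       [a4,0,0,a1,0,0],[0,a5,0,0,a2,0],[0,0,a6,0,0,a3]])"

end

theory Submission
  imports Defs
    "HOL-Analysis.Linear_Algebra"
    "HOL-Computational_Algebra.Fundamental_Theorem_Algebra"
begin

text \<open>
  The map \<open>\<kappa>\<close> is self-adjoint for the wedge product on 2-forms, which has signature (3, 3). A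
  null eigenvector \<open>\<xi> \<and> \<eta>\<close> of \<open>\<kappa>\<close> would put the plane spanned by \<open>\<xi>\<close> and
  \<open>\<eta>\<close> into the Fresnel surface, so every real eigenvector can be normalised and split off
  orthogonally. A non-real eigenvalue \<open>\<mu>\<close> with positive imaginary part contributes a Jordan chain
  \<open>u, N u, \<dots>, N\<^sup>m\<^sup>-\<^sup>1 u\<close>, where \<open>N = \<kappa> - \<mu>\<close>; after normalisation its real and
  imaginary parts span a subspace of signature \<open>(m, m)\<close>, so the chain lengths add up to at most 3.
  The possible combinations of chains and pairs of real eigenvectors give bases \<open>f\<^sub>1, \<dots>, f\<^sub>6\<close> of
  hyperbolic pairs \<open>(f\<^sub>i, f\<^sub>i\<^sub>+\<^sub>3)\<close> in which \<open>\<kappa>\<close> has one of the seven forms.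

  Such a basis comes, up to a scalar, from a coframe if and only if \<open>f\<^sub>1, f\<^sub>2, f\<^sub>3\<close> have a common
  linear factor. If they have not, then exchanging \<open>f\<^sub>3\<close> and \<open>f\<^sub>6\<close>, or another odd exchange that
  preserves the normal form up to the signs of all the imaginary parts, gives a basis that does.
\<close>

section \<open>Complexification of a self-adjoint map\<close>

text \<open>A pair \<open>(x, y)\<close> stands for \<open>x + i y\<close>. Jordan theory enters
  only through a list of scalars whose shifts compose to zero; it supplies the eigenvectors and
  keeps the form nondegenerate on generalised eigenspaces.

  The obstacle is that maximal null subspaces of 2-forms come in two families: the multiples of one
  covector, and the 2-forms on a three-dimensional space of covectors. A coframe always puts its
  first three products into the first family, while an algebraic normal form may land in the second.
  An isometry of determinant -1 exchanges the families. It costs nothing when a real plane is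
  present, since such a plane is symmetric in its two vectors; in Metaclasses I, II and III it
  reverses all imaginary parts. This is why imaginary parts that conjugation has made positive are
  only promised a common sign.

  The scalar relating basis and coframe is harmless: scaling a basis does not change the matrix of a
  linear map. Its square is the determinant of the coframe, so the sign in the twisted
  transformation law is +1.\<close>

definition cscale :: "complex \<Rightarrow> 'a \<times> 'a \<Rightarrow> 'a \<times> 'a::real_vector" where
  "cscale c z = (Re c *\<^sub>R fst z - Im c *\<^sub>R snd z, Re c *\<^sub>R snd z + Im c *\<^sub>R fst z)"

interpretation cvs: vector_space cscale
  by unfold_locales (auto simp: cscale_def algebra_simps prod_eq_iff)

definition conjp :: "'a \<times> 'a \<Rightarrow> 'a \<times> 'a::real_vector" where
  "conjp z = (fst z, - snd z)"

text \<open>Stated for a family rather than a set because the iterates \<open>(k ^^ i) v\<close> to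
  which it is applied may repeat; a repetition is itself a nontrivial relation.\<close>

lemma linear_combination_eq_0:
  fixes f :: "nat \<Rightarrow> 'a::euclidean_space"
  shows "\<exists>c. (\<exists>i\<le>DIM('a). c i \<noteq> 0) \<and> (\<Sum>i\<le>DIM('a). c i *\<^sub>R f i) = 0"
proof (cases "inj_on f {..DIM('a)}")
  case True
  then have "card (f ` {..DIM('a)}) = Suc (DIM('a))"
    by (simp add: card_image)
  then have "dependent (f ` {..DIM('a)})"
    using dependent_biggerset[of "f ` {..DIM('a)}"] by simp
  then obtain u v where uv: "v \<in> f ` {..DIM('a)}" "u v \<noteq> 0"
      "(\<Sum>v\<in>f ` {..DIM('a)}. u v *\<^sub>R v) = 0"
    using dependent_finite[of "f ` {..DIM('a)}"] by auto
  from uv(3) have "(\<Sum>i\<le>DIM('a). u (f i) *\<^sub>R f i) = 0"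
    by (simp add: sum.reindex[OF True] o_def)
  with uv(1,2) show ?thesis
    by (intro exI[of _ "\<lambda>i. u (f i)"]) auto
next
  case False
  then obtain i j where ij: "i \<le> DIM('a)" "j \<le> DIM('a)" "i \<noteq> j" "f i = f j"
    by (auto simp: inj_on_def)
  define c where "c = (\<lambda>l. (if l = i then 1 else 0) - (if l = j then 1 else (0::real)))"
  have "(\<Sum>l\<le>DIM('a). c l *\<^sub>R f l)
      = (\<Sum>l\<le>DIM('a). if l = i then f l else 0) - (\<Sum>l\<le>DIM('a). if l = j then f l else 0)"
    unfolding sum_subtractf[symmetric] by (rule sum.cong) (auto simp: c_def)
  also have "\<dots> = 0"
    using ij by simp
  finally show ?thesis
    using ij by (intro exI[of _ c]) (auto simp: c_def)
qed

locale selfadjoint_pair =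
  fixes B :: "'a::euclidean_space \<Rightarrow> 'a \<Rightarrow> real" and k :: "'a \<Rightarrow> 'a"
  assumes bilinear: "bilinear B"
    and sym: "B x y = B y x"
    and lin: "linear k"
    and selfadj: "B (k x) y = B x (k y)"
begin

lemmas B_simps = bilinear_ladd[OF bilinear] bilinear_radd[OF bilinear]
  bilinear_lmul[OF bilinear] bilinear_rmul[OF bilinear] bilinear_lneg[OF bilinear]
  bilinear_rneg[OF bilinear] bilinear_lzero[OF bilinear] bilinear_rzero[OF bilinear]
  bilinear_lsub[OF bilinear] bilinear_rsub[OF bilinear]

lemmas k_simps = linear_add[OF lin] linear_diff[OF lin] linear_cmul[OF lin] linear_0[OF lin]
  linear_neg[OF lin]

text \<open>The extension is complex bilinear, not Hermitian: then every \<open>shift \<mu>\<close>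
  is self-adjoint, and values of the form can be normalised by complex square roots.\<close>

definition BC :: "'a \<times> 'a \<Rightarrow> 'a \<times> 'a \<Rightarrow> complex" where
  "BC z w = Complex (B (fst z) (fst w) - B (snd z) (snd w)) (B (fst z) (snd w) + B (snd z) (fst w))"

definition kC :: "'a \<times> 'a \<Rightarrow> 'a \<times> 'a" where
  "kC z = (k (fst z), k (snd z))"

definition shift :: "complex \<Rightarrow> 'a \<times> 'a \<Rightarrow> 'a \<times> 'a" where
  "shift \<mu> z = kC z - cscale \<mu> z"

abbreviation shifts :: "complex list \<Rightarrow> 'a \<times> 'a \<Rightarrow> 'a \<times> 'a" where
  "shifts \<equiv> foldr shift"

lemma BC_sym: "BC z w = BC w z"
  by (simp add: BC_def sym add.commute)

lemma BC_add_left: "BC (z + z') w = BC z w + BC z' w"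
  and BC_diff_left: "BC (z - z') w = BC z w - BC z' w"
  and BC_scale_left: "BC (cscale c z) w = c * BC z w"
  and BC_zero_left: "BC 0 w = 0"
  by (auto simp: BC_def complex_eq_iff B_simps cscale_def algebra_simps)

lemma BC_add_right: "BC w (z + z') = BC w z + BC w z'"
  and BC_diff_right: "BC w (z - z') = BC w z - BC w z'"
  and BC_scale_right: "BC w (cscale c z) = c * BC w z"
  and BC_zero_right: "BC w 0 = 0"
  by (simp_all add: BC_sym[of w] BC_add_left BC_diff_left BC_scale_left BC_zero_left)

lemmas BC_simps = BC_add_left BC_diff_left BC_scale_left BC_zero_left
  BC_add_right BC_diff_right BC_scale_right BC_zero_right

lemma kC_add: "kC (z + w) = kC z + kC w"
  and kC_diff: "kC (z - w) = kC z - kC w"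
  and kC_scale: "kC (cscale c z) = cscale c (kC z)"
  and kC_zero: "kC 0 = 0"
  by (auto simp: kC_def cscale_def k_simps prod_eq_iff)

lemma shift_add: "shift \<mu> (z + w) = shift \<mu> z + shift \<mu> w"
  and shift_scale: "shift \<mu> (cscale c z) = cscale c (shift \<mu> z)"
  and shift_zero: "shift \<mu> 0 = 0"
  by (simp_all add: shift_def kC_add kC_diff kC_scale kC_zero cvs.scale_right_distrib
      cvs.scale_right_diff_distrib mult.commute)

lemma shift_commute: "shift \<mu> (shift \<nu> z) = shift \<nu> (shift \<mu> z)"
  by (simp add: shift_def kC_add kC_diff kC_scale cvs.scale_right_diff_distrib mult.commute)

lemma BC_shift: "BC (shift \<mu> z) w = BC z (shift \<mu> w)"
proof -
  have "BC (kC z) w = BC z (kC w)"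
    by (simp add: BC_def kC_def selfadj)
  then show ?thesis
    by (simp add: shift_def BC_simps)
qed

lemma shifts_add: "shifts ms (z + w) = shifts ms z + shifts ms w"
  by (induction ms) (auto simp: shift_add)

lemma shifts_scale: "shifts ms (cscale c z) = cscale c (shifts ms z)"
  by (induction ms) (auto simp: shift_scale)

lemma shifts_zero: "shifts ms 0 = 0"
  by (induction ms) (auto simp: shift_zero)

lemma shift_shifts_commute: "shift \<mu> (shifts ms z) = shifts ms (shift \<mu> z)"
  by (induction ms) (auto simp: shift_commute)

lemma shifts_commute: "shifts ms (shifts ns z) = shifts ns (shifts ms z)"
  by (induction ms) (auto simp: shift_shifts_commute)

lemma BC_shifts: "BC (shifts ms z) w = BC z (shifts ms w)"
  by (induction ms arbitrary: z w) (auto simp: BC_shift shift_shifts_commute)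

subsection \<open>An annihilating product of shifts\<close>

text \<open>The vector \<open>p(kC) z\<close>, computed by Horner's scheme.\<close>

definition ev :: "complex poly \<Rightarrow> 'a \<times> 'a \<Rightarrow> 'a \<times> 'a" where
  "ev p z = fold_coeffs (\<lambda>c w. cscale c z + kC w) p 0"

lemma ev_0 [simp]: "ev 0 z = 0"
  by (simp add: ev_def)

lemma ev_pCons: "ev (pCons c p) z = cscale c z + kC (ev p z)"
  by (cases "c = 0 \<and> p = 0") (auto simp: ev_def kC_zero)

lemma ev_smult: "ev (smult c p) z = cscale c (ev p z)"
  by (induction p) (auto simp: ev_pCons cvs.scale_right_distrib kC_scale)

lemma ev_add: "ev (p + q) z = ev p z + ev q z"
proof (induction p arbitrary: q)
  case (pCons a p)
  obtain b r where "q = pCons b r"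
    by (cases q) auto
  then show ?case
    by (simp add: ev_pCons pCons.IH cvs.scale_left_distrib kC_add)
qed simp

lemma ev_linear_factor: "ev ([:- \<mu>, 1:] * p) z = shift \<mu> (ev p z)"
proof -
  have "[:- \<mu>, 1:] * p = smult (- \<mu>) p + pCons 0 p"
    by simp
  then show ?thesis
    by (simp only: ev_add ev_smult ev_pCons) (simp add: shift_def)
qed

lemma ev_monom: "ev (monom c n) z = cscale c ((kC ^^ n) z)"
  by (induction n) (auto simp: monom_0 monom_Suc ev_pCons kC_scale kC_zero)

lemma ev_sum: "ev (sum p I) z = (\<Sum>i\<in>I. ev (p i) z)"
  by (induction I rule: infinite_finite_induct) (auto simp: ev_add)

text \<open>Over the complex numbers \<open>p\<close> splits; each root is stripped off as one
  shift, which is passed on to \<open>z\<close>, until a nonzero constant remains.\<close>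

lemma shifts_of_ev_eq_0:
  assumes "p \<noteq> 0" "ev p z = 0"
  shows "\<exists>ms. shifts ms z = 0"
  using assms
proof (induction "degree p" arbitrary: p z)
  case 0
  then obtain c where "p = [:c:]" "c \<noteq> 0"
    by (metis degree_eq_zeroE pCons_0_0)
  with 0 have "z = 0"
    by (simp add: ev_pCons kC_zero)
  then show ?case
    by (intro exI[of _ "[]"]) simp
next
  case (Suc n)
  then obtain \<mu> where "poly p \<mu> = 0"
    using fundamental_theorem_of_algebra[of p] constant_degree[of p] by auto
  then obtain q where q: "p = [:- \<mu>, 1:] * q"
    by (auto simp: poly_eq_0_iff_dvd)
  with Suc.prems have "q \<noteq> 0"
    by auto
  moreover have "degree q = n"
    using \<open>q \<noteq> 0\<close> Suc.hyps(2) degree_mult_eq[of "[:- \<mu>, 1:]" q] unfolding q by simp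
  moreover have "ev q (shift \<mu> z) = shift \<mu> (ev q z)" for q
    by (induction q) (auto simp: ev_pCons shift_add shift_scale shift_zero shift_def kC_diff
        kC_scale cvs.scale_right_diff_distrib cvs.scale_right_distrib kC_add kC_zero mult.commute)
  then have "ev q (shift \<mu> z) = 0"
    using Suc.prems(2) by (simp add: q ev_linear_factor del: mult_pCons_left)
  ultimately obtain ms where "shifts ms (shift \<mu> z) = 0"
    using Suc.hyps(1) by blast
  then show ?case
    by (intro exI[of _ "\<mu> # ms"]) (simp add: shift_shifts_commute)
qed

text \<open>Among the first DIM + 1 iterates of \<open>v\<close> there is a linear relation, that
  is, a nonzero polynomial in \<open>k\<close> that kills \<open>v\<close>.\<close>

lemma shifts_real_vector: "\<exists>ms. shifts ms (v, 0) = 0"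
proof -
  obtain c where c: "\<exists>i\<le>DIM('a). c i \<noteq> 0" "(\<Sum>i\<le>DIM('a). c i *\<^sub>R ((k ^^ i) v)) = 0"
    using linear_combination_eq_0[of "\<lambda>i. (k ^^ i) v"] by blast
  define p where "p = (\<Sum>i\<le>DIM('a). monom (of_real (c i)) i :: complex poly)"
  have "coeff p i = of_real (c i)" if "i \<le> DIM('a)" for i
    using that by (simp add: p_def coeff_sum coeff_monom)
  with c(1) have "p \<noteq> 0"
    by (metis coeff_0 of_real_eq_0_iff)
  moreover have "(kC ^^ i) (v, 0) = ((k ^^ i) v, 0)" for i
    by (induction i) (auto simp: kC_def k_simps)
  then have "ev p (v, 0) = (\<Sum>i\<le>DIM('a). (c i *\<^sub>R ((k ^^ i) v), 0))"
    by (simp add: p_def ev_sum ev_monom cscale_def)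
  then have "ev p (v, 0) = 0"
    using c(2) by (simp add: prod_eq_iff fst_sum snd_sum)
  ultimately show ?thesis
    by (rule shifts_of_ev_eq_0)
qed

text \<open>Shifts commute, so concatenating the lists found for the basis vectors kills all of them
  at once. The result serves as a characteristic polynomial that is already split into linear
  factors.\<close>

lemma ex_annihilator: "\<exists>ms. \<forall>z. shifts ms z = 0"
proof -
  have "\<exists>ms. \<forall>b\<in>S. shifts ms (b, 0) = 0" if "finite S" for S
    using that
  proof (induction S)
    case (insert b S)
    then obtain ms ns where "\<forall>b\<in>S. shifts ms (b, 0) = 0" "shifts ns (b, 0) = 0"
      using shifts_real_vector by blast
    moreover from this have "shifts (ms @ ns) (x, 0) = 0" if "x \<in> S" for x
      using that shifts_commute[of ms ns "(x, 0)"] by (simp add: shifts_zero)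
    ultimately have "\<forall>b\<in>insert b S. shifts (ms @ ns) (b, 0) = 0"
      by (auto simp: shifts_zero)
    then show ?case
      by blast
  qed simp
  from this[OF finite_Basis] obtain ms where ms: "\<forall>b\<in>Basis. shifts ms (b, 0) = 0"
    by blast
  have "linear (\<lambda>x. shifts ms (x, 0))"
  proof (rule linearI)
    show "shifts ms (x + y, 0) = shifts ms (x, 0) + shifts ms (y, 0)" for x y
      using shifts_add[of ms "(x, 0)" "(y, 0)"] by simp
    show "shifts ms (r *\<^sub>R x, 0) = r *\<^sub>R shifts ms (x, 0)" for r x
      using shifts_scale[of ms "of_real r" "(x, 0)"] by (simp add: cscale_def prod_eq_iff)
  qed
  then have real: "shifts ms (x, 0) = 0" for x
    using linear_eq_stdbasis[of "\<lambda>x. shifts ms (x, 0)" "\<lambda>_. 0"] ms by (auto simp: module_hom_zero fun_eq_iff)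
  have "shifts ms z = 0" for z
  proof -
    have "z = (fst z, 0) + cscale \<i> (snd z, 0)"
      by (simp add: cscale_def prod_eq_iff)
    then show ?thesis
      by (metis real shifts_add shifts_scale cvs.scale_zero_right add_0)
  qed
  then show ?thesis
    by blast
qed

end

subsection \<open>Jordan chains normalised by the bilinear form\<close>

context selfadjoint_pair
begin

definition nondegenerate_on :: "'a set \<Rightarrow> bool" where
  "nondegenerate_on U \<longleftrightarrow> (\<forall>x\<in>U. (\<forall>y\<in>U. B x y = 0) \<longrightarrow> x = 0)"

definition invariant_subspace :: "'a set \<Rightarrow> bool" where
  "invariant_subspace U \<longleftrightarrow> subspace U \<and> (\<forall>x\<in>U. k x \<in> U)"

lemma complexified_closed:
  assumes "invariant_subspace U" "z \<in> U \<times> U" "w \<in> U \<times> U"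
  shows "cscale c z \<in> U \<times> U" "z + w \<in> U \<times> U" "shift \<mu> z \<in> U \<times> U"
    "(shift \<mu> ^^ n) z \<in> U \<times> U" "shifts ms z \<in> U \<times> U"
proof -
  have *: "cscale c z \<in> U \<times> U" if "z \<in> U \<times> U" for c z
    using assms(1) that by (auto simp: invariant_subspace_def cscale_def
        intro!: subspace_add subspace_diff subspace_scale)
  then show "cscale c z \<in> U \<times> U"
    using assms(2) by blast
  show "z + w \<in> U \<times> U"
    using assms subspace_add[of U] by (auto simp: invariant_subspace_def)
  have **: "shift \<mu> z \<in> U \<times> U" if "z \<in> U \<times> U" for \<mu> z
    using *[OF that, of \<mu>] assms(1) that
    by (auto simp: shift_def kC_def invariant_subspace_def mem_Times_iff intro!: subspace_diff)
  then show "shift \<mu> z \<in> U \<times> U"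
    using assms(2) by blast
  show "(shift \<mu> ^^ n) z \<in> U \<times> U"
    using assms(2) ** by (induction n) auto
  show "shifts ms z \<in> U \<times> U"
    using assms(2) ** by (induction ms) auto
qed

lemma shift_power_add: "(shift \<mu> ^^ n) (z + w) = (shift \<mu> ^^ n) z + (shift \<mu> ^^ n) w"
  by (induction n) (auto simp: shift_add)

lemma shift_power_scale: "(shift \<mu> ^^ n) (cscale c z) = cscale c ((shift \<mu> ^^ n) z)"
  by (induction n) (auto simp: shift_scale)

lemma shift_power_zero: "(shift \<mu> ^^ n) 0 = 0"
  by (induction n) (auto simp: shift_zero)

lemma shift_power_eq_0_mono: "(shift \<mu> ^^ n) z = 0 \<Longrightarrow> n \<le> m \<Longrightarrow> (shift \<mu> ^^ m) z = 0"
  by (metis shift_power_zero funpow_add le_iff_add add.commute o_apply)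

lemma shift_power_shifts_commute: "(shift \<mu> ^^ n) (shifts ms z) = shifts ms ((shift \<mu> ^^ n) z)"
  by (induction n) (auto simp: shift_shifts_commute)

lemma BC_shift_power: "BC ((shift \<mu> ^^ n) z) w = BC z ((shift \<mu> ^^ n) w)"
proof (induction n arbitrary: w)
  case (Suc n)
  have "BC ((shift \<mu> ^^ Suc n) z) w = BC z ((shift \<mu> ^^ n) (shift \<mu> w))"
    by (simp only: funpow.simps o_apply BC_shift Suc)
  then show ?case
    by (simp only: funpow_Suc_right o_apply)
qed simp

lemma shift_power_power: "(shift \<mu> ^^ a) ((shift \<mu> ^^ b) z) = (shift \<mu> ^^ (a + b)) z"
  by (simp add: funpow_add)

lemma BC_shift_power_power:
  "BC ((shift \<mu> ^^ a) z) ((shift \<mu> ^^ b) w) = BC ((shift \<mu> ^^ (a + b)) z) w"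
  by (metis BC_shift_power shift_power_power add.commute)

lemma shift_eigen: "shift \<mu> z = 0 \<Longrightarrow> shift \<nu> z = cscale (\<mu> - \<nu>) z"
  by (simp add: shift_def cvs.scale_left_diff_distrib)

text \<open>Apply the shifts of an annihilating list to \<open>(x, 0)\<close> one after another: the
  last vector before the first zero is an eigenvector, and invariance keeps it inside
  \<open>U \<times> U\<close>.\<close>

lemma ex_eigenvector:
  assumes "invariant_subspace U" "x \<in> U" "x \<noteq> 0"
  obtains \<mu> z where "z \<in> U \<times> U" "z \<noteq> 0" "shift \<mu> z = 0"
proof -
  have "\<exists>\<mu> w. w \<in> U \<times> U \<and> w \<noteq> 0 \<and> shift \<mu> w = 0"
    if "shifts ms z = 0" "z \<in> U \<times> U" "z \<noteq> 0" for ms z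
    using that
  proof (induction ms)
    case (Cons \<mu> ms)
    then show ?case
      using complexified_closed(5)[OF assms(1) Cons.prems(2,2)]
      by (cases "shifts ms z = 0") (simp, metis foldr.simps(2) o_apply)
  qed simp
  moreover obtain ms where "\<forall>z. shifts ms z = 0"
    using ex_annihilator by blast
  moreover have "(x, 0) \<in> U \<times> U" "(x, 0) \<noteq> 0"
    using assms by (auto simp: invariant_subspace_def subspace_0 zero_prod_def)
  ultimately show ?thesis
    using that by blast
qed

text \<open>Moving a shift from one argument to the other leaves the remainder
  \<open>(\<mu> - \<nu>) * BC z w\<close>; the two terms that carry a shift vanish by induction on
  the sum of the nilpotency exponents.\<close>

lemma BC_generalized_eigenvectors_eq_0:
  assumes "(shift \<mu> ^^ c) z = 0" "(shift \<nu> ^^ d) w = 0" "\<mu> \<noteq> \<nu>"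
  shows "BC z w = 0"
  using assms(1,2)
proof (induction "c + d" arbitrary: c d z w)
  case (Suc n)
  show ?case
  proof (cases "c = 0 \<or> d = 0")
    case True
    then show ?thesis
      using Suc.prems by (auto simp: BC_simps)
  next
    case False
    then obtain c' d' where cd: "c = Suc c'" "d = Suc d'"
      by (metis not0_implies_Suc)
    have "BC (shift \<mu> z) w = 0" "BC z (shift \<nu> w) = 0"
      using Suc.hyps(1)[of c' d "shift \<mu> z" w] Suc.hyps(1)[of c d' z "shift \<nu> w"] Suc.hyps(2)
        Suc.prems by (auto simp: cd funpow_swap1)
    moreover have "shift \<nu> w = shift \<mu> w + cscale (\<mu> - \<nu>) w"
      by (simp add: shift_def cvs.scale_left_diff_distrib)
    ultimately show ?thesis
      using assms(3) by (simp add: BC_simps BC_shift)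
  qed
qed (simp add: BC_simps)

definition gen_eigenspace :: "'a set \<Rightarrow> complex \<Rightarrow> ('a \<times> 'a) set" where
  "gen_eigenspace U \<mu> = {z \<in> U \<times> U. \<exists>c. (shift \<mu> ^^ c) z = 0}"

lemma gen_eigenspace_closed:
  assumes "invariant_subspace U" "z \<in> gen_eigenspace U \<mu>" "w \<in> gen_eigenspace U \<mu>"
  shows "z + w \<in> gen_eigenspace U \<mu>" "cscale c z \<in> gen_eigenspace U \<mu>"
    "shifts ms z \<in> gen_eigenspace U \<mu>" "(shift \<mu> ^^ n) z \<in> gen_eigenspace U \<mu>"
proof -
  from assms obtain a b where ab: "z \<in> U \<times> U" "w \<in> U \<times> U" "(shift \<mu> ^^ a) z = 0" "(shift \<mu> ^^ b) w = 0"
    by (auto simp: gen_eigenspace_def)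
  have "(shift \<mu> ^^ max a b) (z + w) = 0"
    using shift_power_eq_0_mono[OF ab(3), of "max a b"] shift_power_eq_0_mono[OF ab(4), of "max a b"]
    by (simp add: shift_power_add)
  then show "z + w \<in> gen_eigenspace U \<mu>"
    using complexified_closed(2)[OF assms(1) ab(1,2)] by (auto simp: gen_eigenspace_def)
  show "cscale c z \<in> gen_eigenspace U \<mu>"
    using complexified_closed(1)[OF assms(1) ab(1,2)] ab(3)
    by (auto simp: gen_eigenspace_def shift_power_scale intro!: exI[of _ a])
  show "shifts ms z \<in> gen_eigenspace U \<mu>"
    using complexified_closed(5)[OF assms(1) ab(1,2)] ab(3)
    by (auto simp: gen_eigenspace_def shift_power_shifts_commute shifts_zero intro!: exI[of _ a])
  have "(shift \<mu> ^^ a) ((shift \<mu> ^^ n) z) = 0"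
    using ab(3) by (metis add.commute comp_apply funpow_add shift_power_zero)
  then show "(shift \<mu> ^^ n) z \<in> gen_eigenspace U \<mu>"
    using complexified_closed(4)[OF assms(1) ab(1,2)] by (auto simp: gen_eigenspace_def)
qed

lemma shift_nilpotent:
  assumes "invariant_subspace U"
  shows "\<exists>c. \<forall>z\<in>gen_eigenspace U \<mu>. (shift \<mu> ^^ c) z = 0"
proof -
  have "(shift \<mu> ^^ length ms) z = 0" if "z \<in> gen_eigenspace U \<mu>" "shifts ms z = 0" for ms z
    using that
  proof (induction ms arbitrary: z)
    case (Cons \<nu> ms)
    show ?case
    proof (cases "\<nu> = \<mu>")
      case True
      then show ?thesis
        using Cons gen_eigenspace_closed(4)[OF assms Cons.prems(1,1), of 1]
        by (simp add: shift_shifts_commute funpow_swap1)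
    next
      case False
      define y where "y = shifts ms z"
      have y: "shift \<nu> y = 0"
        using Cons.prems by (simp add: y_def)
      have "(shift \<mu> ^^ c) y = cscale ((\<nu> - \<mu>) ^ c) y" for c
        by (induction c) (auto simp: shift_scale shift_eigen[OF y])
      moreover have "y \<in> gen_eigenspace U \<mu>"
        using gen_eigenspace_closed(3)[OF assms] Cons.prems(1) by (auto simp: y_def)
      ultimately have "y = 0"
        using False by (auto simp: gen_eigenspace_def)
      then show ?thesis
        using Cons.IH[of z] Cons.prems by (simp add: y_def shift_zero)
    qed
  qed simp
  moreover obtain ms where "\<forall>z. shifts ms z = 0"
    using ex_annihilator by blast
  ultimately show ?thesis
    by blast
qed

text \<open>The last nonzero power of the shift turns \<open>z\<close> into an eigenvector
  \<open>y\<close> that is still orthogonal to the generalised eigenspace. The annihilating factors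
  other than \<open>\<mu>\<close> map all of \<open>U \<times> U\<close> into that space; moved onto
  \<open>y\<close> they only scale it, so \<open>y\<close> is orthogonal to everything.\<close>

lemma gen_eigenspace_nondegenerate:
  assumes inv: "invariant_subspace U" and nd: "nondegenerate_on U"
    and z: "z \<in> gen_eigenspace U \<mu>" and orth: "\<And>w. w \<in> gen_eigenspace U \<mu> \<Longrightarrow> BC z w = 0"
  shows "z = 0"
proof (rule ccontr)
  assume "z \<noteq> 0"
  define c where "c = (LEAST c. (shift \<mu> ^^ c) z = 0)"
  have c: "(shift \<mu> ^^ c) z = 0"
    using LeastI_ex[of "\<lambda>c. (shift \<mu> ^^ c) z = 0"] z by (auto simp: gen_eigenspace_def c_def)
  with \<open>z \<noteq> 0\<close> obtain d where d: "c = Suc d"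
    by (cases c) auto
  define y where "y = (shift \<mu> ^^ d) z"
  have "y \<noteq> 0"
    using not_less_Least[of d "\<lambda>c. (shift \<mu> ^^ c) z = 0"] d by (auto simp: y_def c_def)
  have "shift \<mu> y = 0"
    using c by (simp add: y_def d)
  have y: "y \<in> gen_eigenspace U \<mu>"
    unfolding y_def using gen_eigenspace_closed(4)[OF inv z z] .
  have BCy: "BC y w = 0" if "w \<in> gen_eigenspace U \<mu>" for w
    unfolding y_def BC_shift_power using orth gen_eigenspace_closed(4)[OF inv that that] by blast
  obtain ms where ms: "\<forall>z. shifts ms z = 0"
    using ex_annihilator by blast
  define qs where "qs = filter (\<lambda>\<nu>. \<nu> \<noteq> \<mu>) ms"
  have "\<exists>c. shifts ms w = (shift \<mu> ^^ c) (shifts (filter (\<lambda>\<nu>. \<nu> \<noteq> \<mu>) ms) w)" for w ms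
  proof (induction ms)
    case (Cons \<nu> ms)
    then obtain c where c: "shifts ms w = (shift \<mu> ^^ c) (shifts (filter (\<lambda>\<nu>. \<nu> \<noteq> \<mu>) ms) w)"
      by blast
    show ?case
    proof (cases "\<nu> = \<mu>")
      case True
      then show ?thesis
        by (intro exI[of _ "Suc c"]) (simp add: c)
    next
      case False
      have "shift \<nu> ((shift \<mu> ^^ c) v) = (shift \<mu> ^^ c) (shift \<nu> v)" for v
        using shift_power_shifts_commute[where ms = "[\<nu>]"] by simp
      with False show ?thesis
        by (intro exI[of _ c]) (simp add: c)
    qed
  qed (auto intro: exI[of _ 0])
  then have "\<exists>c. (shift \<mu> ^^ c) (shifts qs w) = 0" for w
    using ms unfolding qs_def by metis
  then have "shifts qs w \<in> gen_eigenspace U \<mu>" if "w \<in> U \<times> U" for w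
    unfolding gen_eigenspace_def using complexified_closed(5)[OF inv that that] by blast
  then have 1: "BC (shifts qs y) w = 0" if "w \<in> U \<times> U" for w
    using BCy that by (simp add: BC_shifts)
  \<comment> \<open>On the eigenvector \<open>y\<close> each factor with
    \<open>\<nu> \<noteq> \<mu>\<close> acts as the nonzero scalar
    \<open>\<mu> - \<nu>\<close>.\<close>
  have "\<exists>a. a \<noteq> 0 \<and> shifts ns y = cscale a y" if "\<mu> \<notin> set ns" for ns
    using that
  proof (induction ns)
    case Nil
    then show ?case
      by (intro exI[of _ 1]) simp
  next
    case (Cons \<nu> ns)
    then obtain a where "a \<noteq> 0" "shifts ns y = cscale a y"
      by auto
    with Cons.prems show ?case
      by (intro exI[of _ "a * (\<mu> - \<nu>)"]) (auto simp: shift_scale shift_eigen[OF \<open>shift \<mu> y = 0\<close>])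
  qed
  then obtain a where a: "a \<noteq> 0" "shifts qs y = cscale a y"
    by (metis (mono_tags, lifting) mem_Collect_eq qs_def set_filter)
  have "BC y (v, 0) = 0" if "v \<in> U" for v
    using 1[of "(v, 0)"] that inv a by (simp add: BC_simps invariant_subspace_def subspace_0)
  then have "B (fst y) v = 0" "B (snd y) v = 0" if "v \<in> U" for v
    using that by (auto simp: BC_def complex_eq_iff B_simps)
  moreover have "fst y \<in> U" "snd y \<in> U"
    using y by (auto simp: gen_eigenspace_def)
  ultimately have "fst y = 0" "snd y = 0"
    using nd by (auto simp: nondegenerate_on_def)
  with \<open>y \<noteq> 0\<close> show False
    by (simp add: prod_eq_iff)
qed

text \<open>The chain \<open>u, N u, N\<^sup>2 u, \<dots>\<close> is made isotropic one antidiagonal at a time, replacing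
  \<open>u\<close> by \<open>u + b N\<^sup>d u\<close>.\<close>

lemma normalised_chain:
  assumes inv: "invariant_subspace U" and nd: "nondegenerate_on U" and "\<gamma> \<noteq> 0"
    and z0: "z0 \<in> U \<times> U" "z0 \<noteq> 0" "shift \<mu> z0 = 0"
  shows "\<exists>m u. m \<ge> 1 \<and> u \<in> U \<times> U \<and> (shift \<mu> ^^ m) u = 0 \<and>
    (\<forall>a b. BC ((shift \<mu> ^^ a) u) ((shift \<mu> ^^ b) u) = (if a + b = m - 1 then \<gamma> else 0))"
proof -
  define G where "G = gen_eigenspace U \<mu>"
  note G_closed = gen_eigenspace_closed[OF inv, where \<mu> = \<mu>, folded G_def]
  \<comment> \<open>The nilpotency index of the shift on the whole generalised eigenspace: a chain
    of this maximal length is extracted, and powers from \<open>m\<close> on vanish for every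
    candidate generator.\<close>
  define m where "m = (LEAST m. \<forall>z\<in>G. (shift \<mu> ^^ m) z = 0)"
  have m: "(shift \<mu> ^^ m) z = 0" if "z \<in> G" for z
    using LeastI_ex[OF shift_nilpotent[OF inv, of \<mu>, folded G_def]] that by (auto simp: m_def)
  have "z0 \<in> G"
    using z0 by (auto simp: G_def gen_eigenspace_def intro!: exI[of _ 1])
  with m[of z0] z0 obtain l where l: "m = Suc l"
    by (cases m) auto
  then obtain z where z: "z \<in> G" "(shift \<mu> ^^ l) z \<noteq> 0"
    using not_less_Least[of l "\<lambda>m. \<forall>z\<in>G. (shift \<mu> ^^ m) z = 0"] by (auto simp: m_def)
  define q where "q = (\<lambda>j u. BC ((shift \<mu> ^^ j) u) u)"
  obtain w where w: "w \<in> G" "BC ((shift \<mu> ^^ l) z) w \<noteq> 0"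
    using gen_eigenspace_nondegenerate[OF inv nd, of "(shift \<mu> ^^ l) z" \<mu>] z G_closed(4)[of z z]
    by (auto simp: G_def)
  have "BC ((shift \<mu> ^^ l) w) z = BC ((shift \<mu> ^^ l) z) w"
    by (metis BC_shift_power BC_sym)
  \<comment> \<open>Polarisation: if \<open>q l\<close> vanished at \<open>z\<close>,
    \<open>w\<close> and \<open>z + w\<close>, so would the mixed term, which was chosen
    nonzero.\<close>
  then have "q l (z + w) = q l z + q l w + 2 * BC ((shift \<mu> ^^ l) z) w"
    by (simp add: q_def shift_power_add BC_simps)
  with w have "q l (z + w) \<noteq> 0 \<or> q l z \<noteq> 0 \<or> q l w \<noteq> 0"
    by auto
  then obtain u0 where u0: "u0 \<in> G" "q l u0 \<noteq> 0"
    using z w G_closed(1) by blast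
  have q_eq_0: "q j u = 0" if "u \<in> G" "j \<ge> m" for j u
    using shift_power_eq_0_mono[OF m[OF that(1)] that(2)] by (simp add: q_def BC_simps)
  have q_add: "q j (u + cscale b ((shift \<mu> ^^ d) u))
      = q j u + 2 * b * q (j + d) u + b * b * q (j + 2 * d) u" for j d b u
  proof -
    have "BC z (cscale b z') = b * BC z z'" for z z'
      by (simp add: BC_simps)
    moreover have "q (j + d) u = BC ((shift \<mu> ^^ (d + j)) u) u"
      by (simp add: q_def add.commute)
    moreover have "q (j + 2 * d) u = BC ((shift \<mu> ^^ (j + d + d)) u) u"
      by (simp add: q_def mult_2 add.assoc)
    ultimately show ?thesis
      unfolding q_def shift_power_add shift_power_scale BC_add_left BC_add_right BC_scale_left BC_scale_right
        shift_power_power BC_shift_power_power by (simp add: add.commute[of d] ring_distribs)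
  qed
  have "\<exists>u\<in>G. q l u \<noteq> 0 \<and> (\<forall>j. l - d \<le> j \<and> j < l \<longrightarrow> q j u = 0)" if "d \<le> l" for d
    using that
  proof (induction d)
    case 0
    then show ?case
      using u0 by auto
  next
    case (Suc d)
    then obtain u where u: "u \<in> G" "q l u \<noteq> 0" "\<And>j. l - d \<le> j \<Longrightarrow> j < l \<Longrightarrow> q j u = 0"
      by auto
    define i where "i = l - Suc d"
    have i: "i + Suc d = l"
      using Suc.prems by (simp add: i_def)
    \<comment> \<open>The quadratic term of \<open>q i u'\<close> has index
      \<open>i + 2 * Suc d > l\<close> and vanishes, so
      \<open>q i u' = q i u + 2 * b * q l u\<close>; \<open>b\<close> is the root of this linear
      expression.\<close>
    define b where "b = - q i u / (2 * q l u)"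
    define u' where "u' = u + cscale b ((shift \<mu> ^^ Suc d) u)"
    have u': "q j u' = q j u + 2 * b * q (j + Suc d) u + b * b * q (j + 2 * Suc d) u" for j
      unfolding u'_def by (rule q_add)
    have "q l u' = q l u"
      using u' q_eq_0[OF u(1)] l by simp
    moreover have "q i u' = 0"
      using u'[of i] i q_eq_0[OF u(1), of "i + 2 * Suc d"] l u(2) by (simp add: b_def)
    moreover have "q j u' = 0" if "l - d \<le> j" "j < l" for j
      using u'[of j] u(3)[OF that] that q_eq_0[OF u(1), of "j + Suc d"]
        q_eq_0[OF u(1), of "j + 2 * Suc d"] l by simp
    moreover have "j = i \<or> l - d \<le> j" if "l - Suc d \<le> j" for j
      using that by (auto simp: i_def)
    moreover have "u' \<in> G"
      unfolding u'_def
      using G_closed(1)[OF u(1) G_closed(2)[OF G_closed(4)[OF u(1) u(1)] u(1)]] .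
    ultimately show ?case
      using u(2) by (intro bexI[of _ u']) auto
  qed
  from this[of l] obtain u where u: "u \<in> G" "q l u \<noteq> 0" "\<And>j. j < l \<Longrightarrow> q j u = 0"
    by auto
  define s where "s = csqrt (\<gamma> / q l u)"
  define v where "v = cscale s u"
  have "v \<in> G"
    unfolding v_def using G_closed(2)[OF u(1) u(1)] .
  have "q j v = s\<^sup>2 * q j u" for j
    by (simp add: v_def q_def shift_power_scale BC_simps power2_eq_square)
  then have qv: "q j v = (if j = l then \<gamma> else 0)" for j
    using u(2) u(3)[of j] q_eq_0[OF u(1), of j] l
    by (cases j l rule: linorder_cases) (simp_all add: s_def)
  have "BC ((shift \<mu> ^^ a) v) ((shift \<mu> ^^ b) v) = q (a + b) v" for a b
    by (simp add: q_def BC_shift_power_power)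
  with qv \<open>v \<in> G\<close> m l show ?thesis
    by (intro exI[of _ m] exI[of _ v]) (auto simp: G_def gen_eigenspace_def)
qed

end

subsection \<open>Splitting into real eigenvectors and complex chains\<close>

context selfadjoint_pair
begin

definition orth_list :: "real \<Rightarrow> 'a list \<Rightarrow> bool" where
  "orth_list s xs \<longleftrightarrow> (\<forall>x\<in>set xs. B x x = s) \<and> sorted_wrt (\<lambda>x y. B x y = 0) xs"

lemma orth_list_append:
  "orth_list s (xs @ ys) \<longleftrightarrow> orth_list s xs \<and> orth_list s ys \<and> (\<forall>x\<in>set xs. \<forall>y\<in>set ys. B x y = 0)"
  by (auto simp: orth_list_def sorted_wrt_append)

lemma orth_list_set:
  assumes "orth_list s xs" "x \<in> set xs" "y \<in> set xs"
  shows "B x y = (if x = y then s else 0)"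
proof (cases "x = y")
  case False
  obtain i j where ij: "i < length xs" "x = xs ! i" "j < length xs" "y = xs ! j"
    using assms by (auto simp: in_set_conv_nth)
  with False have "i < j \<or> j < i"
    by (metis nat_neq_iff)
  then show ?thesis
    using assms ij False sym[of x y] by (auto simp: orth_list_def sorted_wrt_iff_nth_less)
qed (use assms in \<open>auto simp: orth_list_def\<close>)

text \<open>The last three clauses say that the form on \<open>U\<close> has signature \<open>(p, q)\<close>; the last one is
  \<open>dim U \<ge> p + q\<close>.\<close>

definition has_signature :: "nat \<Rightarrow> nat \<Rightarrow> 'a set \<Rightarrow> bool" where
  "has_signature p q U \<longleftrightarrow> invariant_subspace U \<and> nondegenerate_on U \<and>
     (\<forall>xs. set xs \<subseteq> U \<longrightarrow> orth_list 1 xs \<longrightarrow> length xs \<le> p) \<and>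
     (\<forall>xs. set xs \<subseteq> U \<longrightarrow> orth_list (-1) xs \<longrightarrow> length xs \<le> q) \<and>
     (\<forall>ls. length ls < p + q \<longrightarrow> (\<exists>x\<in>U. x \<noteq> 0 \<and> (\<forall>l\<in>set ls. B x l = 0)))"

lemma sum_B: "B (\<Sum>i\<in>I. f i) x = (\<Sum>i\<in>I. B (f i) x)"
  using linear_sum[of "\<lambda>y. B y x" f I] bilinear by (auto simp: bilinear_def)

lemma complement_nondegenerate:
  assumes U: "subspace U" "nondegenerate_on U" "set ps \<subseteq> U" "set ns \<subseteq> U"
    and "orth_list 1 ps" "orth_list (-1) ns" "\<And>x y. x \<in> set ps \<Longrightarrow> y \<in> set ns \<Longrightarrow> B x y = 0"
  shows "nondegenerate_on {y \<in> U. \<forall>v\<in>set ps \<union> set ns. B y v = 0}"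
  unfolding nondegenerate_on_def
proof safe
  fix x assume x: "x \<in> U" "\<forall>v\<in>set ps \<union> set ns. B x v = 0"
    and orth: "\<forall>y\<in>{y \<in> U. \<forall>v\<in>set ps \<union> set ns. B y v = 0}. B x y = 0"
  have "B x y = 0" if "y \<in> U" for y
  proof -
    \<comment> \<open>The projection of \<open>y\<close> to the complement; members of
      \<open>ns\<close> enter with a plus because their square is -1. Since \<open>x\<close> is
      orthogonal to both lists, \<open>y\<close> and \<open>y'\<close> have the same product with
      \<open>x\<close>.\<close>
    define y' where "y' = y - (\<Sum>v\<in>set ps. B y v *\<^sub>R v) + (\<Sum>v\<in>set ns. B y v *\<^sub>R v)"
    have "y' \<in> U"
      unfolding y'_def using U that
      by (intro subspace_add subspace_diff subspace_sum subspace_scale) auto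
    have B_y': "B y' w = B y w - (\<Sum>v\<in>set ps. B y v * B v w) + (\<Sum>v\<in>set ns. B y v * B v w)" for w
      by (simp add: y'_def B_simps sum_B)
    have "B y' w = 0" if w: "w \<in> set ps" for w
    proof -
      have "(\<Sum>v\<in>set ps. B y v * B v w) = (\<Sum>v\<in>set ps. if v = w then B y v else 0)"
        using w assms(5) by (intro sum.cong) (auto simp: orth_list_set)
      moreover have "(\<Sum>v\<in>set ns. B y v * B v w) = 0"
        using w assms(7) by (intro sum.neutral) (auto simp: sym[of _ w])
      ultimately show ?thesis
        using w by (simp add: B_y')
    qed
    moreover have "B y' w = 0" if w: "w \<in> set ns" for w
    proof -
      have "(\<Sum>v\<in>set ns. B y v * B v w) = (\<Sum>v\<in>set ns. if v = w then - B y v else 0)"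
        using w assms(6) by (intro sum.cong) (auto simp: orth_list_set)
      moreover have "(\<Sum>v\<in>set ps. B y v * B v w) = 0"
        using w assms(7) by (intro sum.neutral) auto
      ultimately show ?thesis
        using w by (simp add: B_y')
    qed
    ultimately have "B x y' = 0"
      using orth \<open>y' \<in> U\<close> by blast
    moreover have "B y' x = B y x"
    proof -
      have "B v x = 0" if "v \<in> set ps \<union> set ns" for v
        using x that sym by metis
      then show ?thesis
        by (simp add: B_y')
    qed
    ultimately show ?thesis
      by (metis sym)
  qed
  with x U(2) show "x = 0"
    by (auto simp: nondegenerate_on_def)
qed

text \<open>Every clause is inherited by appending: an orthonormal list in the complement can be
  extended by \<open>ps\<close> or \<open>ns\<close>, and conditions \<open>ls\<close> on the
  complement become conditions \<open>ls @ ps @ ns\<close> on \<open>U\<close>. The assumption on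
  \<open>k\<close> makes the complement invariant. The bounds on the lengths keep the subtractions
  of natural numbers from truncating.\<close>

lemma complement_has_signature:
  assumes U: "has_signature p q U" "set ps \<subseteq> U" "set ns \<subseteq> U"
    and orth: "orth_list 1 ps" "orth_list (-1) ns" "\<And>x y. x \<in> set ps \<Longrightarrow> y \<in> set ns \<Longrightarrow> B x y = 0"
    and k: "\<And>y v. (\<And>w. w \<in> set ps \<union> set ns \<Longrightarrow> B y w = 0) \<Longrightarrow> v \<in> set ps \<union> set ns \<Longrightarrow> B y (k v) = 0"
  shows "has_signature (p - length ps) (q - length ns) {y \<in> U. \<forall>v\<in>set ps \<union> set ns. B y v = 0}"
    and "length ps \<le> p" "length ns \<le> q"
proof -
  let ?U' = "{y \<in> U. \<forall>v\<in>set ps \<union> set ns. B y v = 0}"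
  have sub: "subspace U" and nd: "nondegenerate_on U" and kU: "x \<in> U \<Longrightarrow> k x \<in> U" for x
    using U by (auto simp: has_signature_def invariant_subspace_def)
  have P: "length xs \<le> p" if "set xs \<subseteq> U" "orth_list 1 xs" for xs
    using U(1) that by (auto simp: has_signature_def)
  have N: "length xs \<le> q" if "set xs \<subseteq> U" "orth_list (-1) xs" for xs
    using U(1) that by (auto simp: has_signature_def)
  show "length ps \<le> p" "length ns \<le> q"
    using P N U orth by auto
  have "invariant_subspace ?U'"
    using k sub kU by (auto simp: invariant_subspace_def subspace_def B_simps selfadj)
  moreover have "nondegenerate_on ?U'"
    using complement_nondegenerate[OF sub nd U(2,3) orth] .
  moreover have "length xs \<le> p - length ps" if "set xs \<subseteq> ?U'" "orth_list 1 xs" for xs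
  proof -
    have "set (xs @ ps) \<subseteq> U" "orth_list 1 (xs @ ps)"
      using that U orth by (auto simp: orth_list_append)
    then show ?thesis
      using P[of "xs @ ps"] by simp
  qed
  moreover have "length xs \<le> q - length ns" if "set xs \<subseteq> ?U'" "orth_list (-1) xs" for xs
  proof -
    have "set (xs @ ns) \<subseteq> U" "orth_list (-1) (xs @ ns)"
      using that U orth by (auto simp: orth_list_append)
    then show ?thesis
      using N[of "xs @ ns"] by simp
  qed
  moreover have "\<exists>x\<in>?U'. x \<noteq> 0 \<and> (\<forall>l\<in>set ls. B x l = 0)"
    if "length ls < (p - length ps) + (q - length ns)" for ls
  proof -
    have "length (ls @ ps @ ns) < p + q"
      using that \<open>length ps \<le> p\<close> \<open>length ns \<le> q\<close> by simp
    then obtain x where "x \<in> U" "x \<noteq> 0" "\<forall>l\<in>set (ls @ ps @ ns). B x l = 0"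
      using U(1) unfolding has_signature_def by blast
    then show ?thesis
      by auto
  qed
  ultimately show "has_signature (p - length ps) (q - length ns) ?U'"
    unfolding has_signature_def by blast
qed

definition real_block :: "real \<Rightarrow> real \<times> 'a \<Rightarrow> bool" where
  "real_block s r \<longleftrightarrow> k (snd r) = fst r *\<^sub>R snd r \<and> B (snd r) (snd r) = s"

text \<open>The constant \<open>2 * \<i>\<close> is chosen so that real and imaginary parts of
  complementary chain members have product 1.\<close>

definition complex_block :: "nat \<times> complex \<times> 'a \<times> 'a \<Rightarrow> bool" where
  "complex_block c \<longleftrightarrow> (case c of (m, \<mu>, u) \<Rightarrow> m \<ge> 1 \<and> Im \<mu> > 0 \<and> (shift \<mu> ^^ m) u = 0 \<and>
    (\<forall>a b. BC ((shift \<mu> ^^ a) u) ((shift \<mu> ^^ b) u) = (if a + b = m - 1 then 2 * \<i> else 0)))"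

definition chain_vectors :: "nat \<times> complex \<times> 'a \<times> 'a \<Rightarrow> 'a set" where
  "chain_vectors c = (case c of (m, \<mu>, u) \<Rightarrow>
    range (\<lambda>a. fst ((shift \<mu> ^^ a) u)) \<union> range (\<lambda>a. snd ((shift \<mu> ^^ a) u)))"

lemma conjp_shift_power: "(shift (cnj \<mu>) ^^ n) (conjp z) = conjp ((shift \<mu> ^^ n) z)"
proof -
  have "shift (cnj \<mu>) (conjp z) = conjp (shift \<mu> z)" for z
    by (simp add: shift_def kC_def conjp_def cscale_def k_simps)
  then show ?thesis
    by (induction n) auto
qed

text \<open>As \<open>\<mu>\<close> is not real, the chain is orthogonal to its conjugate, which
  belongs to the eigenvalue \<open>cnj \<mu>\<close>. Adding and subtracting this and the
  normalisation separates the products of real and imaginary parts.\<close>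

lemma complex_block_relations:
  assumes "complex_block (m, \<mu>, u)"
  defines "X \<equiv> \<lambda>a. fst ((shift \<mu> ^^ a) u)" and "Y \<equiv> \<lambda>a. snd ((shift \<mu> ^^ a) u)"
  shows "B (X a) (X b) = 0" "B (Y a) (Y b) = 0" "B (X a) (Y b) = (if a + b = m - 1 then 1 else 0)"
    "k (X a) = X (Suc a) + Re \<mu> *\<^sub>R X a - Im \<mu> *\<^sub>R Y a"
    "k (Y a) = Y (Suc a) + Re \<mu> *\<^sub>R Y a + Im \<mu> *\<^sub>R X a"
    "a \<ge> m \<Longrightarrow> X a = 0" "a \<ge> m \<Longrightarrow> Y a = 0"
proof -
  let ?N = "\<lambda>a. (shift \<mu> ^^ a) u"
  have m: "m \<ge> 1" "Im \<mu> > 0" "?N m = 0"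
    and BN: "BC (?N a) (?N b) = (if a + b = m - 1 then 2 * \<i> else 0)" for a b
    using assms(1) by (auto simp: complex_block_def)
  have "(shift \<mu> ^^ m) (?N a) = 0" for a
    using shift_power_eq_0_mono[OF m(3), of "m + a"] by (simp add: funpow_add)
  then have "BC (?N a) (conjp (?N b)) = 0"
    using BC_generalized_eigenvectors_eq_0[where c = m and d = m and \<mu> = \<mu> and \<nu> = "cnj \<mu>"
        and z = "?N a" and w = "conjp (?N b)"] m(2)
    unfolding conjp_shift_power by (auto simp: complex_eq_iff) (simp_all add: conjp_def zero_prod_def)
  with BN[of a b] show "B (X a) (X b) = 0" "B (Y a) (Y b) = 0"
    "B (X a) (Y b) = (if a + b = m - 1 then 1 else 0)"
    by (auto simp: BC_def complex_eq_iff X_def Y_def conjp_def B_simps split: if_splits)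
  have "?N (Suc a) = kC (?N a) - cscale \<mu> (?N a)"
    by (simp add: shift_def)
  then show "k (X a) = X (Suc a) + Re \<mu> *\<^sub>R X a - Im \<mu> *\<^sub>R Y a"
    "k (Y a) = Y (Suc a) + Re \<mu> *\<^sub>R Y a + Im \<mu> *\<^sub>R X a"
    by (auto simp: X_def Y_def prod_eq_iff kC_def cscale_def algebra_simps simp del: funpow.simps)
  show "a \<ge> m \<Longrightarrow> X a = 0" "a \<ge> m \<Longrightarrow> Y a = 0"
    using shift_power_eq_0_mono[OF m(3)] by (auto simp: X_def Y_def)
qed

text \<open>\<open>X a\<close> pairs only with \<open>Y (m - 1 - a)\<close>, so the chain spans
  \<open>m\<close> hyperbolic planes. In each of them the sum and the difference of the two null
  vectors, divided by the square root of 2, have squares 1 and -1.\<close>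

lemma complex_block_complement:
  assumes c: "complex_block c" "c = (m, \<mu>, u)" and U: "has_signature p q U" and u: "u \<in> U \<times> U"
  shows "has_signature (p - m) (q - m) {y \<in> U. \<forall>v\<in>chain_vectors c. B y v = 0}" "m \<le> p" "m \<le> q"
    "chain_vectors c \<subseteq> U"
proof -
  define X where "X a = fst ((shift \<mu> ^^ a) u)" for a
  define Y where "Y a = snd ((shift \<mu> ^^ a) u)" for a
  have inv: "invariant_subspace U" and sub: "subspace U"
    using U by (auto simp: has_signature_def invariant_subspace_def)
  have XY: "X a \<in> U" "Y a \<in> U" for a
    using complexified_closed(4)[OF inv u u] by (auto simp: X_def Y_def mem_Times_iff)
  note rel = complex_block_relations[OF c(1)[unfolded c(2)], folded X_def Y_def]
  have cv: "chain_vectors c = range X \<union> range Y"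
    by (simp add: chain_vectors_def c(2) X_def Y_def)
  with XY show "chain_vectors c \<subseteq> U"
    by auto
  have m: "m \<ge> 1"
    using c by (auto simp: complex_block_def)
  define h where "h = 1 / sqrt 2"
  have hh: "h * h = 1 / 2" "h \<noteq> 0"
    by (auto simp: h_def)
  define P where "P = (\<lambda>a. h *\<^sub>R (X a + Y (m - 1 - a)))"
  define N where "N = (\<lambda>a. h *\<^sub>R (X a - Y (m - 1 - a)))"
  have rel': "B (Y a) (X b) = (if a + b = m - 1 then 1 else 0)" for a b
    using rel(3)[of b a] by (simp add: sym[of "Y a"] add.commute)
  have PP: "B (P a) (P b) = (if a = b then 1 else 0)" "B (N a) (N b) = (if a = b then -1 else 0)"
    "B (P a) (N b) = 0" if "a < m" "b < m" for a b
    using that m by (auto simp: P_def N_def B_simps rel rel' hh(1) algebra_simps mult.assoc[symmetric])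
  have perp: "B y (X a) = 0 \<and> B y (Y a) = 0"
    if "\<forall>v\<in>set (map P [0..<m]) \<union> set (map N [0..<m]). B y v = 0" for y a
  proof -
    have *: "B y (X a) = 0 \<and> B y (Y (m - 1 - a)) = 0" if "a < m" for a
    proof -
      have "B y (P a) = 0" "B y (N a) = 0"
        using \<open>\<forall>v\<in>set (map P [0..<m]) \<union> set (map N [0..<m]). B y v = 0\<close> that by auto
      then show ?thesis
        using hh(2) by (simp add: P_def N_def B_simps)
    qed
    show ?thesis
      using *[of a] *[of "m - 1 - a"] rel(6,7)[of a] by (cases "a < m") (auto simp: B_simps)
  qed
  have perp': "B y v = 0"
    if "\<forall>v\<in>range X \<union> range Y. B y v = 0" "v \<in> set (map P [0..<m]) \<union> set (map N [0..<m])" for y v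
    using that by (auto simp: P_def N_def B_simps)
  have "orth_list 1 (map P [0..<m])" "orth_list (-1) (map N [0..<m])"
    using PP by (auto simp: orth_list_def sorted_wrt_map sorted_wrt_iff_nth_less)
  moreover have "set (map P [0..<m]) \<subseteq> U" "set (map N [0..<m]) \<subseteq> U"
    using XY sub by (auto simp: P_def N_def intro!: subspace_scale subspace_add subspace_diff)
  moreover have "B y (k v) = 0"
    if "\<And>w. w \<in> set (map P [0..<m]) \<union> set (map N [0..<m]) \<Longrightarrow> B y w = 0"
      "v \<in> set (map P [0..<m]) \<union> set (map N [0..<m])" for y v
  proof -
    have XY0: "B y (X a) = 0" "B y (Y a) = 0" for a
      using perp that(1) by blast+
    then have "B y (k (X a)) = 0" "B y (k (Y a)) = 0" for a
      by (simp_all add: rel B_simps)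
    then show ?thesis
      using that(2) by (auto simp: P_def N_def B_simps k_simps)
  qed
  moreover have "B x y = 0" if "x \<in> set (map P [0..<m])" "y \<in> set (map N [0..<m])" for x y
    using that PP by auto
  ultimately have *: "has_signature (p - m) (q - m)
      {y \<in> U. \<forall>v\<in>set (map P [0..<m]) \<union> set (map N [0..<m]). B y v = 0}" "m \<le> p" "m \<le> q"
    using complement_has_signature[OF U, of "map P [0..<m]" "map N [0..<m]"] by auto
  have "{y \<in> U. \<forall>v\<in>set (map P [0..<m]) \<union> set (map N [0..<m]). B y v = 0}
      = {y \<in> U. \<forall>v\<in>chain_vectors c. B y v = 0}"
    unfolding cv using perp perp' by blast
  with * show "has_signature (p - m) (q - m) {y \<in> U. \<forall>v\<in>chain_vectors c. B y v = 0}"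
      "m \<le> p" "m \<le> q"
    by auto
qed

lemma real_block_complement:
  assumes r: "real_block s (a, x)" and U: "has_signature p q U" and x: "x \<in> U"
  shows "s = 1 \<Longrightarrow> has_signature (p - 1) q {y \<in> U. B y x = 0} \<and> p \<ge> 1"
    and "s = -1 \<Longrightarrow> has_signature p (q - 1) {y \<in> U. B y x = 0} \<and> q \<ge> 1"
  using complement_has_signature[OF U, of "[x]" "[]"] complement_has_signature[OF U, of "[]" "[x]"]
    r x by (simp_all add: real_block_def orth_list_def B_simps)

definition perp :: "'a set \<Rightarrow> 'a set \<Rightarrow> bool" where
  "perp S T \<longleftrightarrow> (\<forall>x\<in>S. \<forall>y\<in>T. B x y = 0)"

lemma perp_sym: "perp S T \<longleftrightarrow> perp T S"
  unfolding perp_def using sym by metis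

lemma split_off_block:
  assumes U: "has_signature p q U" and pq: "p + q > 0"
    and nonull: "\<forall>x a. k x = a *\<^sub>R x \<longrightarrow> B x x = 0 \<longrightarrow> x = 0"
  obtains (real) s r where "s = 1 \<or> s = -1" "real_block s r" "snd r \<in> U"
  | (complex) m \<mu> u where "complex_block (m, \<mu>, u)" "u \<in> U \<times> U"
proof -
  have inv: "invariant_subspace U" and nd: "nondegenerate_on U"
    using U by (auto simp: has_signature_def)
  obtain x where "x \<in> U" "x \<noteq> 0"
  proof -
    \<comment> \<open>With no conditions imposed, the dimension clause of the signature supplies a
      nonzero vector.\<close>
    have "length ([] :: 'a list) < p + q \<longrightarrow> (\<exists>x\<in>U. x \<noteq> 0 \<and> (\<forall>l\<in>set []. B x l = 0))"
      using U unfolding has_signature_def by blast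
    then show ?thesis
      using that pq by auto
  qed
  then obtain \<mu> z where z: "z \<in> U \<times> U" "z \<noteq> 0" "shift \<mu> z = 0"
    by (rule ex_eigenvector[OF inv])
  show ?thesis
  proof (cases "Im \<mu> = 0")
    case True
    with z(3) have "k (fst z) = Re \<mu> *\<^sub>R fst z" "k (snd z) = Re \<mu> *\<^sub>R snd z"
      by (auto simp: shift_def kC_def cscale_def prod_eq_iff)
    \<comment> \<open>For a real eigenvalue the real and the imaginary part of \<open>z\<close>
      satisfy the eigenvector equation separately, and one of them is nonzero.\<close>
    with z(1,2) obtain y where y: "y \<in> U" "y \<noteq> 0" "k y = Re \<mu> *\<^sub>R y"
      by (auto simp: prod_eq_iff)
    then have By: "B y y \<noteq> 0"
      using nonull by blast
    define t where "t = 1 / sqrt \<bar>B y y\<bar>"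
    have "t * t = 1 / \<bar>B y y\<bar>"
      by (simp add: t_def)
    then have "B (t *\<^sub>R y) (t *\<^sub>R y) = sgn (B y y)"
      using By by (simp add: B_simps mult.assoc[symmetric] sgn_if)
    moreover have "sgn (B y y) = 1 \<or> sgn (B y y) = -1"
      using By by (auto simp: sgn_if)
    moreover have "k (t *\<^sub>R y) = Re \<mu> *\<^sub>R t *\<^sub>R y"
      using y by (simp add: k_simps)
    moreover have "t *\<^sub>R y \<in> U"
      using y inv by (auto simp: invariant_subspace_def intro: subspace_scale)
    ultimately show ?thesis
      using real[of "sgn (B y y)" "(Re \<mu>, t *\<^sub>R y)"] by (auto simp: real_block_def)
  next
    case False
    \<comment> \<open>Conjugation swaps \<open>\<mu>\<close> and \<open>cnj \<mu>\<close>. Insisting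
      on a positive imaginary part in every block is what later gives all the \<open>b\<close> the
      same sign.\<close>
    have "\<exists>\<mu> z. Im \<mu> > 0 \<and> z \<in> U \<times> U \<and> z \<noteq> 0 \<and> shift \<mu> z = 0"
    proof (cases "Im \<mu> > 0")
      case True
      with z show ?thesis by blast
    next
      case neg: False
      have "conjp z \<in> U \<times> U" "conjp z \<noteq> 0"
        using z inv by (auto simp: conjp_def invariant_subspace_def subspace_neg prod_eq_iff mem_Times_iff)
      moreover have "shift (cnj \<mu>) (conjp z) = 0"
        using conjp_shift_power[where n = 1 and z = z] z(3) by (simp add: conjp_def zero_prod_def)
      moreover have "Im (cnj \<mu>) > 0"
        using neg False by simp
      ultimately show ?thesis
        by (intro exI[of _ "cnj \<mu>"] exI[of _ "conjp z"] conjI)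
    qed
    then obtain \<mu> z where z: "Im \<mu> > 0" "z \<in> U \<times> U" "z \<noteq> 0" "shift \<mu> z = 0"
      by blast
    have "2 * \<i> \<noteq> 0"
      by simp
    from normalised_chain[OF inv nd this z(2-4)] obtain m u where
      "m \<ge> 1" "u \<in> U \<times> U" "(shift \<mu> ^^ m) u = 0"
      "\<And>a b. BC ((shift \<mu> ^^ a) u) ((shift \<mu> ^^ b) u) = (if a + b = m - 1 then 2 * \<i> else 0)"
      by blast
    with z(1) show ?thesis
      using complex[of m \<mu> u] by (auto simp: complex_block_def)
  qed
qed

text \<open>A chain uses up as many positive as negative directions. Hence for \<open>p = q\<close>
  equally many real eigenvectors of either sign remain, and they can be paired.\<close>

theorem block_decomposition:
  assumes U: "has_signature p q U"
    and nonull: "\<forall>x a. k x = a *\<^sub>R x \<longrightarrow> B x x = 0 \<longrightarrow> x = 0"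
  shows "\<exists>cs ps ns. (\<forall>c\<in>set cs. complex_block c) \<and> (\<forall>r\<in>set ps. real_block 1 r) \<and>
    (\<forall>r\<in>set ns. real_block (-1) r) \<and>
    sum_list (map fst cs) + length ps = p \<and> sum_list (map fst cs) + length ns = q \<and>
    (\<forall>c\<in>set cs. chain_vectors c \<subseteq> U) \<and> (\<forall>r\<in>set ps \<union> set ns. snd r \<in> U) \<and>
    sorted_wrt perp (map chain_vectors cs @ map (\<lambda>r. {snd r}) (ps @ ns))"
  using U
proof (induction "p + q" arbitrary: p q U rule: less_induct)
  case less
  show ?case
  proof (cases "p + q = 0")
    case True
    then show ?thesis
      by (intro exI[of _ "[]"]) simp
  next
    case False
    then have "p + q > 0"
      by simp
    consider (real) s r where "s = 1 \<or> s = -1" "real_block s r" "snd r \<in> U"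
      | (complex) m \<mu> u where "complex_block (m, \<mu>, u)" "u \<in> U \<times> U"
      by (rule split_off_block[OF less.prems \<open>p + q > 0\<close> nonull])
    then show ?thesis
    proof cases
      case (real s r)
      let ?V = "{y \<in> U. B y (snd r) = 0}"
      have perp_r: "perp S {snd r}" if "S \<subseteq> ?V" for S
        using that by (unfold perp_def) blast
      then have perp_r': "perp {snd r} S" if "S \<subseteq> ?V" for S
        using that perp_sym by blast
      from real(1) show ?thesis
      proof
        assume s: "s = 1"
        with real_block_complement(1)[OF _ less.prems, of s "fst r" "snd r"] real
        have V: "has_signature (p - 1) q ?V" "p \<ge> 1"
          by auto
        have "p - 1 + q < p + q"
          using V(2) by simp
        from less.hyps[OF this V(1)] obtain cs ps ns where *: "\<forall>c\<in>set cs. complex_block c"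
          "\<forall>r\<in>set ps. real_block 1 r" "\<forall>r\<in>set ns. real_block (-1) r"
          "sum_list (map fst cs) + length ps = p - 1" "sum_list (map fst cs) + length ns = q"
          "\<forall>c\<in>set cs. chain_vectors c \<subseteq> ?V" "\<forall>r\<in>set ps \<union> set ns. snd r \<in> ?V"
          "sorted_wrt perp (map chain_vectors cs @ map (\<lambda>r. {snd r}) (ps @ ns))"
          by blast
        have "perp (chain_vectors c) {snd r}" if "c \<in> set cs" for c
          using *(6) that by (intro perp_r) blast
        moreover have "perp {snd r} {snd t}" "perp {snd t} {snd r}" if "t \<in> set ps \<union> set ns" for t
        proof -
          have "{snd t} \<subseteq> ?V"
            using *(7) that by blast
          then show "perp {snd r} {snd t}" "perp {snd t} {snd r}"
            by (fact perp_r', fact perp_r)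
        qed
        ultimately have "sorted_wrt perp (map chain_vectors cs @ map (\<lambda>r. {snd r}) ((r # ps) @ ns))"
          using *(8) by (simp add: sorted_wrt_append ball_Un)
        moreover have "\<forall>c\<in>set cs. chain_vectors c \<subseteq> U" "\<forall>r\<in>set ps \<union> set ns. snd r \<in> U"
          using *(6,7) by blast+
        ultimately show ?thesis
          by - (rule exI[of _ cs], rule exI[of _ "r # ps"], rule exI[of _ ns], use *(1-5) V(2) real s in simp)
      next
        assume s: "s = -1"
        with real_block_complement(2)[OF _ less.prems, of s "fst r" "snd r"] real
        have V: "has_signature p (q - 1) ?V" "q \<ge> 1"
          by auto
        have "p + (q - 1) < p + q"
          using V(2) by simp
        from less.hyps[OF this V(1)] obtain cs ps ns where *: "\<forall>c\<in>set cs. complex_block c"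
          "\<forall>r\<in>set ps. real_block 1 r" "\<forall>r\<in>set ns. real_block (-1) r"
          "sum_list (map fst cs) + length ps = p" "sum_list (map fst cs) + length ns = q - 1"
          "\<forall>c\<in>set cs. chain_vectors c \<subseteq> ?V" "\<forall>r\<in>set ps \<union> set ns. snd r \<in> ?V"
          "sorted_wrt perp (map chain_vectors cs @ map (\<lambda>r. {snd r}) (ps @ ns))"
          by blast
        have "perp (chain_vectors c) {snd r}" if "c \<in> set cs" for c
          using *(6) that by (intro perp_r) blast
        moreover have "perp {snd r} {snd t}" "perp {snd t} {snd r}" if "t \<in> set ps \<union> set ns" for t
        proof -
          have "{snd t} \<subseteq> ?V"
            using *(7) that by blast
          then show "perp {snd r} {snd t}" "perp {snd t} {snd r}"
            by (fact perp_r', fact perp_r)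
        qed
        ultimately have "sorted_wrt perp (map chain_vectors cs @ map (\<lambda>r. {snd r}) (ps @ (r # ns)))"
          using *(8) by (simp add: sorted_wrt_append ball_Un)
        moreover have "\<forall>c\<in>set cs. chain_vectors c \<subseteq> U" "\<forall>r\<in>set ps \<union> set ns. snd r \<in> U"
          using *(6,7) by blast+
        ultimately show ?thesis
          by - (rule exI[of _ cs], rule exI[of _ ps], rule exI[of _ "r # ns"], use *(1-5) V(2) real s in simp)
      qed
    next
      case (complex m \<mu> u)
      let ?c = "(m, \<mu>, u)"
      let ?V = "{y \<in> U. \<forall>v\<in>chain_vectors ?c. B y v = 0}"
      note V = complex_block_complement[OF complex(1) refl less.prems complex(2)]
      have "m \<ge> 1"
        using complex(1) by (simp add: complex_block_def)
      then have "p - m + (q - m) < p + q"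
        using V(2) by simp
      from less.hyps[OF this V(1)] obtain cs ps ns where *: "\<forall>c\<in>set cs. complex_block c"
        "\<forall>r\<in>set ps. real_block 1 r" "\<forall>r\<in>set ns. real_block (-1) r"
        "sum_list (map fst cs) + length ps = p - m" "sum_list (map fst cs) + length ns = q - m"
        "\<forall>c\<in>set cs. chain_vectors c \<subseteq> ?V" "\<forall>r\<in>set ps \<union> set ns. snd r \<in> ?V"
        "sorted_wrt perp (map chain_vectors cs @ map (\<lambda>r. {snd r}) (ps @ ns))"
        by blast
      have perpV: "perp (chain_vectors ?c) S" if "S \<subseteq> ?V" for S
        using that by (subst perp_sym, unfold perp_def) blast
      have "perp (chain_vectors ?c) S"
        if S: "S \<in> set (map chain_vectors cs @ map (\<lambda>r. {snd r}) (ps @ ns))" for S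
      proof -
        consider c where "c \<in> set cs" "S = chain_vectors c"
          | r where "r \<in> set ps \<union> set ns" "S = {snd r}"
          using S unfolding set_append set_map by blast
        then show ?thesis
        proof cases
          case 1
          then show ?thesis
            using *(6) by (intro perpV) blast
        next
          case 2
          then show ?thesis
            using *(7) by (intro perpV) blast
        qed
      qed
      then have "sorted_wrt perp (map chain_vectors (?c # cs) @ map (\<lambda>r. {snd r}) (ps @ ns))"
        using *(8) by simp
      moreover have "\<forall>c\<in>set cs. chain_vectors c \<subseteq> U" "\<forall>r\<in>set ps \<union> set ns. snd r \<in> U"
        using *(6,7) by blast+
      moreover have "m + sum_list (map fst cs) + length ps = p" "m + sum_list (map fst cs) + length ns = q"
        using *(4,5) V(2,3) by linarith+
      ultimately show ?thesis
        using *(1-3) V(4) complex(1)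
        by - (rule exI[of _ "?c # cs"], rule exI[of _ ps], rule exI[of _ ns], simp)
    qed
  qed
qed

end

section \<open>Hyperbolic bases in normal form\<close>

definition hyperbolic_pair :: "('a \<Rightarrow> 'a \<Rightarrow> real) \<Rightarrow> 'a \<Rightarrow> 'a \<Rightarrow> bool" where
  "hyperbolic_pair B f g \<longleftrightarrow> B f f = 0 \<and> B g g = 0 \<and> B f g = 1 \<and> B g f = 1"

definition orthogonal_pairs :: "('a \<Rightarrow> 'a \<Rightarrow> real) \<Rightarrow> 'a \<Rightarrow> 'a \<Rightarrow> 'a \<Rightarrow> 'a \<Rightarrow> bool" where
  "orthogonal_pairs B f g f' g' \<longleftrightarrow> B f f' = 0 \<and> B f g' = 0 \<and> B g f' = 0 \<and> B g g' = 0 \<and>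
     B f' f = 0 \<and> B g' f = 0 \<and> B f' g = 0 \<and> B g' g = 0"

definition hyperbolic_basis ::
  "('a \<Rightarrow> 'a \<Rightarrow> real) \<Rightarrow> 'a \<Rightarrow> 'a \<Rightarrow> 'a \<Rightarrow> 'a \<Rightarrow> 'a \<Rightarrow> 'a \<Rightarrow> bool" where
  "hyperbolic_basis B f1 f2 f3 f4 f5 f6 \<longleftrightarrow>
     hyperbolic_pair B f1 f4 \<and> hyperbolic_pair B f2 f5 \<and> hyperbolic_pair B f3 f6 \<and>
     orthogonal_pairs B f1 f4 f2 f5 \<and> orthogonal_pairs B f1 f4 f3 f6 \<and> orthogonal_pairs B f2 f5 f3 f6"

definition complex_plane :: "('a \<Rightarrow> 'a::real_vector) \<Rightarrow> real \<Rightarrow> real \<Rightarrow> 'a \<Rightarrow> 'a \<Rightarrow> bool" where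
  "complex_plane k a b f g \<longleftrightarrow> k f = a *\<^sub>R f + b *\<^sub>R g \<and> k g = a *\<^sub>R g - b *\<^sub>R f"

definition real_plane :: "('a \<Rightarrow> 'a::real_vector) \<Rightarrow> real \<Rightarrow> real \<Rightarrow> 'a \<Rightarrow> 'a \<Rightarrow> bool" where
  "real_plane k a b f g \<longleftrightarrow> k f = a *\<^sub>R f + b *\<^sub>R g \<and> k g = b *\<^sub>R f + a *\<^sub>R g"

text \<open>A complex Jordan chain of length 2 for \<open>a + i b\<close>, with generator
  \<open>f2 + i f1\<close> and second member \<open>f4 + i f5\<close>. Likewise
  \<open>chain3\<close> consists of \<open>f2 + i f1\<close>, \<open>f6 + i f3\<close> and
  \<open>f4 + i f5\<close>, and \<open>complex_plane\<close> of \<open>g + i f\<close>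
  alone.\<close>

definition chain2 ::
  "('a \<Rightarrow> 'a::real_vector) \<Rightarrow> real \<Rightarrow> real \<Rightarrow> 'a \<Rightarrow> 'a \<Rightarrow> 'a \<Rightarrow> 'a \<Rightarrow> bool" where
  "chain2 k a b f1 f2 f4 f5 \<longleftrightarrow>
     k f1 = a *\<^sub>R f1 + b *\<^sub>R f2 + f5 \<and> k f2 = a *\<^sub>R f2 - b *\<^sub>R f1 + f4 \<and>
     k f4 = a *\<^sub>R f4 - b *\<^sub>R f5 \<and> k f5 = a *\<^sub>R f5 + b *\<^sub>R f4"

definition chain3 ::
  "('a \<Rightarrow> 'a::real_vector) \<Rightarrow> real \<Rightarrow> real \<Rightarrow> 'a \<Rightarrow> 'a \<Rightarrow> 'a \<Rightarrow> 'a \<Rightarrow> 'a \<Rightarrow> 'a \<Rightarrow> bool" where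
  "chain3 k a b f1 f2 f3 f4 f5 f6 \<longleftrightarrow>
     k f1 = a *\<^sub>R f1 + b *\<^sub>R f2 + f3 \<and> k f2 = a *\<^sub>R f2 - b *\<^sub>R f1 + f6 \<and>
     k f3 = a *\<^sub>R f3 + b *\<^sub>R f6 + f5 \<and> k f6 = a *\<^sub>R f6 - b *\<^sub>R f3 + f4 \<and>
     k f4 = a *\<^sub>R f4 - b *\<^sub>R f5 \<and> k f5 = a *\<^sub>R f5 + b *\<^sub>R f4"

text \<open>The alternatives are Metaclasses I, IV, VI, VII, II, V and III, in this order.\<close>

definition normal_frame ::
  "('a \<Rightarrow> 'a::real_vector) \<Rightarrow> 'a \<Rightarrow> 'a \<Rightarrow> 'a \<Rightarrow> 'a \<Rightarrow> 'a \<Rightarrow> 'a \<Rightarrow> bool" where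
  "normal_frame k f1 f2 f3 f4 f5 f6 \<longleftrightarrow>
     (\<exists>a1 a2 a3 b1 b2 b3. same_sign [b1, b2, b3] \<and>
        complex_plane k a1 b1 f1 f4 \<and> complex_plane k a2 b2 f2 f5 \<and> complex_plane k a3 b3 f3 f6) \<or>
     (\<exists>a1 a2 a3 b1 b2 b3. same_sign [b1, b2] \<and>
        complex_plane k a1 b1 f1 f4 \<and> complex_plane k a2 b2 f2 f5 \<and> real_plane k a3 b3 f3 f6) \<or>
     (\<exists>a1 a2 a3 b1 b2 b3. same_sign [b1] \<and>
        complex_plane k a1 b1 f1 f4 \<and> real_plane k a2 b2 f2 f5 \<and> real_plane k a3 b3 f3 f6) \<or>
     (\<exists>a1 a2 a3 b1 b2 b3.
        real_plane k a1 b1 f1 f4 \<and> real_plane k a2 b2 f2 f5 \<and> real_plane k a3 b3 f3 f6) \<or>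
     (\<exists>a1 a2 b1 b2. same_sign [b1, b2] \<and> chain2 k a1 b1 f1 f2 f4 f5 \<and> complex_plane k a2 b2 f3 f6) \<or>
     (\<exists>a1 a2 b1 b2. same_sign [b1] \<and> chain2 k a1 b1 f1 f2 f4 f5 \<and> real_plane k a2 b2 f3 f6) \<or>
     (\<exists>a b. same_sign [b] \<and> chain3 k a b f1 f2 f3 f4 f5 f6)"

lemma normal_frame_I:
  assumes "same_sign [b1, b2, b3]" "complex_plane k a1 b1 f1 f4" "complex_plane k a2 b2 f2 f5" "complex_plane k a3 b3 f3 f6"
  shows "normal_frame k f1 f2 f3 f4 f5 f6"
  unfolding normal_frame_def
  by (rule disjI1, intro exI conjI, (rule assms)+)

lemma normal_frame_IV:
  assumes "same_sign [b1, b2]" "complex_plane k a1 b1 f1 f4" "complex_plane k a2 b2 f2 f5" "real_plane k a3 b3 f3 f6"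
  shows "normal_frame k f1 f2 f3 f4 f5 f6"
  unfolding normal_frame_def
  by (rule disjI2, rule disjI1, intro exI conjI, (rule assms)+)

lemma normal_frame_VI:
  assumes "same_sign [b1]" "complex_plane k a1 b1 f1 f4" "real_plane k a2 b2 f2 f5" "real_plane k a3 b3 f3 f6"
  shows "normal_frame k f1 f2 f3 f4 f5 f6"
  unfolding normal_frame_def
  by (rule disjI2, rule disjI2, rule disjI1, intro exI conjI, (rule assms)+)

lemma normal_frame_VII:
  assumes "real_plane k a1 b1 f1 f4" "real_plane k a2 b2 f2 f5" "real_plane k a3 b3 f3 f6"
  shows "normal_frame k f1 f2 f3 f4 f5 f6"
  unfolding normal_frame_def
  by (rule disjI2, rule disjI2, rule disjI2, rule disjI1, intro exI conjI, (rule assms)+)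

lemma normal_frame_II:
  assumes "same_sign [b1, b2]" "chain2 k a1 b1 f1 f2 f4 f5" "complex_plane k a2 b2 f3 f6"
  shows "normal_frame k f1 f2 f3 f4 f5 f6"
  unfolding normal_frame_def
  by (rule disjI2, rule disjI2, rule disjI2, rule disjI2, rule disjI1, intro exI conjI, (rule assms)+)

lemma normal_frame_V:
  assumes "same_sign [b1]" "chain2 k a1 b1 f1 f2 f4 f5" "real_plane k a2 b2 f3 f6"
  shows "normal_frame k f1 f2 f3 f4 f5 f6"
  unfolding normal_frame_def
  by (rule disjI2, rule disjI2, rule disjI2, rule disjI2, rule disjI2, rule disjI1, intro exI conjI, (rule assms)+)

lemma normal_frame_III:
  assumes "same_sign [b]" "chain3 k a b f1 f2 f3 f4 f5 f6"
  shows "normal_frame k f1 f2 f3 f4 f5 f6"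
  unfolding normal_frame_def
  by (rule disjI2, rule disjI2, rule disjI2, rule disjI2, rule disjI2, rule disjI2, intro exI conjI, (rule assms)+)

lemma same_sign_pos: "(\<And>b. b \<in> set bs \<Longrightarrow> b > 0) \<Longrightarrow> same_sign bs"
  by (force simp: same_sign_def)

lemma small_sum_lists:
  fixes cs :: "(nat \<times> 'b) list"
  assumes "\<forall>c\<in>set cs. 1 \<le> fst c" "sum_list (map fst cs) \<le> 3"
  shows "cs = [] \<or> (\<exists>u. cs = [(1, u)]) \<or> (\<exists>u. cs = [(2, u)]) \<or> (\<exists>u. cs = [(3, u)]) \<or>
    (\<exists>u v. cs = [(1, u), (1, v)]) \<or> (\<exists>u v. cs = [(2, u), (1, v)] \<or> cs = [(1, v), (2, u)]) \<or>
    (\<exists>u v w. cs = [(1, u), (1, v), (1, w)])"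
proof -
  have *: "ds = [] \<or> (\<exists>d ds'. ds = d # ds' \<and> (fst d = 1 \<or> fst d = 2 \<or> fst d = 3) \<and>
      sum_list (map fst ds') \<le> 3 - fst d)"
    if "\<forall>c\<in>set ds. 1 \<le> fst c" "sum_list (map fst ds) \<le> 3" for ds :: "(nat \<times> 'b) list"
    using that by (cases ds) auto
  show ?thesis
  proof (cases cs)
    case c: (Cons c ds)
    show ?thesis
    proof (cases ds)
      case Nil
      then show ?thesis
        using c *[OF assms] by (cases c) auto
    next
      case d: (Cons d es)
      show ?thesis
      proof (cases es)
        case Nil
        have "(fst c, fst d) = (1, 1) \<or> (fst c, fst d) = (1, 2) \<or> (fst c, fst d) = (2, 1)"
          using assms c d Nil by auto
        then show ?thesis
          using c d Nil by (cases c; cases d) auto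
      next
        case e: (Cons e gs)
        then have "1 \<le> fst c" "1 \<le> fst d" "1 \<le> fst e"
          "fst c + fst d + fst e + sum_list (map fst gs) \<le> 3"
          using assms c d by auto
        then have "fst c = 1" "fst d = 1" "fst e = 1" "sum_list (map fst gs) = 0"
          by linarith+
        moreover from this have "gs = []"
          using assms(1) c d e by (cases gs) auto
        ultimately show ?thesis
          using c d e by (cases c; cases d; cases e) auto
      qed
    qed
  qed simp
qed

section \<open>Planes and chains built from the blocks\<close>

context selfadjoint_pair
begin

lemma perp_pairs:
  "perp {f, g} {f', g'} \<longleftrightarrow> orthogonal_pairs B f g f' g'"
  unfolding perp_def orthogonal_pairs_def using sym by auto

text \<open>The imaginary part is listed first, which gives \<open>b\<close> the sign required by
  \<open>complex_plane\<close>. The last clause transports the orthogonality of blocks to the pair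
  that replaces the block.\<close>

lemma complex_plane_of_block:
  assumes "complex_block (1, \<mu>, u)"
  obtains a b f g where "b > 0" "complex_plane k a b f g" "hyperbolic_pair B f g"
    "\<forall>T. perp (chain_vectors (1, \<mu>, u)) T \<longrightarrow> perp {f, g} T"
proof
  note rel = complex_block_relations[OF assms]
  show "Im \<mu> > 0"
    using assms by (simp add: complex_block_def)
  show "complex_plane k (Re \<mu>) (Im \<mu>) (snd u) (fst u)"
    using rel(4)[of 0] rel(5)[of 0] rel(6,7)[of 1] by (simp add: complex_plane_def)
  show "hyperbolic_pair B (snd u) (fst u)"
    using rel(1)[of 0 0] rel(2)[of 0 0] rel(3)[of 0 0] sym[of "snd u" "fst u"]
    by (simp add: hyperbolic_pair_def)
  have "fst u \<in> chain_vectors (1, \<mu>, u)" "snd u \<in> chain_vectors (1, \<mu>, u)"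
    by (auto simp: chain_vectors_def intro: image_eqI[of _ _ 0])
  then show "\<forall>T. perp (chain_vectors (1, \<mu>, u)) T \<longrightarrow> perp {snd u, fst u} T"
    by (auto simp: perp_def)
qed

text \<open>Writing the eigenvalues of the positive and the negative eigenvector as
  \<open>a + b\<close> and \<open>a - b\<close>, the map takes the symmetric form with entries
  \<open>a\<close> and \<open>b\<close> on the null vectors given by their normalised sum and
  difference.\<close>

lemma real_plane_of_blocks:
  assumes "real_block 1 r" "real_block (-1) t" "perp {snd r} {snd t}"
  obtains a b f g where "real_plane k a b f g" "hyperbolic_pair B f g"
    "\<forall>T. perp {snd r} T \<longrightarrow> perp {snd t} T \<longrightarrow> perp {f, g} T"
proof
  define h where "h = 1 / sqrt 2"
  have hh: "h * h = 1 / 2"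
    by (simp add: h_def)
  let ?x = "snd r" and ?y = "snd t"
  let ?f = "h *\<^sub>R (?x + ?y)" and ?g = "h *\<^sub>R (?x - ?y)"
  have r: "k ?x = fst r *\<^sub>R ?x" "B ?x ?x = 1" "k ?y = fst t *\<^sub>R ?y" "B ?y ?y = -1" "B ?x ?y = 0" "B ?y ?x = 0"
    using assms sym[of ?y ?x] by (auto simp: real_block_def perp_def)
  define a b where "a = (fst r + fst t) / 2" and "b = (fst r - fst t) / 2"
  then have rt: "fst r = a + b" "fst t = a - b"
    by (simp_all add: field_simps)
  show "real_plane k a b ?f ?g"
    by (simp add: real_plane_def k_simps r(1,3) rt algebra_simps)
  show "hyperbolic_pair B ?f ?g"
    using hh by (simp add: hyperbolic_pair_def B_simps r algebra_simps)
  show "\<forall>T. perp {snd r} T \<longrightarrow> perp {snd t} T \<longrightarrow> perp {?f, ?g} T"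
    by (auto simp: perp_def B_simps)
qed

lemma chain2_of_block:
  assumes "complex_block (2, \<mu>, u)"
  obtains a b f1 f2 f4 f5 where "b > 0" "chain2 k a b f1 f2 f4 f5"
    "hyperbolic_pair B f1 f4" "hyperbolic_pair B f2 f5" "orthogonal_pairs B f1 f4 f2 f5"
    "\<forall>T. perp (chain_vectors (2, \<mu>, u)) T \<longrightarrow> perp {f1, f4} T \<and> perp {f2, f5} T"
proof
  note rel = complex_block_relations[OF assms]
  define X where "X a = fst ((shift \<mu> ^^ a) u)" for a
  define Y where "Y a = snd ((shift \<mu> ^^ a) u)" for a
  note rel = rel[folded X_def Y_def]
  have rel': "B (Y a) (X b) = (if a + b = 1 then 1 else 0)" for a b
    using rel(3)[of b a] by (simp add: sym[of "Y a"] add.commute)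
  show "Im \<mu> > 0"
    using assms by (simp add: complex_block_def)
  show "chain2 k (Re \<mu>) (Im \<mu>) (Y 0) (X 0) (X 1) (Y 1)"
    using rel(4)[of 0] rel(5)[of 0] rel(4)[of 1] rel(5)[of 1] rel(6,7)[of 2]
    by (simp add: chain2_def numeral_2_eq_2)
  show "hyperbolic_pair B (Y 0) (X 1)" "hyperbolic_pair B (X 0) (Y 1)"
    "orthogonal_pairs B (Y 0) (X 1) (X 0) (Y 1)"
    by (simp_all add: hyperbolic_pair_def orthogonal_pairs_def rel rel')
  have "X a \<in> chain_vectors (2, \<mu>, u)" "Y a \<in> chain_vectors (2, \<mu>, u)" for a
    by (auto simp: chain_vectors_def X_def Y_def)
  then show "\<forall>T. perp (chain_vectors (2, \<mu>, u)) T \<longrightarrow> perp {Y 0, X 1} T \<and> perp {X 0, Y 1} T"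
    by (auto simp: perp_def)
qed

text \<open>Members of a chain of length 3 pair when their positions add up to 2, so the middle one
  supplies the pair \<open>(Y 1, X 1)\<close>. The chain fills all six dimensions, and no
  orthogonality to other blocks has to be passed on.\<close>

lemma chain3_of_block:
  assumes "complex_block (3, \<mu>, u)"
  obtains a b f1 f2 f3 f4 f5 f6 where "b > 0" "chain3 k a b f1 f2 f3 f4 f5 f6"
    "hyperbolic_basis B f1 f2 f3 f4 f5 f6"
proof
  note rel = complex_block_relations[OF assms]
  define X where "X a = fst ((shift \<mu> ^^ a) u)" for a
  define Y where "Y a = snd ((shift \<mu> ^^ a) u)" for a
  note rel = rel[folded X_def Y_def]
  have rel': "B (Y a) (X b) = (if a + b = 2 then 1 else 0)" for a b
    using rel(3)[of b a] by (simp add: sym[of "Y a"] add.commute)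
  show "Im \<mu> > 0"
    using assms by (simp add: complex_block_def)
  show "chain3 k (Re \<mu>) (Im \<mu>) (Y 0) (X 0) (Y 1) (X 2) (Y 2) (X 1)"
    using rel(4)[of 0] rel(5)[of 0] rel(4)[of 1] rel(5)[of 1] rel(4)[of 2] rel(5)[of 2] rel(6,7)[of 3]
    by (simp add: chain3_def numeral_2_eq_2 numeral_3_eq_3)
  show "hyperbolic_basis B (Y 0) (X 0) (Y 1) (X 2) (Y 2) (X 1)"
    by (simp add: hyperbolic_basis_def hyperbolic_pair_def orthogonal_pairs_def rel rel')
qed

lemma hyperbolic_basisI:
  assumes "hyperbolic_pair B f1 f4" "hyperbolic_pair B f2 f5" "hyperbolic_pair B f3 f6"
    "perp {f1, f4} {f2, f5}" "perp {f1, f4} {f3, f6}" "perp {f2, f5} {f3, f6}"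
  shows "hyperbolic_basis B f1 f2 f3 f4 f5 f6"
  using assms by (simp add: hyperbolic_basis_def perp_pairs)

theorem ex_normal_frame:
  assumes U: "has_signature 3 3 UNIV"
    and nonull: "\<forall>x a. k x = a *\<^sub>R x \<longrightarrow> B x x = 0 \<longrightarrow> x = 0"
  shows "\<exists>f1 f2 f3 f4 f5 f6. hyperbolic_basis B f1 f2 f3 f4 f5 f6 \<and> normal_frame k f1 f2 f3 f4 f5 f6"
proof -
  obtain cs ps ns where cs: "\<forall>c\<in>set cs. complex_block c"
    and ps: "\<forall>r\<in>set ps. real_block 1 r" and ns: "\<forall>r\<in>set ns. real_block (-1) r"
    and len: "sum_list (map fst cs) + length ps = 3" "sum_list (map fst cs) + length ns = 3"
    and orth: "sorted_wrt perp (map chain_vectors cs @ map (\<lambda>r. {snd r}) (ps @ ns))"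
    using block_decomposition[OF U nonull] by blast
  have "\<forall>c\<in>set cs. 1 \<le> fst c"
    using cs by (auto simp: complex_block_def)
  moreover have "sum_list (map fst cs) \<le> 3"
    using len(1) by simp
  \<comment> \<open>Chain lengths are positive with sum at most 3; the signature (3, 3) fills the
    rest with as many positive as negative real eigenvectors.\<close>
  ultimately consider (0) "cs = []"
    | (1) \<mu> u where "cs = [(1, \<mu>, u)]"
    | (2) \<mu> u where "cs = [(2, \<mu>, u)]"
    | (3) \<mu> u where "cs = [(3, \<mu>, u)]"
    | (11) \<mu> u \<nu> v where "cs = [(1, \<mu>, u), (1, \<nu>, v)]"
    | (21) \<mu> u \<nu> v where "cs = [(2, \<mu>, u), (1, \<nu>, v)] \<or> cs = [(1, \<nu>, v), (2, \<mu>, u)]"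
    | (111) \<mu> u \<nu> v \<xi> w where "cs = [(1, \<mu>, u), (1, \<nu>, v), (1, \<xi>, w)]"
    using small_sum_lists[of cs, unfolded split_paired_Ex] by blast
  then show ?thesis
  proof cases
    case 0
    with len obtain p1 p2 p3 n1 n2 n3 where l: "ps = [p1, p2, p3]" "ns = [n1, n2, n3]"
      by (auto simp: numeral_3_eq_3 length_Suc_conv)
    have "real_block 1 p1" "real_block (-1) n1" "perp {snd p1} {snd n1}"
      using l ps ns orth by (auto simp: sorted_wrt_append)
    then obtain a1 b1 f1 f4 where 1: "real_plane k a1 b1 f1 f4" "hyperbolic_pair B f1 f4"
      "\<forall>T. perp {snd p1} T \<longrightarrow> perp {snd n1} T \<longrightarrow> perp {f1, f4} T"
      by (rule real_plane_of_blocks)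
    have "real_block 1 p2" "real_block (-1) n2" "perp {snd p2} {snd n2}"
      using l ps ns orth by (auto simp: sorted_wrt_append)
    then obtain a2 b2 f2 f5 where 2: "real_plane k a2 b2 f2 f5" "hyperbolic_pair B f2 f5"
      "\<forall>T. perp {snd p2} T \<longrightarrow> perp {snd n2} T \<longrightarrow> perp {f2, f5} T"
      by (rule real_plane_of_blocks)
    have "real_block 1 p3" "real_block (-1) n3" "perp {snd p3} {snd n3}"
      using l ps ns orth by (auto simp: sorted_wrt_append)
    then obtain a3 b3 f3 f6 where 3: "real_plane k a3 b3 f3 f6" "hyperbolic_pair B f3 f6"
      "\<forall>T. perp {snd p3} T \<longrightarrow> perp {snd n3} T \<longrightarrow> perp {f3, f6} T"
      by (rule real_plane_of_blocks)
    have o: "perp {snd p1} {snd p2}" "perp {snd p1} {snd p3}" "perp {snd p2} {snd p3}"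
      "perp {snd n1} {snd n2}" "perp {snd n1} {snd n3}" "perp {snd n2} {snd n3}"
      "perp {snd p1} {snd n2}" "perp {snd p1} {snd n3}" "perp {snd p2} {snd n3}"
      "perp {snd n1} {snd p2}" "perp {snd n1} {snd p3}" "perp {snd n2} {snd p3}"
      using orth l perp_sym by (auto simp: sorted_wrt_append)
    have "perp {f1, f4} {snd p2}" "perp {f1, f4} {snd n2}" "perp {f1, f4} {snd p3}"
      "perp {f1, f4} {snd n3}" "perp {f2, f5} {snd p3}" "perp {f2, f5} {snd n3}"
      using 1(3) 2(3) o by auto
    \<comment> \<open>The transport clauses replace a block on the left of \<open>perp\<close> only;
      its symmetry lets them act on the right-hand block as well.\<close>
    then have "perp {f1, f4} {f2, f5}" "perp {f1, f4} {f3, f6}" "perp {f2, f5} {f3, f6}"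
      using 2(3)[rule_format, of "{f1, f4}"] 3(3)[rule_format, of "{f1, f4}"] 3(3)[rule_format, of "{f2, f5}"] perp_sym by blast+
    then have "hyperbolic_basis B f1 f2 f3 f4 f5 f6"
      using 1 2 3 by (intro hyperbolic_basisI)
    moreover have "normal_frame k f1 f2 f3 f4 f5 f6"
      using 1(1) 2(1) 3(1) by (rule normal_frame_VII)
    ultimately show ?thesis
      by blast
  next
    case (1 \<mu> u)
    with len obtain p2 p3 n2 n3 where l: "ps = [p2, p3]" "ns = [n2, n3]"
      by (auto simp: eval_nat_numeral length_Suc_conv)
    have "complex_block (1, \<mu>, u)"
      using \<open>cs = _\<close> cs by simp
    then obtain a1 b1 f1 f4 where 1: "b1 > 0" "complex_plane k a1 b1 f1 f4" "hyperbolic_pair B f1 f4"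
      "\<forall>T. perp (chain_vectors (1, \<mu>, u)) T \<longrightarrow> perp {f1, f4} T"
      by (rule complex_plane_of_block)
    have "real_block 1 p2" "real_block (-1) n2" "perp {snd p2} {snd n2}"
      using l ps ns orth by (auto simp: sorted_wrt_append)
    then obtain a2 b2 f2 f5 where 2: "real_plane k a2 b2 f2 f5" "hyperbolic_pair B f2 f5"
      "\<forall>T. perp {snd p2} T \<longrightarrow> perp {snd n2} T \<longrightarrow> perp {f2, f5} T"
      by (rule real_plane_of_blocks)
    have "real_block 1 p3" "real_block (-1) n3" "perp {snd p3} {snd n3}"
      using l ps ns orth by (auto simp: sorted_wrt_append)
    then obtain a3 b3 f3 f6 where 3: "real_plane k a3 b3 f3 f6" "hyperbolic_pair B f3 f6"
      "\<forall>T. perp {snd p3} T \<longrightarrow> perp {snd n3} T \<longrightarrow> perp {f3, f6} T"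
      by (rule real_plane_of_blocks)
    have o: "perp {snd p2} {snd p3}" "perp {snd n2} {snd n3}"
      "perp {snd p2} {snd n3}" "perp {snd n2} {snd p3}"
      "perp (chain_vectors (1, \<mu>, u)) {snd p2}" "perp (chain_vectors (1, \<mu>, u)) {snd n2}"
      "perp (chain_vectors (1, \<mu>, u)) {snd p3}" "perp (chain_vectors (1, \<mu>, u)) {snd n3}"
      using orth l \<open>cs = _\<close> perp_sym by (auto simp: sorted_wrt_append)
    have "perp {f1, f4} {snd p2}" "perp {f1, f4} {snd n2}" "perp {f1, f4} {snd p3}"
      "perp {f1, f4} {snd n3}" "perp {f2, f5} {snd p3}" "perp {f2, f5} {snd n3}"
      using 1(4) 2(3) o by auto
    then have "perp {f1, f4} {f2, f5}" "perp {f1, f4} {f3, f6}" "perp {f2, f5} {f3, f6}"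
      using 2(3)[rule_format, of "{f1, f4}"] 3(3)[rule_format, of "{f1, f4}"] 3(3)[rule_format, of "{f2, f5}"] perp_sym by blast+
    then have "hyperbolic_basis B f1 f2 f3 f4 f5 f6"
      using 1 2 3 by (intro hyperbolic_basisI)
    moreover have "same_sign [b1]"
      using 1(1) by (intro same_sign_pos) auto
    then have "normal_frame k f1 f2 f3 f4 f5 f6"
      using 1(2) 2(1) 3(1) by (rule normal_frame_VI)
    ultimately show ?thesis
      by blast
  next
    case (2 \<mu> u)
    with len obtain p3 n3 where l: "ps = [p3]" "ns = [n3]"
      by (auto simp: eval_nat_numeral length_Suc_conv)
    have "complex_block (2, \<mu>, u)"
      using 2 cs by simp
    then obtain a1 b1 f1 f2 f4 f5 where 1: "b1 > 0" "chain2 k a1 b1 f1 f2 f4 f5"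
      "hyperbolic_pair B f1 f4" "hyperbolic_pair B f2 f5" "orthogonal_pairs B f1 f4 f2 f5"
      "\<forall>T. perp (chain_vectors (2, \<mu>, u)) T \<longrightarrow> perp {f1, f4} T \<and> perp {f2, f5} T"
      by (rule chain2_of_block)
    have "real_block 1 p3" "real_block (-1) n3" "perp {snd p3} {snd n3}"
      using l ps ns orth by (auto simp: sorted_wrt_append)
    then obtain a3 b3 f3 f6 where 3: "real_plane k a3 b3 f3 f6" "hyperbolic_pair B f3 f6"
      "\<forall>T. perp {snd p3} T \<longrightarrow> perp {snd n3} T \<longrightarrow> perp {f3, f6} T"
      by (rule real_plane_of_blocks)
    have "perp (chain_vectors (2, \<mu>, u)) {snd p3}" "perp (chain_vectors (2, \<mu>, u)) {snd n3}"
      using orth l 2 by (auto simp: sorted_wrt_append)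
    then have "perp {f1, f4} {f3, f6}" "perp {f2, f5} {f3, f6}"
      using 1(6) 3(3)[rule_format, of "{f1, f4}"] 3(3)[rule_format, of "{f2, f5}"] perp_sym by blast+
    then have "hyperbolic_basis B f1 f2 f3 f4 f5 f6"
      using 1 3 by (intro hyperbolic_basisI) (auto simp: perp_pairs)
    moreover have "same_sign [b1]"
      using 1(1) by (intro same_sign_pos) auto
    then have "normal_frame k f1 f2 f3 f4 f5 f6"
      using 1(2) 3(1) by (rule normal_frame_V)
    ultimately show ?thesis
      by blast
  next
    case (3 \<mu> u)
    then have "complex_block (3, \<mu>, u)"
      using cs by simp
    then obtain a b f1 f2 f3 f4 f5 f6 where *: "b > 0" "chain3 k a b f1 f2 f3 f4 f5 f6"
      "hyperbolic_basis B f1 f2 f3 f4 f5 f6"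
      by (rule chain3_of_block)
    moreover have "same_sign [b]"
      using *(1) by (intro same_sign_pos) auto
    ultimately show ?thesis
      using normal_frame_III[of b k a f1 f2 f3 f4 f5 f6] by blast
  next
    case (11 \<mu> u \<nu> v)
    with len obtain p3 n3 where l: "ps = [p3]" "ns = [n3]"
      by (auto simp: eval_nat_numeral length_Suc_conv)
    have "complex_block (1, \<mu>, u)"
      using \<open>cs = _\<close> cs by simp
    then obtain a1 b1 f1 f4 where 1: "b1 > 0" "complex_plane k a1 b1 f1 f4" "hyperbolic_pair B f1 f4"
      "\<forall>T. perp (chain_vectors (1, \<mu>, u)) T \<longrightarrow> perp {f1, f4} T"
      by (rule complex_plane_of_block)
    have "complex_block (1, \<nu>, v)"
      using \<open>cs = _\<close> cs by simp
    then obtain a2 b2 f2 f5 where 2: "b2 > 0" "complex_plane k a2 b2 f2 f5" "hyperbolic_pair B f2 f5"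
      "\<forall>T. perp (chain_vectors (1, \<nu>, v)) T \<longrightarrow> perp {f2, f5} T"
      by (rule complex_plane_of_block)
    have "real_block 1 p3" "real_block (-1) n3" "perp {snd p3} {snd n3}"
      using l ps ns orth by (auto simp: sorted_wrt_append)
    then obtain a3 b3 f3 f6 where 3: "real_plane k a3 b3 f3 f6" "hyperbolic_pair B f3 f6"
      "\<forall>T. perp {snd p3} T \<longrightarrow> perp {snd n3} T \<longrightarrow> perp {f3, f6} T"
      by (rule real_plane_of_blocks)
    have o: "perp (chain_vectors (1, \<mu>, u)) (chain_vectors (1, \<nu>, v))"
      "perp (chain_vectors (1, \<mu>, u)) {snd p3}" "perp (chain_vectors (1, \<mu>, u)) {snd n3}"
      "perp (chain_vectors (1, \<nu>, v)) {snd p3}" "perp (chain_vectors (1, \<nu>, v)) {snd n3}"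
      using orth l 11 by (auto simp: sorted_wrt_append)
    have "perp {f1, f4} (chain_vectors (1, \<nu>, v))"
      "perp {f1, f4} {snd p3}" "perp {f1, f4} {snd n3}" "perp {f2, f5} {snd p3}" "perp {f2, f5} {snd n3}"
      using 1(4) 2(4) o by auto
    then have "perp {f1, f4} {f2, f5}" "perp {f1, f4} {f3, f6}" "perp {f2, f5} {f3, f6}"
      using 2(4)[rule_format, of "{f1, f4}"] 3(3)[rule_format, of "{f1, f4}"] 3(3)[rule_format, of "{f2, f5}"] perp_sym by blast+
    then have "hyperbolic_basis B f1 f2 f3 f4 f5 f6"
      using 1 2 3 by (intro hyperbolic_basisI)
    moreover have "same_sign [b1, b2]"
      using 1(1) 2(1) by (intro same_sign_pos) auto
    then have "normal_frame k f1 f2 f3 f4 f5 f6"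
      using 1(2) 2(2) 3(1) by (rule normal_frame_IV)
    ultimately show ?thesis
      by blast
  next
    case (21 \<mu> u \<nu> v)
    have blocks: "complex_block (2, \<mu>, u)" "complex_block (1, \<nu>, v)"
      and o: "perp (chain_vectors (2, \<mu>, u)) (chain_vectors (1, \<nu>, v))"
      using 21 cs orth perp_sym by (auto simp: sorted_wrt_append)
    from blocks(1)
    obtain a1 b1 f1 f2 f4 f5 where 1: "b1 > 0" "chain2 k a1 b1 f1 f2 f4 f5"
      "hyperbolic_pair B f1 f4" "hyperbolic_pair B f2 f5" "orthogonal_pairs B f1 f4 f2 f5"
      "\<forall>T. perp (chain_vectors (2, \<mu>, u)) T \<longrightarrow> perp {f1, f4} T \<and> perp {f2, f5} T"
      by (rule chain2_of_block)
    from blocks(2)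
    obtain a3 b3 f3 f6 where 3: "b3 > 0" "complex_plane k a3 b3 f3 f6" "hyperbolic_pair B f3 f6"
      "\<forall>T. perp (chain_vectors (1, \<nu>, v)) T \<longrightarrow> perp {f3, f6} T"
      by (rule complex_plane_of_block)
    have "perp {f1, f4} {f3, f6}" "perp {f2, f5} {f3, f6}"
      using 1(6)[rule_format, OF o] 3(4)[rule_format, of "{f1, f4}"] 3(4)[rule_format, of "{f2, f5}"] perp_sym by blast+
    then have "hyperbolic_basis B f1 f2 f3 f4 f5 f6"
      using 1 3 by (intro hyperbolic_basisI) (auto simp: perp_pairs)
    moreover have "same_sign [b1, b3]"
      using 1(1) 3(1) by (intro same_sign_pos) auto
    then have "normal_frame k f1 f2 f3 f4 f5 f6"
      using 1(2) 3(2) by (rule normal_frame_II)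
    ultimately show ?thesis
      by blast
  next
    case (111 \<mu> u \<nu> v \<xi> w)
    have "complex_block (1, \<mu>, u)"
      using 111 cs by simp
    then obtain a1 b1 f1 f4 where 1: "b1 > 0" "complex_plane k a1 b1 f1 f4" "hyperbolic_pair B f1 f4"
      "\<forall>T. perp (chain_vectors (1, \<mu>, u)) T \<longrightarrow> perp {f1, f4} T"
      by (rule complex_plane_of_block)
    have "complex_block (1, \<nu>, v)"
      using \<open>cs = _\<close> cs by simp
    then obtain a2 b2 f2 f5 where 2: "b2 > 0" "complex_plane k a2 b2 f2 f5" "hyperbolic_pair B f2 f5"
      "\<forall>T. perp (chain_vectors (1, \<nu>, v)) T \<longrightarrow> perp {f2, f5} T"
      by (rule complex_plane_of_block)
    have "complex_block (1, \<xi>, w)"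
      using \<open>cs = _\<close> cs by simp
    then obtain a3 b3 f3 f6 where 3: "b3 > 0" "complex_plane k a3 b3 f3 f6" "hyperbolic_pair B f3 f6"
      "\<forall>T. perp (chain_vectors (1, \<xi>, w)) T \<longrightarrow> perp {f3, f6} T"
      by (rule complex_plane_of_block)
    have o: "perp (chain_vectors (1, \<mu>, u)) (chain_vectors (1, \<nu>, v))"
      "perp (chain_vectors (1, \<mu>, u)) (chain_vectors (1, \<xi>, w))"
      "perp (chain_vectors (1, \<nu>, v)) (chain_vectors (1, \<xi>, w))"
      using orth 111 by (auto simp: sorted_wrt_append)
    have "perp {f1, f4} {f2, f5}" "perp {f1, f4} {f3, f6}" "perp {f2, f5} {f3, f6}"
      using 1(4)[rule_format, OF o(1)] 1(4)[rule_format, OF o(2)] 2(4)[rule_format, OF o(3)]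
        2(4)[rule_format, of "{f1, f4}"] 3(4)[rule_format, of "{f1, f4}"] 3(4)[rule_format, of "{f2, f5}"] perp_sym by blast+
    then have "hyperbolic_basis B f1 f2 f3 f4 f5 f6"
      using 1 2 3 by (intro hyperbolic_basisI)
    moreover have "same_sign [b1, b2, b3]"
      using 1(1) 2(1) 3(1) by (intro same_sign_pos) auto
    then have "normal_frame k f1 f2 f3 f4 f5 f6"
      using 1(2) 2(2) 3(2) by (rule normal_frame_I)
    ultimately show ?thesis
      by blast
  qed
qed

end

section \<open>Two-forms on a four-dimensional space\<close>

type_synonym real4 = "real \<times> real \<times> real \<times> real"
type_synonym real6 = "real \<times> real \<times> real \<times> real \<times> real \<times> real"

text \<open>Coordinates of a 2-form are listed in the order 01, 02, 03, 23, 31, 12.\<close>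

fun wedge6 :: "real6 \<Rightarrow> real6 \<Rightarrow> real" where
  "wedge6 (a1, a2, a3, a4, a5, a6) (b1, b2, b3, b4, b5, b6) =
     a1 * b4 + a4 * b1 + a2 * b5 + a5 * b2 + a3 * b6 + a6 * b3"

text \<open>The wedge product of two covectors.\<close>

fun ext :: "real4 \<Rightarrow> real4 \<Rightarrow> real6" where
  "ext (a0, a1, a2, a3) (b0, b1, b2, b3) =
     (a0 * b1 - a1 * b0, a0 * b2 - a2 * b0, a0 * b3 - a3 * b0,
      a2 * b3 - a3 * b2, a3 * b1 - a1 * b3, a1 * b2 - a2 * b1)"

fun pairing :: "real4 \<Rightarrow> real4 \<Rightarrow> real" where
  "pairing (a0, a1, a2, a3) (b0, b1, b2, b3) = a0 * b0 + a1 * b1 + a2 * b2 + a3 * b3"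

text \<open>\<open>lower f v\<close> contracts the 2-form \<open>f\<close> with the vector \<open>v\<close>; \<open>upper f \<xi>\<close> is the vector dual to
  the 3-form \<open>f \<and> \<xi>\<close>. They are the two halves of the Clifford action of 2-forms on spinors.\<close>

fun lower :: "real6 \<Rightarrow> real4 \<Rightarrow> real4" where
  "lower (f1, f2, f3, f4, f5, f6) (v0, v1, v2, v3) =
     (f1 * v1 + f2 * v2 + f3 * v3, - f1 * v0 + f6 * v2 - f5 * v3,
      - f2 * v0 - f6 * v1 + f4 * v3, - f3 * v0 + f5 * v1 - f4 * v2)"

fun upper :: "real6 \<Rightarrow> real4 \<Rightarrow> real4" where
  "upper (f1, f2, f3, f4, f5, f6) (x0, x1, x2, x3) =
     (f4 * x1 + f5 * x2 + f6 * x3, - f4 * x0 + f3 * x2 - f2 * x3,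
      - f5 * x0 - f3 * x1 + f1 * x3, - f6 * x0 + f2 * x1 - f1 * x2)"

text \<open>The Clifford relation for the quadratic form of \<open>wedge6\<close>: orthogonal
  2-forms anticommute and null ones square to zero.\<close>

lemma lower_upper: "lower f (upper g x) = - (wedge6 f g *\<^sub>R x) - lower g (upper f x)"
  by (cases f; cases g; cases x) (simp add: algebra_simps)

lemma upper_lower: "upper f (lower g x) = - (wedge6 f g *\<^sub>R x) - upper g (lower f x)"
  by (cases f; cases g; cases x) (simp add: algebra_simps)

lemma lower_0 [simp]: "lower f 0 = 0" and upper_0 [simp]: "upper f 0 = 0"
  by (cases f; simp add: zero_prod_def)+

lemma lower_minus [simp]: "lower f (- x) = - lower f x"
  and upper_minus [simp]: "upper f (- x) = - upper f x"
  by (cases f; cases x; simp)+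

lemma lower_diff: "lower f (x - y) = lower f x - lower f y"
  by (cases f; cases x; cases y; simp add: algebra_simps)

lemma upper_scale [simp]: "upper f (c *\<^sub>R x) = c *\<^sub>R upper f x"
  by (cases f; cases x; simp add: algebra_simps)

lemma upper_scale_left: "upper (c *\<^sub>R f) x = c *\<^sub>R upper f x"
  by (cases f; cases x; simp add: algebra_simps)

lemma pairing_upper: "pairing x (upper f y) = - pairing (upper f x) y"
  by (cases f; cases x; cases y) (simp add: algebra_simps)

lemma pairing_commute: "pairing x y = pairing y x"
  by (cases x; cases y) (simp add: algebra_simps)

lemma pairing_minus [simp]: "pairing x (- y) = - pairing x y" "pairing (- x) y = - pairing x y"
  by (cases x; cases y; simp add: algebra_simps)+

lemma upper_ext [simp]: "upper (ext a b) a = 0" "upper (ext a b) b = 0"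
  by (cases a; cases b; simp add: zero_prod_def algebra_simps)+

text \<open>The Euclidean Hodge dual; it turns the wedge product of 2-forms into the standard inner
  product.\<close>

fun star :: "real6 \<Rightarrow> real6" where
  "star (f1, f2, f3, f4, f5, f6) = (f4, f5, f6, f1, f2, f3)"

lemma ext_0 [simp]: "ext 0 b = 0" "ext b 0 = 0"
  by (cases b; simp add: zero_prod_def)+

lemma wedge6_0 [simp]: "wedge6 0 g = 0" "wedge6 g 0 = 0"
  by (cases g; simp add: zero_prod_def)+

lemma ext_lower_general: "ext a (lower f v) = star (ext (upper f a) v) - pairing a v *\<^sub>R f"
  by (cases f; cases a; cases v) (simp add: algebra_simps)

text \<open>Contracting \<open>f \<and> a = 0\<close> with \<open>v\<close> leaves two terms by the
  product rule. The minus sign arises because \<open>lower\<close> inserts \<open>v\<close> into the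
  second slot of \<open>f\<close>.\<close>

lemma ext_lower:
  assumes "upper f a = 0"
  shows "ext a (lower f v) = - (pairing a v *\<^sub>R f)"
proof -
  have "star 0 = 0"
    by (simp add: zero_prod_def)
  then show ?thesis
    by (simp add: ext_lower_general assms)
qed

lemma ext_eq_0:
  assumes "ext a b = 0" "a \<noteq> 0"
  obtains c where "b = c *\<^sub>R a"
proof -
  obtain a0 a1 a2 a3 b0 b1 b2 b3 where [simp]: "a = (a0, a1, a2, a3)" "b = (b0, b1, b2, b3)"
    by (cases a; cases b) blast
  have e: "a0 * b1 = a1 * b0" "a0 * b2 = a2 * b0" "a0 * b3 = a3 * b0"
      "a2 * b3 = a3 * b2" "a3 * b1 = a1 * b3" "a1 * b2 = a2 * b1"
    using assms(1) by (simp_all add: zero_prod_def)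
  consider "a0 \<noteq> 0" | "a1 \<noteq> 0" | "a2 \<noteq> 0" | "a3 \<noteq> 0"
    using assms(2) by (auto simp: zero_prod_def)
  then show ?thesis
  proof cases
    case 1
    then show ?thesis
      using e by (intro that[of "b0 / a0"]) (auto simp: field_simps)
  next
    case 2
    then show ?thesis
      using e by (intro that[of "b1 / a1"]) (auto simp: field_simps)
  next
    case 3
    then show ?thesis
      using e by (intro that[of "b2 / a2"]) (auto simp: field_simps)
  next
    case 4
    then show ?thesis
      using e by (intro that[of "b3 / a3"]) (auto simp: field_simps)
  qed
qed

lemma lower_eq_0: "(\<And>v. lower f v = 0) \<Longrightarrow> f = 0"
proof -
  assume *: "\<And>v. lower f v = 0"
  obtain f1 f2 f3 f4 f5 f6 where f: "f = (f1, f2, f3, f4, f5, f6)"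
    by (cases f) blast
  show "f = 0"
    using *[of "(1, 0, 0, 0)"] *[of "(0, 1, 0, 0)"] *[of "(0, 0, 1, 0)"]
    by (simp add: f zero_prod_def)
qed

lemma anticommute:
  assumes "wedge6 f g = 0"
  shows "lower f (upper g x) = - lower g (upper f x)" "upper f (lower g x) = - upper g (lower f x)"
  using lower_upper[of f g x] upper_lower[of f g x] assms by simp_all

lemma null_square:
  assumes "wedge6 f f = 0"
  shows "lower f (upper f x) = 0" "upper f (lower f x) = 0"
  using lower_upper[of f f x] upper_lower[of f f x] assms
  by (simp_all add: eq_neg_iff_add_eq_0 flip: scaleR_2)

text \<open>Fact number \<open>6 * (i - 1) + j\<close> evaluates the product of the
  \<open>i\<close>-th and the \<open>j\<close>-th vector; later proofs select facts by this
  number.\<close>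

lemma hyperbolic_basis_wedge6:
  assumes "hyperbolic_basis wedge6 f1 f2 f3 f4 f5 f6"
  shows "wedge6 f1 f1 = 0" "wedge6 f1 f2 = 0" "wedge6 f1 f3 = 0" "wedge6 f1 f4 = 1" "wedge6 f1 f5 = 0" "wedge6 f1 f6 = 0"
    "wedge6 f2 f1 = 0" "wedge6 f2 f2 = 0" "wedge6 f2 f3 = 0" "wedge6 f2 f4 = 0" "wedge6 f2 f5 = 1" "wedge6 f2 f6 = 0"
    "wedge6 f3 f1 = 0" "wedge6 f3 f2 = 0" "wedge6 f3 f3 = 0" "wedge6 f3 f4 = 0" "wedge6 f3 f5 = 0" "wedge6 f3 f6 = 1"
    "wedge6 f4 f1 = 1" "wedge6 f4 f2 = 0" "wedge6 f4 f3 = 0" "wedge6 f4 f4 = 0" "wedge6 f4 f5 = 0" "wedge6 f4 f6 = 0"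
    "wedge6 f5 f1 = 0" "wedge6 f5 f2 = 1" "wedge6 f5 f3 = 0" "wedge6 f5 f4 = 0" "wedge6 f5 f5 = 0" "wedge6 f5 f6 = 0"
    "wedge6 f6 f1 = 0" "wedge6 f6 f2 = 0" "wedge6 f6 f3 = 1" "wedge6 f6 f4 = 0" "wedge6 f6 f5 = 0" "wedge6 f6 f6 = 0"
  using assms unfolding hyperbolic_basis_def hyperbolic_pair_def orthogonal_pairs_def by auto

text \<open>A common factor is found in the image of the Clifford product of the three 2-forms.\<close>

lemma common_factor_dichotomy:
  assumes "hyperbolic_basis wedge6 f1 f2 f3 f4 f5 f6"
  shows "(\<exists>\<xi>. \<xi> \<noteq> 0 \<and> upper f1 \<xi> = 0 \<and> upper f2 \<xi> = 0 \<and> upper f3 \<xi> = 0) \<or>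
    (\<exists>\<xi>. \<xi> \<noteq> 0 \<and> upper f1 \<xi> = 0 \<and> upper f2 \<xi> = 0 \<and> upper f6 \<xi> = 0)"
proof (rule ccontr)
  assume no: "\<not> ?thesis"
  note w = hyperbolic_basis_wedge6[OF assms]
  \<comment> \<open>Each 2-form anticommutes past the others until it meets its own copy, where the
    square of a null form is zero.\<close>
  have killed: "upper f1 \<xi> = 0 \<and> upper f2 \<xi> = 0 \<and> upper f \<xi> = 0"
    if "\<xi> = lower f (upper f1 (lower f2 v))" "wedge6 f f = 0" "wedge6 f1 f = 0" "wedge6 f2 f = 0" for f \<xi> v
    using anticommute(2)[OF that(3)] anticommute(2)[OF that(4)] null_square[OF w(1)] null_square[OF w(8)]
      null_square[OF that(2)] anticommute(1)[OF w(7)]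
    by (simp add: that(1))
  have "lower f3 (upper f1 (lower f2 v)) = 0" "lower f6 (upper f1 (lower f2 v)) = 0" for v
    using no killed[OF refl w(15,3,9)] killed[OF refl w(36,6,12)] by blast+
  \<comment> \<open>Both products vanish, but \<open>f3\<close> and \<open>f6\<close> form a
    hyperbolic pair: by the Clifford relation only zero is annihilated by both of them.\<close>
  then have T: "upper f1 (lower f2 v) = 0" for v
    using upper_lower[of f3 f6 "upper f1 (lower f2 v)"] w(18) by simp
  \<comment> \<open>The same conclusion for the other half of the spinors: \<open>f3\<close> and
    \<open>f6\<close> can be moved to the right of \<open>f1\<close> and \<open>f2\<close>, where
    \<open>T\<close> applies.\<close>
  have T': "lower f1 (upper f2 \<xi>) = 0" for \<xi>
  proof -
    have "upper f3 (lower f1 (upper f2 \<xi>)) = upper f1 (lower f2 (upper f3 \<xi>))"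
      "upper f6 (lower f1 (upper f2 \<xi>)) = upper f1 (lower f2 (upper f6 \<xi>))"
      by (simp_all add: anticommute(2)[OF w(13)] anticommute(2)[OF w(31)] anticommute(1)[OF w(14)]
          anticommute(1)[OF w(32)])
    then have "upper f3 (lower f1 (upper f2 \<xi>)) = 0" "upper f6 (lower f1 (upper f2 \<xi>)) = 0"
      by (simp_all add: T)
    then show ?thesis
      using lower_upper[of f3 f6 "lower f1 (upper f2 \<xi>)"] w(18) by simp
  qed
  \<comment> \<open>Inserting \<open>f5\<close> after \<open>f2\<close> in \<open>T'\<close> and
    applying the Clifford relation of the pair \<open>(f2, f5)\<close> leaves \<open>f1\<close>
    alone, up to a term that vanishes by \<open>T\<close>.\<close>
  have "lower f1 v = 0" for v
  proof -
    have "upper f2 (lower f5 v) = - v - upper f5 (lower f2 v)"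
      using upper_lower[of f2 f5 v] w(11) by simp
    then have "lower f1 (- v - upper f5 (lower f2 v)) = 0"
      using T'[of "lower f5 v"] by simp
    then show ?thesis
      using T[of v] anticommute(1)[OF w(5), of "lower f2 v"] by (simp add: lower_diff)
  qed
  then have "f1 = 0"
    by (rule lower_eq_0)
  then show False
    using w(4) by simp
qed

text \<open>Rescaling the coframe changes \<open>D\<close> by a square only, so its sign cannot be
  normalised away.\<close>

definition induced_by ::
  "real \<Rightarrow> real4 \<Rightarrow> real4 \<Rightarrow> real4 \<Rightarrow> real4 \<Rightarrow> real6 \<Rightarrow> real6 \<Rightarrow> real6 \<Rightarrow> real6 \<Rightarrow> real6 \<Rightarrow> real6 \<Rightarrow> bool" where
  "induced_by D \<theta>0 \<theta>1 \<theta>2 \<theta>3 f1 f2 f3 f4 f5 f6 \<longleftrightarrow> D \<noteq> 0 \<and>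
     ext \<theta>0 \<theta>1 = D *\<^sub>R f1 \<and> ext \<theta>0 \<theta>2 = D *\<^sub>R f2 \<and> ext \<theta>0 \<theta>3 = D *\<^sub>R f3 \<and>
     ext \<theta>2 \<theta>3 = D *\<^sub>R f4 \<and> ext \<theta>3 \<theta>1 = D *\<^sub>R f5 \<and> ext \<theta>1 \<theta>2 = D *\<^sub>R f6"

definition induced_basis :: "real6 \<Rightarrow> real6 \<Rightarrow> real6 \<Rightarrow> real6 \<Rightarrow> real6 \<Rightarrow> real6 \<Rightarrow> bool" where
  "induced_basis f1 f2 f3 f4 f5 f6 \<longleftrightarrow>
     (\<exists>D \<theta>0 \<theta>1 \<theta>2 \<theta>3. induced_by D \<theta>0 \<theta>1 \<theta>2 \<theta>3 f1 f2 f3 f4 f5 f6)"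

lemma ext_commute: "ext a b = - ext b a"
  by (cases a; cases b) simp

text \<open>The formulas for the covectors are read off from the model case: there
  \<open>f6 \<and> \<xi>\<close> is a multiple of
  \<open>\<theta>1 \<and> \<theta>2 \<and> \<theta>0\<close>, whose dual vector points in direction
  3, and contracting \<open>f5\<close>, a multiple of \<open>\<theta>3 \<and> \<theta>1\<close>,
  with it returns a multiple of \<open>\<theta>1\<close>.\<close>

lemma induced_by_common_factor:
  assumes "hyperbolic_basis wedge6 f1 f2 f3 f4 f5 f6"
    and \<xi>: "\<xi> \<noteq> 0" "upper f1 \<xi> = 0" "upper f2 \<xi> = 0" "upper f3 \<xi> = 0"
  shows "induced_basis f1 f2 f3 f4 f5 f6"
proof -
  note w = hyperbolic_basis_wedge6[OF assms(1)]
  define \<theta>1 where "\<theta>1 = lower f5 (upper f6 \<xi>)"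
  define \<theta>2 where "\<theta>2 = lower f6 (upper f4 \<xi>)"
  define \<theta>3 where "\<theta>3 = lower f4 (upper f5 \<xi>)"
  \<comment> \<open>The factor that \<open>ext_lower\<close> produces for
    \<open>ext \<theta>1 \<theta>2\<close>; by cyclic symmetry the other products yield the same
    one.\<close>
  define D where "D = - pairing \<theta>1 (upper f4 \<xi>)"
  have u: "upper f1 \<theta>1 = 0" "upper f5 \<theta>1 = 0" "upper f6 \<theta>1 = 0"
    "upper f2 \<theta>2 = 0" "upper f6 \<theta>2 = 0" "upper f4 \<theta>2 = 0"
    "upper f3 \<theta>3 = 0" "upper f4 \<theta>3 = 0" "upper f5 \<theta>3 = 0"
    unfolding \<theta>1_def \<theta>2_def \<theta>3_def
    using null_square[OF w(22)] null_square[OF w(29)] null_square[OF w(36)]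
      anticommute(2)[OF w(5)] anticommute(1)[OF w(6)] anticommute(2)[OF w(35)]
      anticommute(2)[OF w(12)] anticommute(1)[OF w(10)] anticommute(2)[OF w(24)]
      anticommute(2)[OF w(16)] anticommute(1)[OF w(17)] anticommute(2)[OF w(28)]
      \<xi>(2-4) by simp_all
  have \<theta>': "\<theta>3 = - lower f5 (upper f4 \<xi>)"
    using anticommute(1)[OF w(23), of \<xi>] by (simp add: \<theta>3_def)
  have cyc: "upper f5 \<theta>2 = upper f4 \<theta>1" "upper f6 \<theta>3 = upper f4 \<theta>1"
    unfolding \<theta>1_def \<theta>2_def \<theta>3_def
    by (simp_all add: anticommute[OF w(28)] anticommute[OF w(34)] anticommute[OF w(35)])
  have D: "pairing \<theta>1 (upper f4 \<xi>) = - D" "pairing \<theta>2 (upper f5 \<xi>) = - D" "pairing \<theta>3 (upper f6 \<xi>) = - D"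
    using cyc by (simp_all add: D_def pairing_upper)
  have "ext \<theta>1 \<theta>3 = - (D *\<^sub>R f5)"
    using ext_lower[OF u(2), of "- upper f4 \<xi>"] by (simp add: \<theta>' D)
  then have e5: "ext \<theta>3 \<theta>1 = D *\<^sub>R f5"
    by (simp add: ext_commute[of \<theta>3])
  have e6: "ext \<theta>1 \<theta>2 = D *\<^sub>R f6"
    using ext_lower[OF u(3), of "upper f4 \<xi>"] by (simp add: \<theta>2_def[symmetric] D)
  have e4: "ext \<theta>2 \<theta>3 = D *\<^sub>R f4"
    using ext_lower[OF u(6), of "upper f5 \<xi>"] by (simp add: \<theta>3_def[symmetric] D)
  have "lower f1 (upper f4 \<theta>1) = - \<theta>1" "lower f2 (upper f5 \<theta>2) = - \<theta>2" "lower f3 (upper f6 \<theta>3) = - \<theta>3"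
    using lower_upper[of f1 f4 \<theta>1] lower_upper[of f2 f5 \<theta>2] lower_upper[of f3 f6 \<theta>3] w(4,11,18) u(1,4,7)
    by simp_all
  then have l: "lower f1 (- upper f4 \<theta>1) = \<theta>1" "lower f2 (- upper f5 \<theta>2) = \<theta>2" "lower f3 (- upper f6 \<theta>3) = \<theta>3"
    by simp_all
  have p: "pairing \<xi> (upper f4 \<theta>1) = D" "pairing \<xi> (upper f5 \<theta>2) = D" "pairing \<xi> (upper f6 \<theta>3) = D"
    unfolding pairing_upper[of \<xi>] using D by (simp_all add: pairing_commute)
  have e123: "ext \<xi> \<theta>1 = D *\<^sub>R f1" "ext \<xi> \<theta>2 = D *\<^sub>R f2" "ext \<xi> \<theta>3 = D *\<^sub>R f3"
    using ext_lower[OF \<xi>(2), of "- upper f4 \<theta>1"] ext_lower[OF \<xi>(3), of "- upper f5 \<theta>2"]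
      ext_lower[OF \<xi>(4), of "- upper f6 \<theta>3"] unfolding l by (simp_all add: p)
  \<comment> \<open>Otherwise \<open>\<theta>1\<close> is a multiple of \<open>\<xi>\<close> and
    killed by \<open>f2\<close>. But \<open>f2\<close> sends \<open>\<theta>1\<close> to
    \<open>- upper f6 \<xi>\<close>, so both \<open>f3\<close> and \<open>f6\<close> would kill
    \<open>\<xi>\<close>, against the Clifford relation.\<close>
  have "D \<noteq> 0"
  proof
    assume "D = 0"
    then have "ext \<xi> \<theta>1 = 0"
      using e123(1) by simp
    then obtain c where "\<theta>1 = c *\<^sub>R \<xi>"
      using \<xi>(1) by (rule ext_eq_0)
    then have "upper f2 \<theta>1 = 0"
      using \<xi>(3) by simp
    moreover have "upper f2 \<theta>1 = - upper f6 \<xi>"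
      using upper_lower[of f2 f5 "upper f6 \<xi>"] w(11) anticommute(1)[OF w(12), of \<xi>] \<xi>(3)
      by (simp add: \<theta>1_def)
    ultimately have "upper f6 \<xi> = 0"
      by simp
    then have "\<xi> = 0"
      using lower_upper[of f3 f6 \<xi>] w(18) \<xi>(4) by simp
    with \<xi>(1) show False
      by simp
  qed
  with e123 e4 e5 e6 show ?thesis
    unfolding induced_basis_def induced_by_def by blast
qed

section \<open>Odd exchanges that preserve normal frames\<close>

lemma complex_plane_swap: "complex_plane k a b f g \<Longrightarrow> complex_plane k a (- b) g f"
  by (simp add: complex_plane_def)

lemma real_plane_swap: "real_plane k a b f g \<Longrightarrow> real_plane k a b g f"
  by (simp add: real_plane_def add.commute)

text \<open>The exchange replaces the generator of the chain by \<open>\<i>\<close> times its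
  conjugate, which generates a chain for the conjugate eigenvalue; hence the new sign of
  \<open>b\<close>. The same holds for \<open>complex_plane\<close> and
  \<open>chain3\<close>.\<close>

lemma chain2_swap: "chain2 k a b f1 f2 f4 f5 \<Longrightarrow> chain2 k a (- b) f2 f1 f5 f4"
  by (simp add: chain2_def)

lemma chain3_swap: "chain3 k a b f1 f2 f3 f4 f5 f6 \<Longrightarrow> chain3 k a (- b) f2 f1 f6 f5 f4 f3"
  by (simp add: chain3_def)

lemma same_sign_minus: "same_sign bs \<Longrightarrow> same_sign (map uminus bs)"
  unfolding same_sign_def set_map by (metis imageE neg_equal_0_iff_equal sgn_minus)

text \<open>All three are odd permutations of the six vectors, so each of them exchanges the two
  families of maximal null subspaces.\<close>

lemma hyperbolic_basis_swaps:
  assumes "hyperbolic_basis B f1 f2 f3 f4 f5 f6"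
  shows "hyperbolic_basis B f1 f2 f6 f4 f5 f3" "hyperbolic_basis B f4 f5 f6 f1 f2 f3"
    "hyperbolic_basis B f2 f1 f6 f5 f4 f3"
  using assms by (auto simp: hyperbolic_basis_def hyperbolic_pair_def orthogonal_pairs_def)

lemma upper_eq_0_of_ext:
  assumes "D \<noteq> 0" "ext a b = D *\<^sub>R f"
  shows "upper f a = 0" "upper f b = 0"
  using assms upper_ext[of a b] upper_scale_left[of D f] by auto

theorem ex_induced_normal_frame:
  assumes H: "hyperbolic_basis wedge6 f1 f2 f3 f4 f5 f6" and nf: "normal_frame k f1 f2 f3 f4 f5 f6"
  shows "\<exists>g1 g2 g3 g4 g5 g6. induced_basis g1 g2 g3 g4 g5 g6 \<and>
    hyperbolic_basis wedge6 g1 g2 g3 g4 g5 g6 \<and> normal_frame k g1 g2 g3 g4 g5 g6"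
  using common_factor_dichotomy[OF H]
proof
  assume "\<exists>\<xi>. \<xi> \<noteq> 0 \<and> upper f1 \<xi> = 0 \<and> upper f2 \<xi> = 0 \<and> upper f3 \<xi> = 0"
  then show ?thesis
    using induced_by_common_factor[OF H] H nf by blast
next
  note H' = hyperbolic_basis_swaps[OF H]
  assume "\<exists>\<xi>. \<xi> \<noteq> 0 \<and> upper f1 \<xi> = 0 \<and> upper f2 \<xi> = 0 \<and> upper f6 \<xi> = 0"
  then obtain D \<theta>0 \<theta>1 \<theta>2 \<theta>3 where ind: "induced_by D \<theta>0 \<theta>1 \<theta>2 \<theta>3 f1 f2 f6 f4 f5 f3"
    using induced_by_common_factor[OF H'(1)] unfolding induced_basis_def by blast
  have D: "D \<noteq> 0" and e: "ext \<theta>0 \<theta>1 = D *\<^sub>R f1" "ext \<theta>0 \<theta>2 = D *\<^sub>R f2" "ext \<theta>0 \<theta>3 = D *\<^sub>R f6"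
    "ext \<theta>2 \<theta>3 = D *\<^sub>R f4" "ext \<theta>3 \<theta>1 = D *\<^sub>R f5"
    using ind by (auto simp: induced_by_def)
  \<comment> \<open>The coframe found for the first exchange also serves the other two:
    \<open>\<theta>3\<close> divides \<open>f4\<close>, \<open>f5\<close>, \<open>f6\<close>, and
    \<open>\<theta>0\<close> divides \<open>f2\<close>, \<open>f1\<close>,
    \<open>f6\<close>.\<close>
  have z: "upper f1 \<theta>0 = 0" "upper f2 \<theta>0 = 0" "upper f6 \<theta>0 = 0"
    "upper f4 \<theta>3 = 0" "upper f5 \<theta>3 = 0" "upper f6 \<theta>3 = 0"
    using upper_eq_0_of_ext[OF D] e by blast+
  have "wedge6 f1 f4 = 1" "wedge6 f3 f6 = 1"
    using hyperbolic_basis_wedge6[OF H] by auto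
  then have "f1 \<noteq> 0" "f6 \<noteq> 0"
    by auto
  then have nz: "\<theta>0 \<noteq> 0" "\<theta>3 \<noteq> 0"
    using e(1,3) D by (metis ext_0 scaleR_eq_0_iff)+
  have "induced_basis f1 f2 f6 f4 f5 f3"
    using ind unfolding induced_basis_def by blast
  moreover have "induced_basis f4 f5 f6 f1 f2 f3"
    using induced_by_common_factor[OF H'(2) nz(2) z(4-6)] .
  moreover have "induced_basis f2 f1 f6 f5 f4 f3"
    using induced_by_common_factor[OF H'(3) nz(1) z(2,1,3)] .
  moreover
  \<comment> \<open>A real plane in third place is swapped for free. Metaclass I exchanges all three
    pairs; II and III use the exchange that conjugates the chain together with the third
    pair.\<close>
  have "normal_frame k f1 f2 f6 f4 f5 f3 \<or> normal_frame k f4 f5 f6 f1 f2 f3 \<or>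
    normal_frame k f2 f1 f6 f5 f4 f3"
    using nf[unfolded normal_frame_def]
  proof (elim disjE exE conjE)
    fix a1 a2 a3 b1 b2 b3
    assume *: "same_sign [b1, b2, b3]" "complex_plane k a1 b1 f1 f4" "complex_plane k a2 b2 f2 f5"
      "complex_plane k a3 b3 f3 f6"
    have "same_sign [- b1, - b2, - b3]"
      using same_sign_minus[OF *(1)] by simp
    from normal_frame_I[OF this *(2-4)[THEN complex_plane_swap]] show ?thesis
      by blast
  next
    fix a1 a2 a3 b1 b2 b3
    assume *: "same_sign [b1, b2]" "complex_plane k a1 b1 f1 f4" "complex_plane k a2 b2 f2 f5"
      "real_plane k a3 b3 f3 f6"
    from normal_frame_IV[OF *(1-3) real_plane_swap[OF *(4)]] show ?thesis
      by blast
  next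
    fix a1 a2 a3 b1 b2 b3
    assume *: "same_sign [b1]" "complex_plane k a1 b1 f1 f4" "real_plane k a2 b2 f2 f5"
      "real_plane k a3 b3 f3 f6"
    from normal_frame_VI[OF *(1-3) real_plane_swap[OF *(4)]] show ?thesis
      by blast
  next
    fix a1 a2 a3 b1 b2 b3
    assume *: "real_plane k a1 b1 f1 f4" "real_plane k a2 b2 f2 f5" "real_plane k a3 b3 f3 f6"
    from normal_frame_VII[OF *(1-2) real_plane_swap[OF *(3)]] show ?thesis
      by blast
  next
    fix a1 a2 b1 b2
    assume *: "same_sign [b1, b2]" "chain2 k a1 b1 f1 f2 f4 f5" "complex_plane k a2 b2 f3 f6"
    have "same_sign [- b1, - b2]"
      using same_sign_minus[OF *(1)] by simp
    from normal_frame_II[OF this chain2_swap[OF *(2)] complex_plane_swap[OF *(3)]] show ?thesis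
      by blast
  next
    fix a1 a2 b1 b2
    assume *: "same_sign [b1]" "chain2 k a1 b1 f1 f2 f4 f5" "real_plane k a2 b2 f3 f6"
    from normal_frame_V[OF *(1-2) real_plane_swap[OF *(3)]] show ?thesis
      by blast
  next
    fix a b
    assume *: "same_sign [b]" "chain3 k a b f1 f2 f3 f4 f5 f6"
    have "same_sign [- b]"
      using same_sign_minus[OF *(1)] by simp
    from normal_frame_III[OF this chain3_swap[OF *(2)]] show ?thesis
      by blast
  qed
  ultimately show ?thesis
    using H' by blast
qed

section \<open>Components of 2-forms and of the tensor\<close>

lemma idx4_eq: "idx4 = {0, 1, 2, 3}"
  by (auto simp: idx4_def)

lemma sum_idx4: "(\<Sum>i\<in>idx4. f i) = f 0 + f 1 + f 2 + f 3"
  by (simp add: idx4_eq add.assoc)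

fun comp4 :: "real4 \<Rightarrow> nat \<Rightarrow> real" where
  "comp4 (x0, x1, x2, x3) i = (if i = 0 then x0 else if i = 1 then x1 else if i = 2 then x2 else x3)"

definition vec4 :: "(nat \<Rightarrow> real) \<Rightarrow> real4" where
  "vec4 x = (x 0, x 1, x 2, x 3)"

definition form6 :: "(nat \<Rightarrow> nat \<Rightarrow> real) \<Rightarrow> real6" where
  "form6 F = (F 0 1, F 0 2, F 0 3, F 2 3, F 3 1, F 1 2)"

fun comp6 :: "real6 \<Rightarrow> nat \<Rightarrow> nat \<Rightarrow> real" where
  "comp6 (f1, f2, f3, f4, f5, f6) i j =
     (if i = 0 then (if j = 1 then f1 else if j = 2 then f2 else if j = 3 then f3 else 0)
      else if i = 1 then (if j = 0 then - f1 else if j = 2 then f6 else if j = 3 then - f5 else 0)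
      else if i = 2 then (if j = 0 then - f2 else if j = 1 then - f6 else if j = 3 then f4 else 0)
      else if j = 0 then - f3 else if j = 1 then f5 else if j = 2 then - f4 else 0)"

definition kappa6 :: "(nat \<Rightarrow> nat \<Rightarrow> nat \<Rightarrow> nat \<Rightarrow> real) \<Rightarrow> real6 \<Rightarrow> real6" where
  "kappa6 K f = form6 (kappa_act K (comp6 f))"

lemma nat_less_4: "i < 4 \<longleftrightarrow> i = 0 \<or> i = 1 \<or> i = 2 \<or> i = (3::nat)"
  by auto

lemma two_form_comp6: "two_form (comp6 f)"
  by (cases f) (auto simp: two_form_def nat_less_4)

lemma comp6_form6:
  assumes "two_form F" "i < 4" "j < 4"
  shows "comp6 (form6 F) i j = F i j"
proof -
  have "F i j = - F j i" if "i < 4" "j < 4" for i j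
    using assms(1) that unfolding two_form_def by blast
  from this[of 0 0] this[of 1 1] this[of 2 2] this[of 3 3] this[of 1 0] this[of 2 0] this[of 3 0]
    this[of 2 1] this[of 1 3] this[of 3 2]
  show ?thesis
    using assms(2,3) by (auto simp: form6_def nat_less_4)
qed

lemma linear_kappa6: "linear (kappa6 K)"
proof (rule linearI)
  have *: "comp6 (f + g) i j = comp6 f i j + comp6 g i j" "comp6 (c *\<^sub>R f) i j = c * comp6 f i j" for f g c i j
    by (cases f; cases g; simp)+
  show "kappa6 K (f + g) = kappa6 K f + kappa6 K g" "kappa6 K (c *\<^sub>R f) = c *\<^sub>R kappa6 K f" for f g c
    by (simp_all add: kappa6_def form6_def kappa_act_def * distrib_left sum.distrib sum_distrib_left
        mult.left_commute)
qed

lemma two_form_kappa_act: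
  assumes "antisym_components K"
  shows "two_form (kappa_act K F)"
  unfolding two_form_def
proof (intro allI impI)
  fix i j :: nat
  assume "i < 4" "j < 4"
  then have "K a b i j = - K a b j i" if "a \<in> idx4" "b \<in> idx4" for a b
    using assms that unfolding antisym_components_def idx4_def by blast
  then show "kappa_act K F i j = - kappa_act K F j i"
    by (simp add: kappa_act_def sum_negf)
qed

text \<open>Stated without antisymmetry because the Fresnel computation applies it to a
  \<open>w\<close> that is not antisymmetric.\<close>

lemma levi_sum:
  "(\<Sum>i\<in>idx4. \<Sum>j\<in>idx4. \<Sum>k\<in>idx4. \<Sum>l\<in>idx4. levi i j k l * u i j * w k l)
   = (u 0 1 - u 1 0) * (w 2 3 - w 3 2) + (u 0 2 - u 2 0) * (w 3 1 - w 1 3)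
   + (u 0 3 - u 3 0) * (w 1 2 - w 2 1) + (u 2 3 - u 3 2) * (w 0 1 - w 1 0)
   + (u 3 1 - u 1 3) * (w 0 2 - w 2 0) + (u 1 2 - u 2 1) * (w 0 3 - w 3 0)"
  by (simp add: sum_idx4 levi_def algebra_simps)

lemma wedge22_eq:
  assumes "two_form u" "two_form w"
  shows "wedge22 u w = wedge6 (form6 u) (form6 w)"
proof -
  have "u i j = - u j i" "w i j = - w j i" if "i < 4" "j < 4" for i j
    using assms that unfolding two_form_def by blast+
  from this[of 1 0] this[of 2 0] this[of 3 0] this[of 2 1] this[of 1 3] this[of 3 2]
  show ?thesis
    unfolding wedge22_def levi_sum form6_def by (simp add: algebra_simps)
qed

lemma form6_comp6: "form6 (comp6 f) = f"
  by (cases f) (simp add: form6_def)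

lemma kappa6_selfadjoint:
  assumes "antisym_components K" "skewon_free K"
  shows "wedge6 (kappa6 K f) g = wedge6 f (kappa6 K g)"
proof -
  have "wedge22 (comp6 f) (kappa_act K (comp6 g)) = wedge22 (kappa_act K (comp6 f)) (comp6 g)"
    using assms(2) two_form_comp6 unfolding skewon_free_def by blast
  then show ?thesis
    by (simp add: wedge22_eq two_form_comp6 two_form_kappa_act[OF assms(1)] form6_comp6 kappa6_def)
qed

lemma bilinear_wedge6: "bilinear wedge6"
  unfolding bilinear_def
proof (intro conjI allI linearI)
  show "wedge6 f (g + h) = wedge6 f g + wedge6 f h" "wedge6 (g + h) f = wedge6 g f + wedge6 h f" for f g h
    by (cases f; cases g; cases h; simp add: algebra_simps)+
  show "wedge6 f (c *\<^sub>R g) = c *\<^sub>R wedge6 f g" "wedge6 (c *\<^sub>R g) f = c *\<^sub>R wedge6 g f" for f g c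
    by (cases f; cases g; simp add: algebra_simps)+
qed

lemma wedge6_commute: "wedge6 f g = wedge6 g f"
  by (cases f; cases g) simp

section \<open>Null eigenvectors and the Fresnel surface\<close>

lemma pairing_scale [simp]: "pairing x (c *\<^sub>R v) = c * pairing x v"
  by (cases x; cases v) (simp add: algebra_simps)

text \<open>A nonzero minor of the two covectors gives the vector explicitly. The value -1 is chosen
  to cancel the minus sign of \<open>ext_lower\<close>.\<close>

lemma ex_separating:
  assumes "ext a b \<noteq> 0"
  shows "\<exists>v. pairing a v = 0 \<and> pairing b v = -1"
proof -
  obtain a0 a1 a2 a3 b0 b1 b2 b3 where ab: "a = (a0, a1, a2, a3)" "b = (b0, b1, b2, b3)"
    by (cases a; cases b) blast
  have *: "\<exists>v. pairing a v = 0 \<and> pairing b v = -1"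
    if "pairing a t = 0" "pairing b t = - d" "d \<noteq> 0" for t d
    using that by (intro exI[of _ "(1 / d) *\<^sub>R t"]) simp
  consider "a0 * b1 - a1 * b0 \<noteq> 0" | "a0 * b2 - a2 * b0 \<noteq> 0" | "a0 * b3 - a3 * b0 \<noteq> 0"
    | "a2 * b3 - a3 * b2 \<noteq> 0" | "a3 * b1 - a1 * b3 \<noteq> 0" | "a1 * b2 - a2 * b1 \<noteq> 0"
    using assms by (auto simp: ab zero_prod_def)
  then show ?thesis
  proof cases
    case 1
    then show ?thesis
      by (intro *[of "(a1, - a0, 0, 0)" "a0 * b1 - a1 * b0"]) (simp_all add: ab algebra_simps)
  next
    case 2
    then show ?thesis
      by (intro *[of "(a2, 0, - a0, 0)" "a0 * b2 - a2 * b0"]) (simp_all add: ab algebra_simps)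
  next
    case 3
    then show ?thesis
      by (intro *[of "(a3, 0, 0, - a0)" "a0 * b3 - a3 * b0"]) (simp_all add: ab algebra_simps)
  next
    case 4
    then show ?thesis
      by (intro *[of "(0, 0, a3, - a2)" "a2 * b3 - a3 * b2"]) (simp_all add: ab algebra_simps)
  next
    case 5
    then show ?thesis
      by (intro *[of "(0, - a3, 0, a1)" "a3 * b1 - a1 * b3"]) (simp_all add: ab algebra_simps)
  next
    case 6
    then show ?thesis
      by (intro *[of "(0, a2, - a1, 0)" "a1 * b2 - a2 * b1"]) (simp_all add: ab algebra_simps)
  qed
qed

lemma lower_ext: "lower (ext a w) v = pairing w v *\<^sub>R a - pairing a v *\<^sub>R w"
  by (cases a; cases w; cases v) (simp add: algebra_simps)

lemma ext_scale_left [simp]: "ext (c *\<^sub>R a) b = c *\<^sub>R ext a b"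
  by (cases a; cases b) (simp add: algebra_simps)

text \<open>Divisibility by \<open>a\<close> gives \<open>f = ext a w\<close>. Contracting with a
  \<open>v\<close> that kills \<open>a\<close> leaves a multiple of \<open>a\<close>, and
  divisibility by \<open>b\<close> recovers \<open>f\<close> from that contraction.\<close>

lemma multiple_of_ext:
  assumes "ext a b \<noteq> 0" "upper f a = 0" "upper f b = 0"
  obtains c where "f = c *\<^sub>R ext a b"
proof -
  obtain v where v: "pairing a v = 0" "pairing b v = -1"
    using ex_separating[OF assms(1)] by blast
  have "ext b a \<noteq> 0"
    using assms(1) ext_commute[of a b] by auto
  then obtain v' where "pairing a v' = -1"
    using ex_separating[of b a] by blast
  then have f: "f = ext a (lower f v')"
    using ext_lower[OF assms(2), of v'] by simp
  define w where "w = lower f v'"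
  have "lower f v = pairing w v *\<^sub>R a"
    using lower_ext[of a w v] f v(1) by (simp add: w_def)
  moreover have "f = ext b (lower f v)"
    using ext_lower[OF assms(3), of v] v(2) by simp
  ultimately have "f = (- pairing w v) *\<^sub>R ext a b"
    by (metis ext_commute ext_scale_left scaleR_minus_left scaleR_minus_right)
  then show ?thesis
    by (rule that)
qed


section \<open>The Fresnel polynomial as a contraction of three 2-forms\<close>

definition Kform :: "(nat \<Rightarrow> nat \<Rightarrow> nat \<Rightarrow> nat \<Rightarrow> real) \<Rightarrow> nat \<Rightarrow> nat \<Rightarrow> real6" where
  "Kform K a b = form6 (K a b)"

text \<open>\<open>Kform K a b\<close> is the image under \<open>\<kappa>\<close> of
  \<open>dx^a \<and> dx^b\<close>, and \<open>Pform K \<xi> a\<close> that of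
  \<open>dx^a \<and> \<xi>\<close>.\<close>

definition Pform :: "(nat \<Rightarrow> nat \<Rightarrow> nat \<Rightarrow> nat \<Rightarrow> real) \<Rightarrow> real4 \<Rightarrow> nat \<Rightarrow> real6" where
  "Pform K \<xi> a = (\<Sum>i\<in>idx4. comp4 \<xi> i *\<^sub>R Kform K a i)"

text \<open>Regrouping the fourteen summation indices isolates three inner sums, one for each factor
  \<open>K\<close>; only \<open>a1\<close> to \<open>a4\<close>, \<open>b5\<close> and
  \<open>b6\<close> link them.\<close>

lemma fresnel_sum_rearrange:
  "(\<Sum>i\<in>idx4. \<Sum>j\<in>idx4. \<Sum>k\<in>idx4. \<Sum>l\<in>idx4. fresnel_G0 K i j k l * x i * x j * x k * x l) =
   (\<Sum>b5\<in>idx4. \<Sum>a1\<in>idx4. \<Sum>a2\<in>idx4. \<Sum>a3\<in>idx4. \<Sum>a4\<in>idx4. \<Sum>b6\<in>idx4.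
      1 / 48 * levi a1 a2 a3 a4 *
      (\<Sum>(b1, b2, k)\<in>idx4 \<times> idx4 \<times> idx4. K a1 a2 b1 b2 * levi b1 b2 b5 k * x k) *
      (\<Sum>(i, b3, b4, l)\<in>idx4 \<times> idx4 \<times> idx4 \<times> idx4. K a3 i b3 b4 * x i * levi b3 b4 b6 l * x l) *
      (\<Sum>j\<in>idx4. K a4 j b5 b6 * x j))"
  (is "?L = ?R")
proof -
  have distrib: "c * sum f A * sum g B * sum h C = (\<Sum>x\<in>A. \<Sum>y\<in>B. \<Sum>z\<in>C. c * f x * g y * h z)"
    for c :: real and f :: "'a \<Rightarrow> real" and g :: "'b \<Rightarrow> real" and h :: "'c \<Rightarrow> real" and A B C
  proof -
    have "sum f A * (sum g B * sum h C) = (\<Sum>x\<in>A. \<Sum>y\<in>B. f x * (\<Sum>z\<in>C. g y * h z))"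
      unfolding sum_product[of g B h C] sum_product[of f A] ..
    then have "c * (sum f A * (sum g B * sum h C)) = c * (\<Sum>x\<in>A. \<Sum>y\<in>B. f x * (\<Sum>z\<in>C. g y * h z))"
      by (rule arg_cong)
    also have "\<dots> = (\<Sum>x\<in>A. \<Sum>y\<in>B. \<Sum>z\<in>C. c * (f x * (g y * h z)))"
      unfolding sum_distrib_left ..
    finally show ?thesis
      by (simp only: mult.assoc)
  qed
  let ?f = "\<lambda>(i, j, k, l, a1, a2, a3, a4, b1, b2, b3, b4, b5, b6).
    (b5, a1, a2, a3, a4, b6, (b1, b2, k), (i, b3, b4, l), j)"
  let ?g = "\<lambda>(b5, a1, a2, a3, a4, b6, (b1, b2, k), (i, b3, b4, l), j).
    (i, j, k, l, a1, a2, a3, a4, b1, b2, b3, b4, b5, b6)"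
  have "?L = (\<Sum>(i, j, k, l, a1, a2, a3, a4, b1, b2, b3, b4, b5, b6)\<in>
      idx4 \<times> idx4 \<times> idx4 \<times> idx4 \<times> idx4 \<times> idx4 \<times> idx4 \<times> idx4 \<times> idx4 \<times> idx4 \<times> idx4 \<times> idx4 \<times> idx4 \<times> idx4.
      1 / 48 * (K a1 a2 b1 b2 * K a3 i b3 b4 * K a4 j b5 b6 *
        levi b1 b2 b5 k * levi b3 b4 b6 l * levi a1 a2 a3 a4) * x i * x j * x k * x l)"
    unfolding fresnel_G0_def sum_distrib_left sum_distrib_right unfolding sum.cartesian_product ..
  also have "\<dots> = (\<Sum>(b5, a1, a2, a3, a4, b6, (b1, b2, k), (i, b3, b4, l), j)\<in>
      idx4 \<times> idx4 \<times> idx4 \<times> idx4 \<times> idx4 \<times> idx4 \<times> (idx4 \<times> idx4 \<times> idx4) \<times> (idx4 \<times> idx4 \<times> idx4 \<times> idx4) \<times> idx4.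
      1 / 48 * levi a1 a2 a3 a4 * (K a1 a2 b1 b2 * levi b1 b2 b5 k * x k) *
      (K a3 i b3 b4 * x i * levi b3 b4 b6 l * x l) * (K a4 j b5 b6 * x j))"
    by (rule sum.reindex_bij_witness[of _ ?g ?f]) auto
  also have "\<dots> = ?R"
    unfolding distrib sum.cartesian_product by (simp add: case_prod_unfold)
  finally show ?thesis .
qed

text \<open>The sum is the vector dual to the 3-form \<open>F \<and> \<xi>\<close>; the 2 appears
  because every index pair of \<open>F\<close> occurs in both orders.\<close>

lemma contract_levi:
  assumes "two_form F" "b < 4"
  shows "(\<Sum>(b1, b2, k)\<in>idx4 \<times> idx4 \<times> idx4. F b1 b2 * levi b1 b2 b k * comp4 \<xi> k)
    = 2 * comp4 (upper (form6 F) \<xi>) b"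
proof -
  obtain x0 x1 x2 x3 where \<xi>: "\<xi> = (x0, x1, x2, x3)"
    by (cases \<xi>) blast
  have "F i j = - F j i" if "i < 4" "j < 4" for i j
    using assms that unfolding two_form_def by blast
  from this[of 1 0] this[of 2 0] this[of 3 0] this[of 2 1] this[of 1 3] this[of 3 2] assms(2)
  show ?thesis
    unfolding sum.cartesian_product[symmetric] sum_idx4 nat_less_4
    by (elim disjE) (simp_all add: levi_def form6_def \<xi> algebra_simps)
qed

lemma comp4_add [simp]: "comp4 (v + w) i = comp4 v i + comp4 w i"
  and comp4_scale [simp]: "comp4 (c *\<^sub>R v) i = c * comp4 v i"
  and comp4_0 [simp]: "comp4 0 i = 0"
  by (cases v; cases w; simp add: zero_prod_def)+

lemma lower_linear_left: "lower (f + g) v = lower f v + lower g v" "lower (c *\<^sub>R f) v = c *\<^sub>R lower f v"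
  by (cases f; cases g; cases v; simp add: algebra_simps)+

lemma upper_add_left: "upper (f + g) v = upper f v + upper g v"
  by (cases f; cases g; cases v; simp add: algebra_simps)

lemma upper_minus_left: "upper (- f) v = - upper f v"
  by (cases f; cases v; simp)

lemma comp4_minus: "comp4 (- v) i = - comp4 v i"
  by (cases v; simp)

lemma lower_add: "lower f (v + w) = lower f v + lower f w"
  and lower_scale: "lower f (c *\<^sub>R v) = c *\<^sub>R lower f v"
  by (cases f; cases v; cases w; simp add: algebra_simps)+

lemma contract_comp6: "a < 4 \<Longrightarrow> (\<Sum>b\<in>idx4. comp6 f a b * comp4 v b) = comp4 (lower f v) a"
  unfolding nat_less_4 by (cases f; cases v; elim disjE) (simp_all add: sum_idx4)

context
  fixes K :: "nat \<Rightarrow> nat \<Rightarrow> nat \<Rightarrow> nat \<Rightarrow> real"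
  assumes antisym: "antisym_components K"
begin

lemma K_antisym: "i < 4 \<Longrightarrow> j < 4 \<Longrightarrow> r < 4 \<Longrightarrow> s < 4 \<Longrightarrow> K i j r s = - K j i r s"
  "i < 4 \<Longrightarrow> j < 4 \<Longrightarrow> r < 4 \<Longrightarrow> s < 4 \<Longrightarrow> K i j r s = - K i j s r"
  using antisym unfolding antisym_components_def by blast+

lemma Kform_antisym: "a < 4 \<Longrightarrow> b < 4 \<Longrightarrow> Kform K a b = - Kform K b a"
  unfolding Kform_def form6_def
  by (simp add: K_antisym(1)[of a b 0 1] K_antisym(1)[of a b 0 2] K_antisym(1)[of a b 0 3]
      K_antisym(1)[of a b 2 3] K_antisym(1)[of a b 3 1] K_antisym(1)[of a b 1 2] del: One_nat_def)

lemma Kform_simps: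
  "Kform K 0 0 = 0" "Kform K 1 1 = 0" "Kform K 2 2 = 0" "Kform K 3 3 = 0"
  "Kform K 1 0 = - Kform K 0 1" "Kform K 2 0 = - Kform K 0 2" "Kform K 3 0 = - Kform K 0 3"
  "Kform K 3 2 = - Kform K 2 3" "Kform K 1 3 = - Kform K 3 1" "Kform K 2 1 = - Kform K 1 2"
  using Kform_antisym[of 0 0] Kform_antisym[of 1 1] Kform_antisym[of 2 2] Kform_antisym[of 3 3]
    Kform_antisym[of 1 0] Kform_antisym[of 2 0] Kform_antisym[of 3 0]
    Kform_antisym[of 3 2] Kform_antisym[of 1 3] Kform_antisym[of 2 1]
  by (simp_all add: eq_neg_iff_add_eq_0 flip: scaleR_2)

lemma kappa6_eq:
  "kappa6 K (f1, f2, f3, f4, f5, f6) = f1 *\<^sub>R Kform K 0 1 + f2 *\<^sub>R Kform K 0 2 + f3 *\<^sub>R Kform K 0 3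
     + f4 *\<^sub>R Kform K 2 3 + f5 *\<^sub>R Kform K 3 1 + f6 *\<^sub>R Kform K 1 2"
proof -
  have "kappa_act K (comp6 (f1, f2, f3, f4, f5, f6)) r s
      = f1 * K 0 1 r s + f2 * K 0 2 r s + f3 * K 0 3 r s + f4 * K 2 3 r s + f5 * K 3 1 r s + f6 * K 1 2 r s"
    if "r < 4" "s < 4" for r s
    using that K_antisym(1)[of 1 0 r s] K_antisym(1)[of 2 0 r s] K_antisym(1)[of 3 0 r s]
      K_antisym(1)[of 3 2 r s] K_antisym(1)[of 1 3 r s] K_antisym(1)[of 2 1 r s]
    by (simp add: kappa_act_def sum_idx4 algebra_simps)
  then show ?thesis
    by (simp add: kappa6_def form6_def Kform_def)
qed

lemma kappa6_ext:
  "kappa6 K (ext z \<xi>) = (\<Sum>a\<in>idx4. comp4 z a *\<^sub>R Pform K \<xi> a)"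
  by (cases z; cases \<xi>) (simp add: kappa6_eq Pform_def sum_idx4 Kform_simps algebra_simps
      del: One_nat_def)

lemma two_form_K: "a < 4 \<Longrightarrow> b < 4 \<Longrightarrow> two_form (K a b)"
  unfolding two_form_def using K_antisym(2) by blast

lemma two_form_K_contracted: "a < 4 \<Longrightarrow> two_form (\<lambda>r s. \<Sum>i\<in>idx4. K a i r s * comp4 \<xi> i)"
  unfolding two_form_def
proof (intro allI impI)
  fix r s :: nat
  assume "a < 4" "r < 4" "s < 4"
  then have "K a i r s = - K a i s r" if "i \<in> idx4" for i
    using K_antisym(2) that unfolding idx4_def by blast
  then show "(\<Sum>i\<in>idx4. K a i r s * comp4 \<xi> i) = - (\<Sum>i\<in>idx4. K a i s r * comp4 \<xi> i)"
    by (simp add: sum_negf)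
qed

lemma form6_K_contracted: "form6 (\<lambda>r s. \<Sum>i\<in>idx4. K a i r s * comp4 \<xi> i) = Pform K \<xi> a"
  by (simp add: form6_def Pform_def Kform_def sum_idx4 algebra_simps)

text \<open>Two of the three inner sums are contractions with a Levi-Civita symbol and contribute a
  factor 2 each, which turns 1/48 into 1/12; the third applies a 2-form to the vector made from the
  second.\<close>

lemma fresnel_sum_eq:
  "(\<Sum>i\<in>idx4. \<Sum>j\<in>idx4. \<Sum>k\<in>idx4. \<Sum>l\<in>idx4.
      fresnel_G0 K i j k l * comp4 \<xi> i * comp4 \<xi> j * comp4 \<xi> k * comp4 \<xi> l) =
   (\<Sum>b\<in>idx4. 1 / 12 * (\<Sum>a1\<in>idx4. \<Sum>a2\<in>idx4. \<Sum>a3\<in>idx4. \<Sum>a4\<in>idx4.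
      levi a1 a2 a3 a4 * comp4 (upper (Kform K a1 a2) \<xi>) b *
      comp4 (lower (Pform K \<xi> a4) (upper (Pform K \<xi> a3) \<xi>)) b))"
proof -
  have X: "(\<Sum>(b1, b2, k)\<in>idx4 \<times> idx4 \<times> idx4. K a1 a2 b1 b2 * levi b1 b2 b k * comp4 \<xi> k)
      = 2 * comp4 (upper (Kform K a1 a2) \<xi>) b" if "a1 \<in> idx4" "a2 \<in> idx4" "b \<in> idx4" for a1 a2 b
    using contract_levi[OF two_form_K] that by (simp add: idx4_def Kform_def)
  have Y: "(\<Sum>(i, b3, b4, l)\<in>idx4 \<times> idx4 \<times> idx4 \<times> idx4. K a i b3 b4 * comp4 \<xi> i * levi b3 b4 b l * comp4 \<xi> l)
      = 2 * comp4 (upper (Pform K \<xi> a) \<xi>) b" if "a \<in> idx4" "b \<in> idx4" for a b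
  proof -
    have "(\<Sum>(i, b3, b4, l)\<in>idx4 \<times> idx4 \<times> idx4 \<times> idx4. K a i b3 b4 * comp4 \<xi> i * levi b3 b4 b l * comp4 \<xi> l)
      = (\<Sum>i\<in>idx4. \<Sum>t\<in>idx4 \<times> idx4 \<times> idx4. case t of (b3, b4, l) \<Rightarrow> K a i b3 b4 * comp4 \<xi> i * levi b3 b4 b l * comp4 \<xi> l)"
      by (simp add: sum.cartesian_product case_prod_unfold)
    also have "\<dots> = (\<Sum>t\<in>idx4 \<times> idx4 \<times> idx4. \<Sum>i\<in>idx4. case t of (b3, b4, l) \<Rightarrow> K a i b3 b4 * comp4 \<xi> i * levi b3 b4 b l * comp4 \<xi> l)"
      by (rule sum.swap)
    also have "\<dots> = (\<Sum>(b3, b4, l)\<in>idx4 \<times> idx4 \<times> idx4. (\<Sum>i\<in>idx4. K a i b3 b4 * comp4 \<xi> i) * levi b3 b4 b l * comp4 \<xi> l)"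
      by (simp add: case_prod_unfold sum_distrib_right)
    also have "\<dots> = 2 * comp4 (upper (Pform K \<xi> a) \<xi>) b"
      using contract_levi[OF two_form_K_contracted, of a b \<xi> \<xi>] that
      by (simp add: idx4_def form6_K_contracted[unfolded idx4_def])
    finally show ?thesis .
  qed
  have Z: "(\<Sum>j\<in>idx4. K a j b b6 * comp4 \<xi> j) = comp6 (Pform K \<xi> a) b b6"
    if "a \<in> idx4" "b \<in> idx4" "b6 \<in> idx4" for a b b6
    using comp6_form6[OF two_form_K_contracted, of a b b6 \<xi>] that
    by (simp add: form6_K_contracted) (simp add: idx4_def)
  have YZ: "(\<Sum>b6\<in>idx4. c * (2 * u) * (2 * comp4 v b6) * comp6 f b b6) = 4 * (c * u * comp4 (lower f v) b)"
    if "b \<in> idx4" for c u v f b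
    using contract_comp6[of b f v] that unfolding idx4_def
    by (simp add: sum_distrib_left algebra_simps flip: contract_comp6[unfolded idx4_def])
  show ?thesis
    unfolding fresnel_sum_rearrange
    unfolding sum_distrib_left[of "1 / 12"]
  proof (intro sum.cong refl)
    fix b a1 a2 a3 a4
    assume *: "b \<in> idx4" "a1 \<in> idx4" "a2 \<in> idx4" "a3 \<in> idx4" "a4 \<in> idx4"
    have "(\<Sum>b6\<in>idx4. 1 / 48 * levi a1 a2 a3 a4 *
        (\<Sum>(b1, b2, k)\<in>idx4 \<times> idx4 \<times> idx4. K a1 a2 b1 b2 * levi b1 b2 b k * comp4 \<xi> k) *
        (\<Sum>(i, b3, b4, l)\<in>idx4 \<times> idx4 \<times> idx4 \<times> idx4. K a3 i b3 b4 * comp4 \<xi> i * levi b3 b4 b6 l * comp4 \<xi> l) *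
        (\<Sum>j\<in>idx4. K a4 j b b6 * comp4 \<xi> j))
      = (\<Sum>b6\<in>idx4. 1 / 48 * levi a1 a2 a3 a4 * (2 * comp4 (upper (Kform K a1 a2) \<xi>) b) *
        (2 * comp4 (upper (Pform K \<xi> a3) \<xi>) b6) * comp6 (Pform K \<xi> a4) b b6)"
      by (intro sum.cong refl) (simp only: X Y Z *)
    then show "(\<Sum>b6\<in>idx4. 1 / 48 * levi a1 a2 a3 a4 *
        (\<Sum>(b1, b2, k)\<in>idx4 \<times> idx4 \<times> idx4. K a1 a2 b1 b2 * levi b1 b2 b k * comp4 \<xi> k) *
        (\<Sum>(i, b3, b4, l)\<in>idx4 \<times> idx4 \<times> idx4 \<times> idx4. K a3 i b3 b4 * comp4 \<xi> i * levi b3 b4 b6 l * comp4 \<xi> l) *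
        (\<Sum>j\<in>idx4. K a4 j b b6 * comp4 \<xi> j))
      = 1 / 12 * (levi a1 a2 a3 a4 * comp4 (upper (Kform K a1 a2) \<xi>) b *
        comp4 (lower (Pform K \<xi> a4) (upper (Pform K \<xi> a3) \<xi>)) b)"
      using *(1) by (simp only: YZ)
  qed
qed

text \<open>With a null eigenvector \<open>\<xi> \<and> \<eta>\<close> of \<open>\<kappa>\<close>, the contraction of the last two of the three
  factors of the Fresnel tensor is a multiple of \<open>\<xi> \<and> \<eta>\<close>, which the first factor then maps to a
  multiple of \<open>\<xi> \<and> \<eta>\<close>; this is annihilated by the remaining \<open>\<xi>\<close>.\<close>

lemma in_fresnel_of_null_eigenvector:
  assumes skewon: "skewon_free K" and eig: "kappa6 K (ext \<xi> \<eta>) = c *\<^sub>R ext \<xi> \<eta>" and nz: "ext \<xi> \<eta> \<noteq> 0"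
  shows "in_fresnel K (comp4 \<xi>)"
proof -
  have "(\<Sum>a1\<in>idx4. \<Sum>a2\<in>idx4. \<Sum>a3\<in>idx4. \<Sum>a4\<in>idx4.
      levi a1 a2 a3 a4 * comp4 (upper (Kform K a1 a2) \<xi>) b *
      comp4 (lower (Pform K \<xi> a4) (upper (Pform K \<xi> a3) \<xi>)) b) = 0" for b
  proof -
    define w where "w i j = comp4 (lower (Pform K \<xi> j) (upper (Pform K \<xi> i) \<xi>)) b" for i j
    \<comment> \<open>The antisymmetrisation of \<open>w\<close> with each index pair replaced by
      its complement, as the Levi-Civita symbol does. Thus \<open>upper D z\<close> has the
      components \<open>\<Sum>j. (w i j - w j i) * z j\<close>.\<close>
    define D where "D = (w 2 3 - w 3 2, w 3 1 - w 1 3, w 1 2 - w 2 1, w 0 1 - w 1 0, w 0 2 - w 2 0, w 0 3 - w 3 0)"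
    have right: "(\<Sum>j\<in>idx4. comp4 z j * w i j) = comp4 (lower (kappa6 K (ext z \<xi>)) (upper (Pform K \<xi> i) \<xi>)) b" for z i
      by (simp add: kappa6_ext sum_idx4 lower_linear_left w_def)
    have left: "(\<Sum>j\<in>idx4. comp4 z j * w j i) = comp4 (lower (Pform K \<xi> i) (upper (kappa6 K (ext z \<xi>)) \<xi>)) b" for z i
      by (simp add: kappa6_ext sum_idx4 upper_add_left upper_scale_left lower_add lower_scale w_def)
    have upper_D: "upper D z = 0"
      if "\<And>i. i < 4 \<Longrightarrow> (\<Sum>j\<in>idx4. comp4 z j * w i j) = 0" "\<And>i. i < 4 \<Longrightarrow> (\<Sum>j\<in>idx4. comp4 z j * w j i) = 0" for z
      using that(1)[of 0] that(1)[of 1] that(1)[of 2] that(1)[of 3]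
        that(2)[of 0] that(2)[of 1] that(2)[of 2] that(2)[of 3]
      by (cases z) (simp add: D_def sum_idx4 zero_prod_def algebra_simps)
    have "ext \<xi> \<xi> = 0"
      by (cases \<xi>) (simp add: zero_prod_def)
    moreover have zero: "kappa6 K 0 = 0" "lower 0 v = 0" "upper 0 v = 0" for v
      using linear_0[OF linear_kappa6] by (cases v; simp add: zero_prod_def)+
    ultimately have D1: "upper D \<xi> = 0"
      by (intro upper_D) (simp_all only: left right lower_0 upper_0 comp4_0)
    have eig': "kappa6 K (ext \<eta> \<xi>) = - c *\<^sub>R ext \<xi> \<eta>"
      using eig linear_neg[OF linear_kappa6, of K "ext \<xi> \<eta>"] by (simp add: ext_commute[of \<eta>])
    have pair: "pairing \<eta> (upper f \<xi>) = wedge6 f (ext \<xi> \<eta>) \<or> pairing \<eta> (upper f \<xi>) = - wedge6 f (ext \<xi> \<eta>)"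
      "pairing \<xi> (upper f \<xi>) = 0" for f
      by (cases f; cases \<xi>; cases \<eta>; simp add: algebra_simps)+
    \<comment> \<open>Self-adjointness moves \<open>\<kappa>\<close> onto the eigenvector
      \<open>\<xi> \<and> \<eta>\<close>, and the result has \<open>\<xi>\<close> twice as a factor.
      Only this vanishing is needed, so the sign left open in \<open>pair\<close> is
      immaterial.\<close>
    have "wedge6 (Pform K \<xi> i) (ext \<xi> \<eta>) = 0" if "i < 4" for i
    proof -
      define e :: real4 where "e = (if i = 0 then 1 else 0, if i = 1 then 1 else 0, if i = 2 then 1 else 0, if i = 3 then 1 else 0)"
      have "Pform K \<xi> i = kappa6 K (ext e \<xi>)"
        using that unfolding kappa6_ext sum_idx4 nat_less_4 by (elim disjE) (simp_all add: e_def)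
      then have "wedge6 (Pform K \<xi> i) (ext \<xi> \<eta>) = wedge6 (ext e \<xi>) (c *\<^sub>R ext \<xi> \<eta>)"
        using kappa6_selfadjoint[OF antisym skewon] eig by simp
      also have "\<dots> = 0"
        by (cases e; cases \<xi>; cases \<eta>) (simp add: algebra_simps)
      finally show ?thesis .
    qed
    then have "lower (ext \<xi> \<eta>) (upper (Pform K \<xi> i) \<xi>) = 0" if "i < 4" for i
      using pair(1)[of "Pform K \<xi> i"] pair(2)[of "Pform K \<xi> i"] that by (auto simp: lower_ext)
    then have D2: "upper D \<eta> = 0"
      by (intro upper_D) (simp_all add: left right eig' lower_linear_left upper_scale_left
          del: scaleR_minus_left)
    from nz D1 D2 obtain t where t: "D = t *\<^sub>R ext \<xi> \<eta>"
      by (rule multiple_of_ext)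
    have "upper (kappa6 K D) \<xi> = 0"
      by (simp add: t linear_cmul[OF linear_kappa6] eig upper_scale_left)
    moreover define u where "u i j = comp4 (upper (Kform K i j) \<xi>) b" for i j
    have "comp4 (upper (kappa6 K D) \<xi>) b = u 0 1 * (w 2 3 - w 3 2) + u 0 2 * (w 3 1 - w 1 3)
        + u 0 3 * (w 1 2 - w 2 1) + u 2 3 * (w 0 1 - w 1 0) + u 3 1 * (w 0 2 - w 2 0) + u 1 2 * (w 0 3 - w 3 0)"
      by (simp add: D_def kappa6_eq upper_add_left upper_scale_left u_def mult.commute)
    ultimately have "u 0 1 * (w 2 3 - w 3 2) + u 0 2 * (w 3 1 - w 1 3) + u 0 3 * (w 1 2 - w 2 1)
        + u 2 3 * (w 0 1 - w 1 0) + u 3 1 * (w 0 2 - w 2 0) + u 1 2 * (w 0 3 - w 3 0) = 0"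
      by simp
    then have "2 * (u 0 1 * (w 2 3 - w 3 2) + u 0 2 * (w 3 1 - w 1 3) + u 0 3 * (w 1 2 - w 2 1)
        + u 2 3 * (w 0 1 - w 1 0) + u 3 1 * (w 0 2 - w 2 0) + u 1 2 * (w 0 3 - w 3 0)) = 0"
      by simp
    moreover have u: "u 1 0 = - u 0 1" "u 2 0 = - u 0 2" "u 3 0 = - u 0 3" "u 3 2 = - u 2 3"
      "u 1 3 = - u 3 1" "u 2 1 = - u 1 2"
      by (simp_all add: u_def Kform_simps upper_minus_left comp4_minus del: One_nat_def)
    have "(u 0 1 - u 1 0) * (w 2 3 - w 3 2) + (u 0 2 - u 2 0) * (w 3 1 - w 1 3)
        + (u 0 3 - u 3 0) * (w 1 2 - w 2 1) + (u 2 3 - u 3 2) * (w 0 1 - w 1 0)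
        + (u 3 1 - u 1 3) * (w 0 2 - w 2 0) + (u 1 2 - u 2 1) * (w 0 3 - w 3 0)
      = 2 * (u 0 1 * (w 2 3 - w 3 2) + u 0 2 * (w 3 1 - w 1 3) + u 0 3 * (w 1 2 - w 2 1)
        + u 2 3 * (w 0 1 - w 1 0) + u 3 1 * (w 0 2 - w 2 0) + u 1 2 * (w 0 3 - w 3 0))"
      unfolding u by (simp add: algebra_simps del: One_nat_def)
    ultimately show ?thesis
      unfolding levi_sum w_def[symmetric] u_def[symmetric] by simp
  qed
  then show ?thesis
    by (simp add: in_fresnel_def fresnel_sum_eq)
qed

end


text \<open>A nonzero covector \<open>lower f v\<close> divides \<open>f\<close> because null forms
  square to zero. Its Euclidean norm is positive, so a multiple of the covector itself provides the
  vector to contract with.\<close>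

lemma decomposable_of_null:
  assumes "wedge6 f f = 0" "f \<noteq> 0"
  obtains \<xi> \<eta> where "f = ext \<xi> \<eta>"
proof -
  obtain v where v: "lower f v \<noteq> 0"
    using lower_eq_0[of f] assms(2) by blast
  define a where "a = lower f v"
  have "upper f a = 0"
    using null_square(2)[OF assms(1)] by (simp add: a_def)
  moreover have "pairing a a \<noteq> 0"
    using v unfolding a_def[symmetric]
    by (cases a) (auto simp: zero_prod_def add_nonneg_eq_0_iff)
  then have "pairing a ((- 1 / pairing a a) *\<^sub>R a) = -1"
    by simp
  ultimately have "f = ext a (lower f ((- 1 / pairing a a) *\<^sub>R a))"
    using ext_lower[of f a "(- 1 / pairing a a) *\<^sub>R a"] by simp
  then show ?thesis
    by (rule that)
qed

lemma in_fresnel_comp4: "in_fresnel K (\<lambda>i. a * comp4 \<xi> i + b * comp4 \<eta> i)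
    \<longleftrightarrow> in_fresnel K (comp4 (a *\<^sub>R \<xi> + b *\<^sub>R \<eta>))"
  by (simp add: in_fresnel_def)

lemma ext_add_left: "ext (x + y) z = ext x z + ext y z"
  by (cases x; cases y; cases z) (simp add: algebra_simps)

lemma ext_self [simp]: "ext x x = 0"
  by (cases x) (simp add: zero_prod_def)

text \<open>Every nonzero covector in the span of \<open>\<xi>\<close> and \<open>\<eta>\<close>
  divides \<open>\<xi> \<and> \<eta>\<close> and can take the place of \<open>\<xi>\<close> in the
  null eigenvector.\<close>

lemma fresnel_contains_plane_of_null_eigenvector:
  assumes antisym: "antisym_components K" and skewon: "skewon_free K"
    and f: "kappa6 K f = c *\<^sub>R f" "wedge6 f f = 0" "f \<noteq> 0"
  shows "fresnel_contains_plane K"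
proof -
  obtain \<xi> \<eta> where fe: "f = ext \<xi> \<eta>"
    using decomposable_of_null[OF f(2,3)] .
  have "in_fresnel K (comp4 (a *\<^sub>R \<xi> + b *\<^sub>R \<eta>))" for a b
  proof -
    let ?z = "a *\<^sub>R \<xi> + b *\<^sub>R \<eta>"
    have *: "in_fresnel K (comp4 ?z)" if "ext ?z w = t *\<^sub>R ext \<xi> \<eta>" "t \<noteq> 0" for w t
    proof (rule in_fresnel_of_null_eigenvector[OF antisym skewon])
      show "kappa6 K (ext ?z w) = c *\<^sub>R ext ?z w"
        using f(1) by (simp add: that(1) linear_cmul[OF linear_kappa6] fe)
      show "ext ?z w \<noteq> 0"
        using that f(3) by (simp add: fe)
    qed
    consider "a \<noteq> 0" | "b \<noteq> 0" | "a = 0" "b = 0"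
      by blast
    then show ?thesis
    proof cases
      case 1
      then show ?thesis
        by (intro *[of \<eta> a]) (simp_all add: ext_add_left)
    next
      case 2
      then show ?thesis
        by (intro *[of \<xi> "- b"]) (simp_all add: ext_add_left ext_commute[of \<eta> \<xi>])
    next
      case 3
      then show ?thesis
        by (simp add: in_fresnel_def)
    qed
  qed
  moreover have "lin_indep2 (comp4 \<xi>) (comp4 \<eta>)"
    unfolding lin_indep2_def
  proof (intro allI impI)
    fix a b
    assume *: "\<forall>i<4. a * comp4 \<xi> i + b * comp4 \<eta> i = 0"
    have "x = 0" if "\<And>i. i < 4 \<Longrightarrow> comp4 x i = 0" for x
      using that[of 0] that[of 1] that[of 2] that[of 3] by (cases x) (simp add: zero_prod_def)
    then have z: "a *\<^sub>R \<xi> + b *\<^sub>R \<eta> = 0"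
      using * by simp
    have "a *\<^sub>R ext \<xi> \<eta> = ext (a *\<^sub>R \<xi> + b *\<^sub>R \<eta>) \<eta>" "- b *\<^sub>R ext \<xi> \<eta> = ext (a *\<^sub>R \<xi> + b *\<^sub>R \<eta>) \<xi>"
      by (simp_all add: ext_add_left ext_commute[of \<eta> \<xi>])
    then show "a = 0 \<and> b = 0"
      using f(3) by (simp add: z fe)
  qed
  ultimately show ?thesis
    unfolding fresnel_contains_plane_def in_fresnel_comp4[symmetric] by blast
qed

section \<open>The wedge product has signature (3, 3)\<close>

lemma wedge6_inner_star: "wedge6 f g = inner f (star g)"
  by (cases f; cases g) (simp add: inner_Pair)

lemma selfadjoint_pair_wedge6:
  assumes "antisym_components K" "skewon_free K"
  shows "selfadjoint_pair wedge6 (kappa6 K)"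
  unfolding selfadjoint_pair_def
  using bilinear_wedge6 wedge6_commute linear_kappa6 kappa6_selfadjoint[OF assms] by blast

text \<open>The three linear conditions cut out the forms with \<open>star y = - s y\<close>, a
  three-dimensional space on which the wedge product has sign opposite to \<open>s\<close>.\<close>

lemma wedge6_sign:
  fixes y :: real6
  assumes "s = 1 \<or> s = -1" "(\<lambda>(f1, f2, f3, f4, f5, f6). (f1 + s * f4, f2 + s * f5, f3 + s * f6)) y = 0"
  shows "s * wedge6 y y \<le> 0"
proof -
  obtain f1 f2 f3 f4 f5 f6 where y: "y = (f1, f2, f3, f4, f5, f6)"
    by (cases y) blast
  have "f1 = - s * f4" "f2 = - s * f5" "f3 = - s * f6"
    using assms(2) by (auto simp: y zero_prod_def)
  then have "s * wedge6 y y = - 2 * (s * s) * (f4 * f4 + f5 * f5 + f6 * f6)"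
    by (simp add: y algebra_simps)
  moreover have "s * s = 1"
    using assms(1) by auto
  ultimately have "s * wedge6 y y = - 2 * (f4 * f4 + f5 * f5 + f6 * f6)"
    by simp
  moreover have "- 2 * (f4 * f4 + f5 * f5 + f6 * f6) \<le> 0"
    by (rule mult_nonpos_nonneg) simp_all
  ultimately show ?thesis
    by (rule ord_eq_le_trans)
qed

context
  fixes k
  assumes sp: "selfadjoint_pair wedge6 k"
begin

interpretation selfadjoint_pair wedge6 k
  by (fact sp)

text \<open>Four such vectors would have a nontrivial combination on which the three functionals of
  \<open>wedge6_sign\<close> vanish, although \<open>s\<close> times its square is a positive sum of
  squares.\<close>

lemma orth_list_wedge6_length:
  assumes s: "s = 1 \<or> s = -1" and xs: "orth_list s xs"
  shows "length xs \<le> 3"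
proof (rule ccontr)
  assume "\<not> ?thesis"
  then have len: "i < length xs" if "i \<le> 3" for i
    using that by simp
  define \<pi> :: "real6 \<Rightarrow> real \<times> real \<times> real"
    where "\<pi> = (\<lambda>(f1, f2, f3, f4, f5, f6). (f1 + s * f4, f2 + s * f5, f3 + s * f6))"
  have lin: "linear \<pi>"
    by (rule linearI) (auto simp: \<pi>_def algebra_simps)
  have dim: "DIM(real \<times> real \<times> real) = 3"
    by simp
  obtain c where c: "\<exists>i\<le>3. c i \<noteq> 0" "(\<Sum>i\<le>3. c i *\<^sub>R \<pi> (xs ! i)) = 0"
    using linear_combination_eq_0[of "\<lambda>i. \<pi> (xs ! i)", unfolded dim] by blast
  define y where "y = (\<Sum>i\<le>3. c i *\<^sub>R xs ! i)"
  have "\<pi> y = 0"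
    using c(2) by (simp add: y_def linear_sum[OF lin] linear_cmul[OF lin])
  then have "s * wedge6 y y \<le> 0"
    using wedge6_sign[OF s] by (simp add: \<pi>_def)
  have xx: "wedge6 (xs ! i) (xs ! j) = (if i = j then s else 0)" if "i \<le> 3" "j \<le> 3" for i j
  proof (cases i j rule: linorder_cases)
    case less
    then show ?thesis
      using xs len[OF that(1)] len[OF that(2)] by (auto simp: orth_list_def sorted_wrt_iff_nth_less)
  next
    case equal
    then show ?thesis
      using xs len[OF that(1)] by (auto simp: orth_list_def)
  next
    case greater
    then show ?thesis
      using xs len[OF that(1)] len[OF that(2)] sym[of "xs ! i" "xs ! j"]
      by (auto simp: orth_list_def sorted_wrt_iff_nth_less)
  qed
  have "wedge6 y (xs ! j) = c j * s" if "j \<le> 3" for j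
  proof -
    have "wedge6 y (xs ! j) = (\<Sum>i\<le>3. c i * wedge6 (xs ! i) (xs ! j))"
      by (simp add: y_def sum_B B_simps)
    also have "\<dots> = (\<Sum>i\<le>3. if i = j then c j * s else 0)"
      using that by (intro sum.cong) (auto simp: xx)
    finally show ?thesis
      using that by simp
  qed
  then have E: "wedge6 (xs ! j) y = c j * s" if "j \<le> 3" for j
    using that sym[of "xs ! j" y] by simp
  have "wedge6 (\<Sum>i\<le>3. c i *\<^sub>R xs ! i) y = (\<Sum>j\<le>3. wedge6 (c j *\<^sub>R xs ! j) y)"
    by (rule sum_B)
  also have "\<dots> = (\<Sum>j\<le>3. c j * (c j * s))"
    by (intro sum.cong refl) (simp add: B_simps E)
  also have "\<dots> = s * (\<Sum>j\<le>3. (c j)\<^sup>2)"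
    by (simp add: sum_distrib_left power2_eq_square mult.commute mult.left_commute)
  finally have "s * wedge6 y y = (\<Sum>j\<le>3. (c j)\<^sup>2)"
    using s unfolding y_def[symmetric] by auto
  moreover have "(\<Sum>j\<le>3. (c j)\<^sup>2) > 0"
    using c(1) by (auto intro!: sum_pos2)
  ultimately show False
    using \<open>s * wedge6 y y \<le> 0\<close> by simp
qed

lemma has_signature_wedge6: "has_signature 3 3 UNIV"
  unfolding has_signature_def
proof (intro conjI allI impI)
  show "invariant_subspace UNIV"
    by (simp add: invariant_subspace_def)
  show "nondegenerate_on UNIV"
    unfolding nondegenerate_on_def
  proof (intro ballI impI)
    fix x assume *: "\<forall>y\<in>UNIV. wedge6 x y = 0"
    have "star (star x) = x"
      by (cases x) simp
    then have "inner x x = 0"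
      using *[rule_format, OF UNIV_I, of "star x"] wedge6_inner_star[of x "star x"] by simp
    then show "x = 0"
      by simp
  qed
  show "length xs \<le> 3" if "orth_list 1 xs" for xs
    using orth_list_wedge6_length[OF _ that] by simp
  show "length xs \<le> 3" if "orth_list (- 1) xs" for xs
    using orth_list_wedge6_length[OF _ that] by simp
  fix ls :: "real6 list"
  assume ls: "length ls < 3 + 3"
  \<comment> \<open>Fewer than six vectors \<open>star l\<close> do not span the space, and
    Euclidean orthogonality to \<open>star l\<close> is orthogonality to \<open>l\<close> for the
    wedge product.\<close>
  have "dim (star ` set ls) \<le> card (star ` set ls)"
    by (rule dim_le_card') simp
  also have "\<dots> \<le> card (set ls)"
    by (rule card_image_le) simp
  also have "\<dots> \<le> length ls"
    by (rule card_length)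
  also have "\<dots> < DIM(real6)"
    using ls by simp
  finally have dim: "dim (star ` set ls) < DIM(real6)" .
  have "\<exists>x. x \<noteq> 0 \<and> (\<forall>y\<in>span (star ` set ls). orthogonal x y)"
    by (rule orthogonal_to_subspace_exists[OF dim]) blast
  then obtain x where x: "x \<noteq> 0" "\<forall>y\<in>span (star ` set ls). orthogonal x y"
    by blast
  have "wedge6 x l = 0" if "l \<in> set ls" for l
    using x(2)[rule_format, OF span_base, of "star l"] that
    by (simp add: wedge6_inner_star orthogonal_def)
  with x(1) show "\<exists>x\<in>UNIV. x \<noteq> 0 \<and> (\<forall>l\<in>set ls. wedge6 x l = 0)"
    by blast
qed

lemma ex_normal_frame_wedge6:
  assumes "\<forall>x a. k x = a *\<^sub>R x \<longrightarrow> wedge6 x x = 0 \<longrightarrow> x = 0"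
  shows "\<exists>f1 f2 f3 f4 f5 f6. hyperbolic_basis wedge6 f1 f2 f3 f4 f5 f6 \<and> normal_frame k f1 f2 f3 f4 f5 f6"
  by (rule ex_normal_frame[OF has_signature_wedge6 assms])

end

section \<open>The matrix in the adapted coordinates\<close>

lemma det_mat_Suc:
  fixes f :: "nat \<times> nat \<Rightarrow> real"
  shows "det (mat (Suc n) (Suc n) f)
    = (\<Sum>j<Suc n. f (0, j) * ((-1) ^ j * det (mat n n (\<lambda>(a, b). f (Suc a, if b < j then b else Suc b)))))"
proof -
  have "mat_delete (mat (Suc n) (Suc n) f) 0 j = mat n n (\<lambda>(a, b). f (Suc a, if b < j then b else Suc b))" for j
    by (intro eq_matI) (auto simp: mat_delete_def)
  then show ?thesis
    by (subst laplace_expansion_row[of _ "Suc n" 0]) (simp_all add: cofactor_def)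
qed

text \<open>The coefficient of the 4-form
  \<open>\<theta>0 \<and> \<theta>1 \<and> \<theta>2 \<and> \<theta>3\<close>, written so that it
  becomes \<open>D * D\<close> for an induced basis.\<close>

lemma det_frame:
  "det (mat 4 4 (\<lambda>(i, a). comp4 ([\<theta>0, \<theta>1, \<theta>2, \<theta>3] ! i) a)) = wedge6 (ext \<theta>0 \<theta>1) (ext \<theta>2 \<theta>3)"
proof -
  have "det (mat 0 0 f) = (1 :: real)" for f
    by (simp add: det_dim_zero)
  then show ?thesis
    by (cases \<theta>0; cases \<theta>1; cases \<theta>2; cases \<theta>3)
      (simp add: numeral_eq_Suc det_mat_Suc algebra_simps)
qed

text \<open>Components of the 2-form \<open>g\<close> in the new coordinates, with \<open>P\<close>
  as the Jacobian matrix of the old coordinates with respect to the new ones.\<close>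

definition pull :: "real mat \<Rightarrow> real6 \<Rightarrow> nat \<Rightarrow> nat \<Rightarrow> real" where
  "pull P g r s = (\<Sum>c\<in>idx4. \<Sum>d\<in>idx4. P $$ (c, r) * P $$ (d, s) * comp6 g c d)"

lemma comp6_linear: "comp6 (f + g) i j = comp6 f i j + comp6 g i j" "comp6 (t *\<^sub>R f) i j = t * comp6 f i j"
  by (cases f; cases g; simp)+

lemma linear_pull: "linear (\<lambda>g. pull P g r s)"
  by (rule linearI)
    (simp_all add: pull_def comp6_linear sum_distrib_left sum.distrib algebra_simps)

lemma comp6_ext: "c < 4 \<Longrightarrow> d < 4 \<Longrightarrow> comp6 (ext x y) c d = comp4 x c * comp4 y d - comp4 x d * comp4 y c"
  unfolding nat_less_4 by (cases x; cases y; elim disjE) simp_all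

lemma pull_ext:
  "pull P (ext x y) r s = (\<Sum>c\<in>idx4. comp4 x c * P $$ (c, r)) * (\<Sum>d\<in>idx4. comp4 y d * P $$ (d, s))
    - (\<Sum>c\<in>idx4. comp4 y c * P $$ (c, r)) * (\<Sum>d\<in>idx4. comp4 x d * P $$ (d, s))"
proof -
  have "pull P (ext x y) r s
      = (\<Sum>c\<in>idx4. \<Sum>d\<in>idx4. P $$ (c, r) * P $$ (d, s) * (comp4 x c * comp4 y d - comp4 x d * comp4 y c))"
    unfolding pull_def by (intro sum.cong refl) (simp add: comp6_ext idx4_def)
  also have "\<dots> = (\<Sum>c\<in>idx4. \<Sum>d\<in>idx4. (comp4 x c * P $$ (c, r)) * (comp4 y d * P $$ (d, s))
      - (comp4 y c * P $$ (c, r)) * (comp4 x d * P $$ (d, s)))"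
    by (intro sum.cong refl) (simp add: algebra_simps)
  finally show ?thesis
    by (simp add: sum_subtractf sum_product)
qed

lemma sum_rotate:
  "(\<Sum>b\<in>B. \<Sum>c\<in>C. \<Sum>d\<in>D. g b c d) = (\<Sum>c\<in>C. \<Sum>d\<in>D. \<Sum>b\<in>B. g b c d)"
  by (rule trans[OF sum.swap]) (intro sum.cong refl sum.swap)

text \<open>The upper indices are absorbed first: rows \<open>i\<close> and \<open>j\<close> of
  \<open>Q\<close> are the new coordinate differentials, and \<open>\<kappa>\<close> is applied to
  their wedge product. The lower indices then form a pullback.\<close>

lemma twisted_transform_pull:
  assumes "antisym_components K"
    and "\<And>a. a < 4 \<Longrightarrow> Q $$ (i, a) = comp4 x a" "\<And>a. a < 4 \<Longrightarrow> Q $$ (j, a) = comp4 y a"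
  shows "twisted_transform P Q K i j r s = sgn (det P) * pull P (kappa6 K (ext x y)) r s"
proof -
  have K: "(\<Sum>a\<in>idx4. \<Sum>b\<in>idx4. comp4 x a * comp4 y b * K a b c d) = comp6 (kappa6 K (ext x y)) c d"
    if "c < 4" "d < 4" for c d
  proof -
    have "(\<Sum>b\<in>idx4. K a b c d * comp4 y b) = comp6 (Pform K y a) c d" if "a \<in> idx4" for a
    proof -
      have "a < 4"
        using that by (simp add: idx4_def)
      from comp6_form6[OF two_form_K_contracted[OF assms(1) this] \<open>c < 4\<close> \<open>d < 4\<close>, of y]
      show ?thesis
        by (simp add: form6_K_contracted[OF assms(1)])
    qed
    then have "(\<Sum>a\<in>idx4. comp4 x a * (\<Sum>b\<in>idx4. K a b c d * comp4 y b))
        = (\<Sum>a\<in>idx4. comp4 x a * comp6 (Pform K y a) c d)"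
      by simp
    then show ?thesis
      by (simp add: kappa6_ext[OF assms(1)] sum_idx4 comp6_linear algebra_simps)
  qed
  have "(\<Sum>a\<in>idx4. \<Sum>b\<in>idx4. \<Sum>c\<in>idx4. \<Sum>d\<in>idx4. Q $$ (i, a) * Q $$ (j, b) * P $$ (c, r) * P $$ (d, s) * K a b c d)
      = (\<Sum>a\<in>idx4. \<Sum>b\<in>idx4. \<Sum>c\<in>idx4. \<Sum>d\<in>idx4. P $$ (c, r) * P $$ (d, s) * (comp4 x a * comp4 y b * K a b c d))"
    using assms(2,3) by (intro sum.cong refl) (simp add: idx4_def)
  also have "\<dots> = (\<Sum>c\<in>idx4. \<Sum>d\<in>idx4. \<Sum>a\<in>idx4. \<Sum>b\<in>idx4. P $$ (c, r) * P $$ (d, s) * (comp4 x a * comp4 y b * K a b c d))"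
    by (rule trans[OF sum.cong[OF refl sum_rotate] sum_rotate])
  also have "\<dots> = (\<Sum>c\<in>idx4. \<Sum>d\<in>idx4. P $$ (c, r) * P $$ (d, s) * (\<Sum>a\<in>idx4. \<Sum>b\<in>idx4. comp4 x a * comp4 y b * K a b c d))"
    by (simp only: sum_distrib_left)
  also have "\<dots> = pull P (kappa6 K (ext x y)) r s"
    unfolding pull_def
  proof (intro sum.cong refl)
    fix c d
    assume "c \<in> idx4" "d \<in> idx4"
    then have "c < 4" "d < 4"
      by (simp_all add: idx4_def)
    then show "P $$ (c, r) * P $$ (d, s) * (\<Sum>a\<in>idx4. \<Sum>b\<in>idx4. comp4 x a * comp4 y b * K a b c d)
        = P $$ (c, r) * P $$ (d, s) * comp6 (kappa6 K (ext x y)) c d"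
      by (simp only: K)
  qed
  finally show ?thesis
    by (simp add: twisted_transform_def)
qed

lemma normal_frame_scale:
  assumes "linear k" "normal_frame k f1 f2 f3 f4 f5 f6"
  shows "normal_frame k (D *\<^sub>R f1) (D *\<^sub>R f2) (D *\<^sub>R f3) (D *\<^sub>R f4) (D *\<^sub>R f5) (D *\<^sub>R f6)"
proof -
  have c: "complex_plane k a b (D *\<^sub>R f) (D *\<^sub>R g)" if "complex_plane k a b f g" for a b f g
    using that by (simp add: complex_plane_def linear_cmul[OF assms(1)] scaleR_add_right
        scaleR_diff_right mult.commute)
  have r: "real_plane k a b (D *\<^sub>R f) (D *\<^sub>R g)" if "real_plane k a b f g" for a b f g
    using that by (simp add: real_plane_def linear_cmul[OF assms(1)] scaleR_add_right mult.commute)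
  have c2: "chain2 k a b (D *\<^sub>R f1) (D *\<^sub>R f2) (D *\<^sub>R f4) (D *\<^sub>R f5)"
    if "chain2 k a b f1 f2 f4 f5" for a b
    using that by (simp add: chain2_def linear_cmul[OF assms(1)] scaleR_add_right
        scaleR_diff_right mult.commute)
  have c3: "chain3 k a b (D *\<^sub>R f1) (D *\<^sub>R f2) (D *\<^sub>R f3) (D *\<^sub>R f4) (D *\<^sub>R f5) (D *\<^sub>R f6)"
    if "chain3 k a b f1 f2 f3 f4 f5 f6" for a b
    using that by (simp add: chain3_def linear_cmul[OF assms(1)] scaleR_add_right
        scaleR_diff_right mult.commute)
  from assms(2) show ?thesis
    unfolding normal_frame_def[of k f1]
    by (elim disjE exE conjE)
      (rule normal_frame_I[OF _ c c c] normal_frame_IV[OF _ c c r] normal_frame_VI[OF _ c r r]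
        normal_frame_VII[OF r r r] normal_frame_II[OF _ c2 c] normal_frame_V[OF _ c2 r]
        normal_frame_III[OF _ c3]; assumption)+
qed

section \<open>Reading off the seven matrices\<close>

lemma nat_less_6: "i < 6 \<longleftrightarrow> i = 0 \<or> i = 1 \<or> i = 2 \<or> i = 3 \<or> i = 4 \<or> i = (5::nat)"
  by auto

lemma mat_eq_rows_list:
  fixes M :: "real mat"
  assumes "M \<in> carrier_mat 6 6" "length rs = 6" "\<And>I J. I < 6 \<Longrightarrow> J < 6 \<Longrightarrow> M $$ (I, J) = rs ! I ! J"
  shows "M = mat_of_rows_list 6 rs"
  using assms by (intro eq_matI) (auto simp: mat_of_rows_list_def)

text \<open>The functionals \<open>c\<close> are the dual basis of the frame, so column
  \<open>J\<close> lists the coordinates of the image of its \<open>J\<close>-th vector. The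
  alternatives of \<open>normal_frame\<close> are ordered differently from those of
  \<open>metaclass_normal_form\<close>.\<close>

lemma metaclass_of_normal_frame:
  fixes M :: "real mat" and c :: "nat \<Rightarrow> 'a::real_vector \<Rightarrow> real"
  assumes M: "M \<in> carrier_mat 6 6"
    and entry: "\<And>I J. I < 6 \<Longrightarrow> J < 6 \<Longrightarrow> M $$ (I, J) = c I (k ([f1, f2, f3, f4, f5, f6] ! J))"
    and lin: "\<And>I. linear (c I)"
    and dual: "\<And>I J. I < 6 \<Longrightarrow> J < 6 \<Longrightarrow> c I ([f1, f2, f3, f4, f5, f6] ! J) = (if I = J then 1 else 0)"
    and nf: "normal_frame k f1 f2 f3 f4 f5 f6"
  shows "metaclass_normal_form M"
proof -
  have col: "\<And>I. I < 6 \<Longrightarrow> M $$ (I, 0) = c I (k f1)" "\<And>I. I < 6 \<Longrightarrow> M $$ (I, 1) = c I (k f2)"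
    "\<And>I. I < 6 \<Longrightarrow> M $$ (I, 2) = c I (k f3)" "\<And>I. I < 6 \<Longrightarrow> M $$ (I, 3) = c I (k f4)"
    "\<And>I. I < 6 \<Longrightarrow> M $$ (I, 4) = c I (k f5)" "\<And>I. I < 6 \<Longrightarrow> M $$ (I, 5) = c I (k f6)"
    using entry[of _ 0] entry[of _ 1] entry[of _ 2] entry[of _ 3] entry[of _ 4] entry[of _ 5] by simp_all
  have cf: "c I f1 = (if I = 0 then 1 else 0)" "c I f2 = (if I = 1 then 1 else 0)"
    "c I f3 = (if I = 2 then 1 else 0)" "c I f4 = (if I = 3 then 1 else 0)"
    "c I f5 = (if I = 4 then 1 else 0)" "c I f6 = (if I = 5 then 1 else 0)" if "I < 6" for I
    using dual[OF that, of 0] dual[OF that, of 1] dual[OF that, of 2] dual[OF that, of 3]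
      dual[OF that, of 4] dual[OF that, of 5] by simp_all
  note l = linear_add[OF lin] linear_diff[OF lin] linear_cmul[OF lin]
  have M_eq: "M = mat_of_rows_list 6 rs"
    if "length rs = 6" "\<And>I. I < 6 \<Longrightarrow> c I (k f1) = rs ! I ! 0" "\<And>I. I < 6 \<Longrightarrow> c I (k f2) = rs ! I ! 1"
      "\<And>I. I < 6 \<Longrightarrow> c I (k f3) = rs ! I ! 2" "\<And>I. I < 6 \<Longrightarrow> c I (k f4) = rs ! I ! 3"
      "\<And>I. I < 6 \<Longrightarrow> c I (k f5) = rs ! I ! 4" "\<And>I. I < 6 \<Longrightarrow> c I (k f6) = rs ! I ! 5" for rs
  proof (rule mat_eq_rows_list[OF M that(1)])
    fix I J :: nat
    assume I: "I < 6" and "J < 6"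
    from this(2) show "M $$ (I, J) = rs ! I ! J"
      unfolding nat_less_6[of J] by (elim disjE) (simp_all only: col I that)
  qed
  from nf show ?thesis
    unfolding normal_frame_def
  proof (elim disjE exE conjE)
    fix a1 a2 a3 b1 b2 b3
    assume "same_sign [b1, b2, b3]"
      and p: "complex_plane k a1 b1 f1 f4" "complex_plane k a2 b2 f2 f5" "complex_plane k a3 b3 f3 f6"
    moreover have "M = mat_of_rows_list 6
        [[a1,0,0,-b1,0,0],[0,a2,0,0,-b2,0],[0,0,a3,0,0,-b3],
         [b1,0,0,a1,0,0],[0,b2,0,0,a2,0],[0,0,b3,0,0,a3]]"
      using p by (intro M_eq; simp add: complex_plane_def real_plane_def l cf; unfold nat_less_6; elim disjE; simp)
    ultimately show ?thesis
      unfolding metaclass_normal_form_def by - (rule disjI1, intro exI conjI)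
  next
    fix a1 a2 a3 b1 b2 b3
    assume "same_sign [b1, b2]"
      and p: "complex_plane k a1 b1 f1 f4" "complex_plane k a2 b2 f2 f5" "real_plane k a3 b3 f3 f6"
    moreover have "M = mat_of_rows_list 6
        [[a1,0,0,-b1,0,0],[0,a2,0,0,-b2,0],[0,0,a3,0,0,b3],
         [b1,0,0,a1,0,0],[0,b2,0,0,a2,0],[0,0,b3,0,0,a3]]"
      using p by (intro M_eq; simp add: complex_plane_def real_plane_def l cf; unfold nat_less_6; elim disjE; simp)
    ultimately show ?thesis
      unfolding metaclass_normal_form_def by - (rule disjI2, rule disjI2, rule disjI2, rule disjI1, intro exI conjI)
  next
    fix a1 a2 a3 b1 b2 b3
    assume "same_sign [b1]"
      and p: "complex_plane k a1 b1 f1 f4" "real_plane k a2 b2 f2 f5" "real_plane k a3 b3 f3 f6"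
    moreover have "M = mat_of_rows_list 6
        [[a1,0,0,-b1,0,0],[0,a2,0,0,b2,0],[0,0,a3,0,0,b3],
         [b1,0,0,a1,0,0],[0,b2,0,0,a2,0],[0,0,b3,0,0,a3]]"
      using p by (intro M_eq; simp add: complex_plane_def real_plane_def l cf; unfold nat_less_6; elim disjE; simp)
    ultimately show ?thesis
      unfolding metaclass_normal_form_def by - (rule disjI2, rule disjI2, rule disjI2, rule disjI2, rule disjI2, rule disjI1, intro exI conjI)
  next
    fix a1 a2 a3 b1 b2 b3
    assume p: "real_plane k a1 b1 f1 f4" "real_plane k a2 b2 f2 f5" "real_plane k a3 b3 f3 f6"
    have "M = mat_of_rows_list 6
        [[a1,0,0,b1,0,0],[0,a2,0,0,b2,0],[0,0,a3,0,0,b3],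
         [b1,0,0,a1,0,0],[0,b2,0,0,a2,0],[0,0,b3,0,0,a3]]"
      using p by (intro M_eq; simp add: complex_plane_def real_plane_def l cf; unfold nat_less_6; elim disjE; simp)
    then show ?thesis
      unfolding metaclass_normal_form_def by - (rule disjI2, rule disjI2, rule disjI2, rule disjI2, rule disjI2, rule disjI2, intro exI)
  next
    fix a1 a2 b1 b2
    assume "same_sign [b1, b2]" and p: "chain2 k a1 b1 f1 f2 f4 f5" "complex_plane k a2 b2 f3 f6"
    moreover have "M = mat_of_rows_list 6
        [[a1,-b1,0,0,0,0],[b1,a1,0,0,0,0],[0,0,a2,0,0,-b2],
         [0,1,0,a1,b1,0],[1,0,0,-b1,a1,0],[0,0,b2,0,0,a2]]"
      using p by (intro M_eq; simp add: chain2_def complex_plane_def real_plane_def l cf; unfold nat_less_6; elim disjE; simp)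
    ultimately show ?thesis
      unfolding metaclass_normal_form_def by - (rule disjI2, rule disjI1, intro exI conjI)
  next
    fix a1 a2 b1 b2
    assume "same_sign [b1]" and p: "chain2 k a1 b1 f1 f2 f4 f5" "real_plane k a2 b2 f3 f6"
    moreover have "M = mat_of_rows_list 6
        [[a1,-b1,0,0,0,0],[b1,a1,0,0,0,0],[0,0,a2,0,0,b2],
         [0,1,0,a1,b1,0],[1,0,0,-b1,a1,0],[0,0,b2,0,0,a2]]"
      using p by (intro M_eq; simp add: chain2_def complex_plane_def real_plane_def l cf; unfold nat_less_6; elim disjE; simp)
    ultimately show ?thesis
      unfolding metaclass_normal_form_def by - (rule disjI2, rule disjI2, rule disjI2, rule disjI2, rule disjI1, intro exI conjI)
  next
    fix a b
    assume "same_sign [b]" and p: "chain3 k a b f1 f2 f3 f4 f5 f6"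
    moreover have "M = mat_of_rows_list 6
        [[a,-b,0,0,0,0],[b,a,0,0,0,0],[1,0,a,0,0,-b],
         [0,0,0,a,b,1],[0,0,1,-b,a,0],[0,1,b,0,0,a]]"
      using p by (intro M_eq; simp add: chain3_def l cf; unfold nat_less_6; elim disjE; simp)
    ultimately show ?thesis
      unfolding metaclass_normal_form_def by - (rule disjI2, rule disjI2, rule disjI1, intro exI conjI)
  qed
qed

theorem mainTheorem3:
  fixes K :: "nat \<Rightarrow> nat \<Rightarrow> nat \<Rightarrow> nat \<Rightarrow> real"
  assumes "antisym_components K"
    and "skewon_free K"
    and "kappa_invertible K"
    and "\<not> fresnel_contains_plane K"
  shows "\<exists>P Q. P \<in> carrier_mat 4 4 \<and> Q \<in> carrier_mat 4 4 \<and> P * Q = 1\<^sub>m 4 \<and>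
           metaclass_normal_form (kappa_matrix (twisted_transform P Q K))"
proof -
  let ?k = "kappa6 K"
  have "\<forall>f c. ?k f = c *\<^sub>R f \<longrightarrow> wedge6 f f = 0 \<longrightarrow> f = 0"
    using fresnel_contains_plane_of_null_eigenvector[OF assms(1,2)] assms(4) by blast
  then obtain f1 f2 f3 f4 f5 f6 where f: "hyperbolic_basis wedge6 f1 f2 f3 f4 f5 f6"
    "normal_frame ?k f1 f2 f3 f4 f5 f6"
    using ex_normal_frame_wedge6[OF selfadjoint_pair_wedge6[OF assms(1,2)]] by blast
  obtain g1 g2 g3 g4 g5 g6 where ind: "induced_basis g1 g2 g3 g4 g5 g6"
    and g: "hyperbolic_basis wedge6 g1 g2 g3 g4 g5 g6" "normal_frame ?k g1 g2 g3 g4 g5 g6"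
    using ex_induced_normal_frame[OF f] by blast
  obtain D \<theta>0 \<theta>1 \<theta>2 \<theta>3 where "induced_by D \<theta>0 \<theta>1 \<theta>2 \<theta>3 g1 g2 g3 g4 g5 g6"
    using ind unfolding induced_basis_def by blast
  then have D: "D \<noteq> 0" and e: "D *\<^sub>R g1 = ext \<theta>0 \<theta>1" "D *\<^sub>R g2 = ext \<theta>0 \<theta>2" "D *\<^sub>R g3 = ext \<theta>0 \<theta>3"
    "D *\<^sub>R g4 = ext \<theta>2 \<theta>3" "D *\<^sub>R g5 = ext \<theta>3 \<theta>1" "D *\<^sub>R g6 = ext \<theta>1 \<theta>2"
    by (simp_all add: induced_by_def)
  define \<theta> where "\<theta> i = [\<theta>0, \<theta>1, \<theta>2, \<theta>3] ! i" for i
  \<comment> \<open>The new coordinate differentials at the point are the coframe, so its members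
    are the rows of the Jacobian matrix \<open>Q\<close>.\<close>
  define Q where "Q = mat 4 4 (\<lambda>(i, a). comp4 (\<theta> i) a)"
  have Q: "Q \<in> carrier_mat 4 4"
    by (simp add: Q_def)
  have row: "Q $$ (i, a) = comp4 (\<theta> i) a" if "i < 4" "a < 4" for i a
    using that by (simp add: Q_def)
  have "det Q = wedge6 (ext \<theta>0 \<theta>1) (ext \<theta>2 \<theta>3)"
    unfolding Q_def \<theta>_def by (rule det_frame)
  also have "\<dots> = D * D * wedge6 g1 g4"
    by (simp add: bilinear_lmul[OF bilinear_wedge6] bilinear_rmul[OF bilinear_wedge6] flip: e)
  finally have detQ: "det Q = D * D"
    using hyperbolic_basis_wedge6(4)[OF g(1)] by simp
  then have "Q \<in> Units (ring_mat TYPE(real) 4 ())"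
    using D by (intro det_non_zero_imp_unit[OF Q]) simp
  then obtain P where P: "P \<in> carrier_mat 4 4" "P * Q = 1\<^sub>m 4" "Q * P = 1\<^sub>m 4"
    by (auto simp: Units_def ring_mat_def)
  \<comment> \<open>The determinant of the coframe is a square, so the twisted sign is +1 even for
    negative \<open>D\<close>.\<close>
  have "0 < det P * (D * D)"
    using det_mult[OF P(1) Q] P(2) detQ by simp
  moreover have "D * D > 0"
    using D by (simp add: zero_less_mult_iff) linarith
  ultimately have "det P > 0"
    by (rule zero_less_mult_pos2)
  then have sgn: "sgn (det P) = 1"
    by simp
  have delta: "(\<Sum>c\<in>idx4. comp4 (\<theta> i) c * P $$ (c, r)) = (if i = r then 1 else 0)"
    if "i < 4" "r < 4" for i r
  proof -
    have "(Q * P) $$ (i, r) = (\<Sum>c<4. Q $$ (i, c) * P $$ (c, r))"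
      using that P(1) Q by (simp add: scalar_prod_def atLeast0LessThan)
    then show ?thesis
      using that P(3) by (simp add: row idx4_def)
  qed
  have T: "twisted_transform P Q K i j r s
      = pull P (?k (ext (\<theta> i) (\<theta> j))) r s" if "i < 4" "j < 4" for i j r s
    using twisted_transform_pull[OF assms(1) row[OF that(1)] row[OF that(2)], where P = P] sgn by simp
  have d: "pull P (ext (\<theta> i) (\<theta> j)) r s
      = (if i = r \<and> j = s then 1 else 0) - (if j = r \<and> i = s then 1 else 0)"
    if "i < 4" "j < 4" "r < 4" "s < 4" for i j r s
    unfolding pull_ext delta[OF that(1,3)] delta[OF that(1,4)] delta[OF that(2,3)] delta[OF that(2,4)]
    by (cases "i = r"; cases "j = s"; cases "j = r"; cases "i = s") simp_all
  \<comment> \<open>Coordinates with respect to the products of the coframe in the order of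
    \<open>pairsO\<close>; the pair 31, rather than 13, matches
    \<open>ext \<theta>3 \<theta>1\<close>.\<close>
  let ?c = "\<lambda>I g. pull P g (fst (pairsO ! I)) (snd (pairsO ! I))"
  let ?es = "[ext \<theta>0 \<theta>1, ext \<theta>0 \<theta>2, ext \<theta>0 \<theta>3, ext \<theta>2 \<theta>3, ext \<theta>3 \<theta>1, ext \<theta>1 \<theta>2]"
  have es: "?es ! J = ext (\<theta> (fst (pairsO ! J))) (\<theta> (snd (pairsO ! J)))"
    and pairs: "fst (pairsO ! J) < 4" "snd (pairsO ! J) < 4" if "J < 6" for J
    using that unfolding nat_less_6 by (auto simp: pairsO_def \<theta>_def)
  have "metaclass_normal_form (kappa_matrix (twisted_transform P Q K))"
  proof (rule metaclass_of_normal_frame[of _ ?c])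
    show "kappa_matrix (twisted_transform P Q K) \<in> carrier_mat 6 6"
      by (simp add: kappa_matrix_def)
    show "kappa_matrix (twisted_transform P Q K) $$ (I, J) = ?c I (?k (?es ! J))" if "I < 6" "J < 6" for I J
      using that by (simp add: kappa_matrix_def T pairs es)
    show "linear (?c I)" for I
      by (rule linear_pull)
    show "?c I (?es ! J) = (if I = J then 1 else 0)" if "I < 6" "J < 6" for I J
    proof -
      have "?c I (?es ! J) = (if fst (pairsO ! J) = fst (pairsO ! I) \<and> snd (pairsO ! J) = snd (pairsO ! I) then 1 else 0)
          - (if snd (pairsO ! J) = fst (pairsO ! I) \<and> fst (pairsO ! J) = snd (pairsO ! I) then 1 else 0)"
        unfolding es[OF that(2)] by (rule d) (simp_all add: pairs that)
      then show ?thesis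
        using that unfolding nat_less_6 by (elim disjE) (simp_all add: pairsO_def)
    qed
    show "normal_frame ?k (ext \<theta>0 \<theta>1) (ext \<theta>0 \<theta>2) (ext \<theta>0 \<theta>3) (ext \<theta>2 \<theta>3) (ext \<theta>3 \<theta>1) (ext \<theta>1 \<theta>2)"
      using normal_frame_scale[OF linear_kappa6 g(2), of D] by (simp only: e)
  qed
  with P(1,2) Q show ?thesis
    by blast
qed

end
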